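(* Let $M=G/\Gamma$ be a nilmanifold which is not a torus, endowed with an invariant complex structure $J$. Then $M$ does not admit any $J$-Hermitian invariant static metric with constant $\lambda=0$.
   Context: A nilmanifold is a compact quotient $G/\Gamma$ of a simply connected nilpotent Lie group $G$ by a discrete subgroup $\Gamma$. An invariant Riemannian metric (respectively complex structure) on $G/\Gamma$ is one induced by an inner product (respectively an integrable complex structure) on the Lie algebra $\mathfrak{g}$ of $G$, i.e. by a left-invariant one on $G$. Let $(M,J)$ be a complex manifold of real dimension $2n$ and $g$ a $J$-Hermitian metric on it, with fundamental form $\omega(\cdot,\cdot)=g(\cdot,J\cdot)$. The Bismut connection $\nabla^B$ is the unique connection with $\nabla^B J=\nabla^B g=0$ such that, with $T^B$ its torsion, $c(X,Y,Z)=g(X,T^B(Y,Z))$ is totally skew-symmetric. The metric $g$ is SKT if $dc=0$, equivalently $\partial\overline{\partial}\omega=0$. With the curvature convention $R^B(X,Y)Z=\nabla^B_{[X,Y]}Z-[\nabla^B_X,\nabla^B_Y]Z$, the Bismut Ricci form is $\rho^B(X,Y)=\frac12\sum_{k=1}^{2n}g(R^B(X,Y)\mathbf{e}_k,J\mathbf{e}_k)$, where $\{\mathbf{e}_k\}$ is a local $g$-orthonormal frame of $TM$; $(\rho^B)^{(1,1)}$ denotes its $(1,1)$-part with respect to $J$. The metric $g$ is called static (with constant $\lambda$) if it is SKT and $-(\rho^B)^{(1,1)}=\lambda\,\omega$ for some real constant $\lambda$. *)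

theory Defs
  imports "HOL-Analysis.Analysis" "HOL-Algebra.Generated_Groups"
begin

section \<open>Smooth manifolds\<close>

(* C^k on an open set S; the derivatives are taken at points of S, so only values on S matter. *)
primrec ck_on :: "nat \<Rightarrow> 'a::real_normed_vector set \<Rightarrow> ('a \<Rightarrow> 'b::real_normed_vector) \<Rightarrow> bool" where
  "ck_on 0 S f \<longleftrightarrow> continuous_on S f"
| "ck_on (Suc k) S f \<longleftrightarrow>
     (\<forall>x\<in>S. f differentiable (at x)) \<and> (\<forall>v. ck_on k S (\<lambda>x. frechet_derivative f (at x) v))"

definition smooth_on :: "'a::real_normed_vector set \<Rightarrow> ('a \<Rightarrow> 'b::real_normed_vector) \<Rightarrow> bool" where
  "smooth_on S f \<longleftrightarrow> (\<forall>k. ck_on k S f)"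

(* A chart is a pair of its domain and its coordinate map; values outside the domain are irrelevant. *)
type_synonym ('m, 'e) chart = "'m set \<times> ('m \<Rightarrow> 'e)"

definition smooth_manifold ::
    "'m topology \<Rightarrow> ('m, 'e::euclidean_space) chart set \<Rightarrow> bool" where
  "smooth_manifold X A \<longleftrightarrow>
     Hausdorff_space X \<and> second_countable X \<and>
     topspace X = (\<Union>(U, \<phi>)\<in>A. U) \<and>
     (\<forall>(U, \<phi>)\<in>A. openin X U \<and> open (\<phi> ` U) \<and>
        homeomorphic_map (subtopology X U) (top_of_set (\<phi> ` U)) \<phi>) \<and>
     (\<forall>(U, \<phi>)\<in>A. \<forall>(V, \<psi>)\<in>A. smooth_on (\<phi> ` (U \<inter> V)) (\<psi> \<circ> inv_into U \<phi>))"

definition smooth_map ::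
    "'m topology \<Rightarrow> ('m, 'e::euclidean_space) chart set \<Rightarrow>
     'n topology \<Rightarrow> ('n, 'f::euclidean_space) chart set \<Rightarrow> ('m \<Rightarrow> 'n) \<Rightarrow> bool" where
  "smooth_map X A Y B f \<longleftrightarrow>
     continuous_map X Y f \<and>
     (\<forall>(U, \<phi>)\<in>A. \<forall>(V, \<psi>)\<in>B. smooth_on (\<phi> ` {x \<in> U. f x \<in> V}) (\<psi> \<circ> f \<circ> inv_into U \<phi>))"

definition diffeomorphic ::
    "'m topology \<Rightarrow> ('m, 'e::euclidean_space) chart set \<Rightarrow>
     'n topology \<Rightarrow> ('n, 'f::euclidean_space) chart set \<Rightarrow> bool" where
  "diffeomorphic X A Y B \<longleftrightarrow>
     (\<exists>f h. homeomorphic_maps X Y f h \<and> smooth_map X A Y B f \<and> smooth_map Y B X A h)"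

definition product_atlas ::
    "('m, 'e) chart set \<Rightarrow> ('n, 'f) chart set \<Rightarrow> ('m \<times> 'n, 'e \<times> 'f) chart set" where
  "product_atlas A B = {(U \<times> V, map_prod \<phi> \<psi>) |U \<phi> V \<psi>. (U, \<phi>) \<in> A \<and> (V, \<psi>) \<in> B}"

section \<open>Lie groups and nilmanifolds\<close>

definition lie_group ::
    "('g::topological_space, 'k) monoid_scheme \<Rightarrow> ('g, 'e::euclidean_space) chart set \<Rightarrow> bool" where
  "lie_group G A \<longleftrightarrow>
     group G \<and>
     smooth_manifold (top_of_set (carrier G)) A \<and>
     smooth_map (prod_topology (top_of_set (carrier G)) (top_of_set (carrier G))) (product_atlas A A)
       (top_of_set (carrier G)) A (\<lambda>(x, y). x \<otimes>\<^bsub>G\<^esub> y) \<and>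
     smooth_map (top_of_set (carrier G)) A (top_of_set (carrier G)) A (\<lambda>x. inv\<^bsub>G\<^esub> x)"

primrec lower_central_series :: "('g, 'k) monoid_scheme \<Rightarrow> nat \<Rightarrow> 'g set" where
  "lower_central_series G 0 = carrier G"
| "lower_central_series G (Suc k) =
     generate G {x \<otimes>\<^bsub>G\<^esub> y \<otimes>\<^bsub>G\<^esub> inv\<^bsub>G\<^esub> x \<otimes>\<^bsub>G\<^esub> inv\<^bsub>G\<^esub> y |x y.
       x \<in> carrier G \<and> y \<in> lower_central_series G k}"

definition nilpotent_group :: "('g, 'k) monoid_scheme \<Rightarrow> bool" where
  "nilpotent_group G \<longleftrightarrow> group G \<and> (\<exists>k. lower_central_series G k = {\<one>\<^bsub>G\<^esub>})"

definition quotient_topology :: "'a topology \<Rightarrow> ('a \<Rightarrow> 'b) \<Rightarrow> 'b topology" where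
  "quotient_topology X p =
     topology (\<lambda>W. W \<subseteq> p ` topspace X \<and> openin X {x \<in> topspace X. p x \<in> W})"

lemma openin_quotient_topology:
  "openin (quotient_topology X p) W \<longleftrightarrow>
     W \<subseteq> p ` topspace X \<and> openin X {x \<in> topspace X. p x \<in> W}"
proof -
  have "openin X {x \<in> topspace X. p x \<in> S \<inter> T}"
    if "openin X {x \<in> topspace X. p x \<in> S}" "openin X {x \<in> topspace X. p x \<in> T}" for S T
  proof -
    have "{x \<in> topspace X. p x \<in> S \<inter> T} =
        {x \<in> topspace X. p x \<in> S} \<inter> {x \<in> topspace X. p x \<in> T}" by blast
    with that show ?thesis by (simp add: openin_Int)
  qed
  moreover have "openin X {x \<in> topspace X. p x \<in> \<Union>\<K>}"
    if "\<forall>K\<in>\<K>. openin X {x \<in> topspace X. p x \<in> K}" for \<K>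
  proof -
    have "{x \<in> topspace X. p x \<in> \<Union>\<K>} = (\<Union>K\<in>\<K>. {x \<in> topspace X. p x \<in> K})" by blast
    with that show ?thesis by auto
  qed
  ultimately have "istopology (\<lambda>W. W \<subseteq> p ` topspace X \<and> openin X {x \<in> topspace X. p x \<in> W})"
    unfolding istopology_def by blast
  then show ?thesis
    by (simp add: quotient_topology_def topology_inverse')
qed

(* The compact quotient is the space of cosets H g (written H #> g), i.e. the quotient of G by
   left translations by elements of the subgroup H: these are the translations under which
   left-invariant structures on G descend.  Inversion identifies it with the space of cosets g H. *)
definition quotient_space :: "('g::topological_space, 'k) monoid_scheme \<Rightarrow> 'g set \<Rightarrow> 'g set topology" where
  "quotient_space G H = quotient_topology (top_of_set (carrier G)) (\<lambda>g. H #>\<^bsub>G\<^esub> g)"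

(* The charts of the quotient are the charts of G, restricted to open sets on which the projection
   is injective; for discrete H this makes the projection a local diffeomorphism. *)
definition quotient_atlas ::
    "('g::topological_space, 'k) monoid_scheme \<Rightarrow> ('g, 'e) chart set \<Rightarrow> 'g set \<Rightarrow> ('g set, 'e) chart set" where
  "quotient_atlas G A H =
     {((\<lambda>g. H #>\<^bsub>G\<^esub> g) ` W, \<phi> \<circ> inv_into W (\<lambda>g. H #>\<^bsub>G\<^esub> g)) |U \<phi> W.
        (U, \<phi>) \<in> A \<and> openin (top_of_set (carrier G)) W \<and> W \<subseteq> U \<and>
        inj_on (\<lambda>g. H #>\<^bsub>G\<^esub> g) W}"

definition nilmanifold ::
    "('g::topological_space, 'k) monoid_scheme \<Rightarrow> ('g, 'e::euclidean_space) chart set \<Rightarrow> 'g set \<Rightarrow> bool" where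
  "nilmanifold G A H \<longleftrightarrow>
     lie_group G A \<and> simply_connected (carrier G) \<and> nilpotent_group G \<and>
     subgroup H G \<and> discrete H \<and> compact_space (quotient_space G H)"

definition vector_group :: "'e::euclidean_space monoid" where
  "vector_group = \<lparr>carrier = UNIV, mult = (+), one = 0\<rparr>"

definition integer_lattice :: "'e::euclidean_space set" where
  "integer_lattice = {x. \<forall>b\<in>Basis. x \<bullet> b \<in> \<int>}"

(* Being a torus means being diffeomorphic to the standard torus R^m / Z^m, where m is the
   dimension of the model space 'e of G (and hence of the quotient). *)
definition is_torus ::
    "('g::topological_space, 'k) monoid_scheme \<Rightarrow> ('g, 'e::euclidean_space) chart set \<Rightarrow> 'g set \<Rightarrow> bool" where
  "is_torus G A H \<longleftrightarrow>
     diffeomorphic (quotient_space G H) (quotient_atlas G A H)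
       (quotient_space (vector_group :: 'e monoid) integer_lattice)
       (quotient_atlas vector_group {(UNIV, \<lambda>x::'e. x)} integer_lattice)"

section \<open>The Lie algebra of a Lie group\<close>

(* A chart (U, phi) around the identity identifies the Lie algebra T_1 G with the model space 'e.
   left_field is the left-invariant vector field with value v at the identity, read in this chart:
   at the point with coordinates x it is the derivative of the left translation by that point,
   applied to v. *)
definition left_field ::
    "('g, 'k) monoid_scheme \<Rightarrow> ('g, 'e::euclidean_space) chart \<Rightarrow> 'e \<Rightarrow> 'e \<Rightarrow> 'e" where
  "left_field G \<kappa> v x = (case \<kappa> of (U, \<phi>) \<Rightarrow>
     frechet_derivative (\<lambda>y. \<phi> (inv_into U \<phi> x \<otimes>\<^bsub>G\<^esub> inv_into U \<phi> y)) (at (\<phi> \<one>\<^bsub>G\<^esub>)) v)"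

(* The value at the identity of the commutator [V,W] = DW(V) - DV(W) of left-invariant fields. *)
definition lie_bracket ::
    "('g, 'k) monoid_scheme \<Rightarrow> ('g, 'e::euclidean_space) chart \<Rightarrow> 'e \<Rightarrow> 'e \<Rightarrow> 'e" where
  "lie_bracket G \<kappa> v w =
     frechet_derivative (left_field G \<kappa> w) (at (snd \<kappa> \<one>\<^bsub>G\<^esub>)) v -
     frechet_derivative (left_field G \<kappa> v) (at (snd \<kappa> \<one>\<^bsub>G\<^esub>)) w"

section \<open>Invariant Hermitian geometry\<close>

(* In the rest, br is the bracket of a Lie algebra with underlying vector space 'e.  Invariant
   tensors and connections are given by their values on left-invariant vector fields; the functions
   occurring in the defining formulas are then constant, so that no derivative of a function is
   left in the covariant derivatives of tensors, in the torsion and curvature, and in the exterior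
   derivative. *)

definition invariant_complex_structure ::
    "('e::euclidean_space \<Rightarrow> 'e \<Rightarrow> 'e) \<Rightarrow> ('e \<Rightarrow> 'e) \<Rightarrow> bool" where
  "invariant_complex_structure br J \<longleftrightarrow>
     linear J \<and> (\<forall>X. J (J X) = - X) \<and>
     (\<forall>X Y. br (J X) (J Y) - J (br (J X) Y) - J (br X (J Y)) - br X Y = 0)"

(* An arbitrary inner product g; the inner product of the class euclidean_space plays no role. *)
definition invariant_metric :: "('e::euclidean_space \<Rightarrow> 'e \<Rightarrow> real) \<Rightarrow> bool" where
  "invariant_metric g \<longleftrightarrow>
     bilinear g \<and> (\<forall>X Y. g X Y = g Y X) \<and> (\<forall>X. X \<noteq> 0 \<longrightarrow> g X X > 0)"

definition hermitian_metric :: "('e::euclidean_space \<Rightarrow> 'e) \<Rightarrow> ('e \<Rightarrow> 'e \<Rightarrow> real) \<Rightarrow> bool" where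
  "hermitian_metric J g \<longleftrightarrow> invariant_metric g \<and> (\<forall>X Y. g (J X) (J Y) = g X Y)"

definition fundamental_form ::
    "('e \<Rightarrow> 'e) \<Rightarrow> ('e \<Rightarrow> 'e \<Rightarrow> real) \<Rightarrow> 'e \<Rightarrow> 'e \<Rightarrow> real" where
  "fundamental_form J g X Y = g X (J Y)"

(* An invariant connection D is written D X Y for the covariant derivative of Y along X. *)
definition torsion ::
    "('e::euclidean_space \<Rightarrow> 'e \<Rightarrow> 'e) \<Rightarrow> ('e \<Rightarrow> 'e \<Rightarrow> 'e) \<Rightarrow> 'e \<Rightarrow> 'e \<Rightarrow> 'e" where
  "torsion br D X Y = D X Y - D Y X - br X Y"

definition torsion_form ::
    "('e::euclidean_space \<Rightarrow> 'e \<Rightarrow> 'e) \<Rightarrow> ('e \<Rightarrow> 'e \<Rightarrow> real) \<Rightarrow> ('e \<Rightarrow> 'e \<Rightarrow> 'e) \<Rightarrow>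
     'e \<Rightarrow> 'e \<Rightarrow> 'e \<Rightarrow> real" where
  "torsion_form br g D X Y Z = g X (torsion br D Y Z)"

definition bismut_connection ::
    "('e::euclidean_space \<Rightarrow> 'e \<Rightarrow> 'e) \<Rightarrow> ('e \<Rightarrow> 'e) \<Rightarrow> ('e \<Rightarrow> 'e \<Rightarrow> real) \<Rightarrow>
     ('e \<Rightarrow> 'e \<Rightarrow> 'e) \<Rightarrow> bool" where
  "bismut_connection br J g D \<longleftrightarrow>
     bilinear D \<and>
     (\<forall>X Y. D X (J Y) = J (D X Y)) \<and>
     (\<forall>X Y Z. g (D X Y) Z + g Y (D X Z) = 0) \<and>
     (\<forall>X Y Z. torsion_form br g D X Y Z = - torsion_form br g D Y X Z \<and>
              torsion_form br g D X Y Z = - torsion_form br g D X Z Y)"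

(* Exterior derivative of an invariant 3-form: only the bracket terms of the Koszul formula. *)
definition ext_deriv3 ::
    "('e \<Rightarrow> 'e \<Rightarrow> 'e) \<Rightarrow> ('e \<Rightarrow> 'e \<Rightarrow> 'e \<Rightarrow> real) \<Rightarrow> 'e \<Rightarrow> 'e \<Rightarrow> 'e \<Rightarrow> 'e \<Rightarrow> real" where
  "ext_deriv3 br c X Y Z W =
     - c (br X Y) Z W + c (br X Z) Y W - c (br X W) Y Z
     - c (br Y Z) X W + c (br Y W) X Z - c (br Z W) X Y"

definition curvature ::
    "('e::euclidean_space \<Rightarrow> 'e \<Rightarrow> 'e) \<Rightarrow> ('e \<Rightarrow> 'e \<Rightarrow> 'e) \<Rightarrow> 'e \<Rightarrow> 'e \<Rightarrow> 'e \<Rightarrow> 'e" where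
  "curvature br D X Y Z = D (br X Y) Z - (D X (D Y Z) - D Y (D X Z))"

definition orthonormal_frame :: "('e::euclidean_space \<Rightarrow> 'e \<Rightarrow> real) \<Rightarrow> 'e set \<Rightarrow> bool" where
  "orthonormal_frame g E \<longleftrightarrow>
     card E = DIM('e) \<and> (\<forall>e\<in>E. \<forall>f\<in>E. g e f = (if e = f then 1 else 0))"

(* rho^B, computed in the orthonormal frame E *)
definition ricci_form ::
    "('e::euclidean_space \<Rightarrow> 'e \<Rightarrow> 'e) \<Rightarrow> ('e \<Rightarrow> 'e) \<Rightarrow> ('e \<Rightarrow> 'e \<Rightarrow> real) \<Rightarrow>
     ('e \<Rightarrow> 'e \<Rightarrow> 'e) \<Rightarrow> 'e set \<Rightarrow> 'e \<Rightarrow> 'e \<Rightarrow> real" where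
  "ricci_form br J g D E X Y = 1/2 * (\<Sum>e\<in>E. g (curvature br D X Y e) (J e))"

(* (1,1)-part of a real 2-form *)
definition part11 :: "('e \<Rightarrow> 'e) \<Rightarrow> ('e \<Rightarrow> 'e \<Rightarrow> real) \<Rightarrow> 'e \<Rightarrow> 'e \<Rightarrow> real" where
  "part11 J \<rho> X Y = 1/2 * (\<rho> X Y + \<rho> (J X) (J Y))"

(* The Bismut connection D is unique and the Ricci form does not depend on the frame E, so it does
   not matter how these two are quantified. *)
definition static_metric ::
    "('e::euclidean_space \<Rightarrow> 'e \<Rightarrow> 'e) \<Rightarrow> ('e \<Rightarrow> 'e) \<Rightarrow> ('e \<Rightarrow> 'e \<Rightarrow> real) \<Rightarrow> real \<Rightarrow> bool" where
  "static_metric br J g lam \<longleftrightarrow>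
     (\<exists>D E. bismut_connection br J g D \<and> orthonormal_frame g E \<and>
        (\<forall>X Y Z W. ext_deriv3 br (torsion_form br g D) X Y Z W = 0) \<and>
        (\<forall>X Y. - part11 J (ricci_form br J g D E) X Y = lam * fundamental_form J g X Y))"

end

theory Submission
  imports Defs
begin

text \<open>
  Let \<open>D\<close> be the Bismut connection of a static metric with constant 0 and \<open>c\<close> its torsion form.
  The traces of \<open>ad X\<close> and of its square vanish because \<open>ad X\<close> is nilpotent.  Tracing \<open>dc = 0\<close>
  and the first Bianchi identity of \<open>D\<close> against the complex structure shows that the trace of the
  Bismut Ricci form is a multiple of the scalar curvature of \<open>D\<close>, which is therefore zero.  On the
  other hand the vanishing traces turn that scalar curvature into \<open>-(|[,]|^2 + |c|^2) / 4\<close>, so the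
  Lie algebra is abelian.

  The Maurer-Cartan form of a Lie group with vanishing bracket is closed, and the Poincare lemma
  provides a local logarithm, whose inverse extends to a homomorphism from the vector group onto
  the connected group \<open>G\<close>.  It is a local diffeomorphism, and the preimage of \<open>\<Gamma>\<close> is a discrete
  cocompact subgroup, that is, a lattice.  Hence the quotient is a torus.
\<close>

section \<open>Calculus of smooth maps\<close>

text \<open>The closedness of \<open>c\<close> is used twice: it leaves derivatives only along the
  last argument in the first Bianchi identity, and traced over \<open>e, J e, f, J f\<close> it
  gives \<open>g \<tau> \<tau> = 2 * P\<close>, exactly the ratio at which the quadratic torsion
  terms of the traced Bianchi identity cancel. Nilpotency is used twice too:
  \<open>tr (br X) = 0\<close> removes divergences, and the vanishing Killing trace removes the
  mixed products of structure constants, so that squares of one sign remain. On the group side the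
  bracket is known only through left fields in one chart, where the product is partially defined;
  Jacobi and the nilpotency of \<open>br v\<close> therefore come from differentiating group
  identities near the identity element. The extension need not be injective, but its kernel lies in
  the preimage of \<open>\<Gamma>\<close>, so a kernel trivial near 0 is enough.\<close>

lemma ck_on_cong:
  assumes "open S" "\<And>x. x \<in> S \<Longrightarrow> f x = g x" "ck_on k S f"
  shows "ck_on k S g"
  using assms(2,3)
proof (induction k arbitrary: f g)
  case 0
  then show ?case by (simp cong: continuous_on_cong)
next
  case (Suc k)
  have der: "(g has_derivative frechet_derivative f (at x)) (at x)" if "x \<in> S" for x
    using Suc.prems that assms(1) has_derivative_transform_within_open[of f _ x UNIV S g]
    by (auto simp: frechet_derivative_works[symmetric])
  then have eq: "frechet_derivative f (at x) v = frechet_derivative g (at x) v" if "x \<in> S" for x v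
    using that frechet_derivative_at by metis
  show ?case
    using der Suc.IH[of "\<lambda>x. frechet_derivative f (at x) v" "\<lambda>x. frechet_derivative g (at x) v" for v]
      Suc.prems eq by (auto simp: differentiable_def)
qed

lemma ck_on_subset: "ck_on k S f \<Longrightarrow> T \<subseteq> S \<Longrightarrow> ck_on k T f"
  by (induction k arbitrary: f) (auto intro: continuous_on_subset)

lemma ck_on_Suc_imp: "ck_on (Suc k) S f \<Longrightarrow> ck_on k S f"
proof (induction k arbitrary: f)
  case 0
  then show ?case
    by (metis ck_on.simps(1,2) differentiable_at_withinI differentiable_imp_continuous_on differentiable_on_def)
qed auto

lemma ck_on_const: "ck_on k S (\<lambda>x. c)"
  by (induction k arbitrary: c) auto

text \<open>\<open>frechet_derivative\<close> is defined by choice, but derivatives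
  \<open>at x\<close> are unique, so any explicit derivative formula may stand in for it. The sum,
  product and chain rules below go through this.\<close>

lemma ck_on_SucI:
  assumes "\<And>x. x \<in> S \<Longrightarrow> (f has_derivative f' x) (at x)" "open S" "\<And>v. ck_on k S (\<lambda>x. f' x v)"
  shows "ck_on (Suc k) S f"
proof -
  have "f' x v = frechet_derivative f (at x) v" if "x \<in> S" for x v
    using assms(1)[OF that] frechet_derivative_at by metis
  then have "ck_on k S (\<lambda>x. frechet_derivative f (at x) v)" for v
    using ck_on_cong[OF assms(2) _ assms(3)] by auto
  then show ?thesis using assms(1) by (auto simp: differentiable_def)
qed

lemma ck_on_add:
  assumes "open S"
  shows "ck_on k S f \<Longrightarrow> ck_on k S g \<Longrightarrow> ck_on k S (\<lambda>x. f x + g x)"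
proof (induction k arbitrary: f g)
  case 0
  then show ?case by (auto intro: continuous_intros)
next
  case (Suc k)
  show ?case
    by (rule ck_on_SucI[where f' = "\<lambda>x v. frechet_derivative f (at x) v + frechet_derivative g (at x) v"])
      (use Suc assms in \<open>auto intro!: derivative_eq_intros simp: frechet_derivative_works[symmetric]\<close>)
qed

lemma ck_on_bilinear:
  assumes P: "bounded_bilinear P" and S: "open S"
  shows "ck_on k S f \<Longrightarrow> ck_on k S g \<Longrightarrow> ck_on k S (\<lambda>x. P (f x) (g x))"
proof (induction k arbitrary: f g)
  case 0
  then show ?case by (simp add: bounded_bilinear.continuous_on[OF P])
next
  case (Suc k)
  have fg: "ck_on k S f" "ck_on k S g"
    using Suc.prems ck_on_Suc_imp by blast+
  show ?case
  proof (rule ck_on_SucI[where f' = "\<lambda>x v. P (f x) (frechet_derivative g (at x) v) + P (frechet_derivative f (at x) v) (g x)"])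
    fix x assume "x \<in> S"
    then show "((\<lambda>x. P (f x) (g x)) has_derivative
        (\<lambda>v. P (f x) (frechet_derivative g (at x) v) + P (frechet_derivative f (at x) v) (g x))) (at x)"
      using Suc.prems by (intro bounded_bilinear.FDERIV[OF P]) (auto simp: frechet_derivative_works[symmetric])
  next
    fix v
    show "ck_on k S (\<lambda>x. P (f x) (frechet_derivative g (at x) v) + P (frechet_derivative f (at x) v) (g x))"
      using Suc.prems fg by (intro ck_on_add[OF S] Suc.IH) auto
  qed (fact S)
qed

lemma ck_on_bounded_linear:
  assumes "bounded_linear L" "open S" "ck_on k S f"
  shows "ck_on k S (\<lambda>x. L (f x))"
  using assms(3)
proof (induction k arbitrary: f)
  case 0
  then show ?case by (simp add: bounded_linear.continuous_on[OF assms(1)])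
next
  case (Suc k)
  show ?case
    by (rule ck_on_SucI[where f' = "\<lambda>x v. L (frechet_derivative f (at x) v)"])
      (use Suc assms in \<open>auto intro!: bounded_linear.has_derivative[OF assms(1)] simp: frechet_derivative_works[symmetric]\<close>)
qed

lemma ck_on_sum:
  assumes "open S" "\<And>i. i \<in> I \<Longrightarrow> ck_on k S (f i)"
  shows "ck_on k S (\<lambda>x. \<Sum>i\<in>I. f i x)"
proof (cases "finite I")
  case True
  then show ?thesis using assms(2)
    by (induction I rule: finite_induct)
      (auto simp: ck_on_const intro!: ck_on_add[OF \<open>open S\<close>])
qed (simp add: ck_on_const)

lemma linear_eq_sum_Basis:
  fixes L :: "'a::euclidean_space \<Rightarrow> 'b::real_vector"
  assumes "linear L"
  shows "L v = (\<Sum>b\<in>Basis. (v \<bullet> b) *\<^sub>R L b)"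
proof -
  have "L v = L (\<Sum>b\<in>Basis. (v \<bullet> b) *\<^sub>R b)" by (simp add: euclidean_representation)
  then show ?thesis by (simp add: linear_sum[OF assms] linear_scale[OF assms])
qed

lemma ck_on_compose:
  fixes g :: "'a::real_normed_vector \<Rightarrow> 'b::euclidean_space" and f :: "'b \<Rightarrow> 'c::real_normed_vector"
  assumes "open S" "open T" "g ` S \<subseteq> T" "ck_on k S g" "ck_on k T f"
  shows "ck_on k S (\<lambda>x. f (g x))"
  using assms(4,5)
proof (induction k arbitrary: f)
  case 0
  then show ?case using assms(3) continuous_on_compose2 by auto
next
  case (Suc k)
  \<comment> \<open>The chain rule applies \<open>frechet_derivative f (at (g x))\<close> to a
    vector that moves with \<open>x\<close>, which the induction hypothesis does not cover.
    Expanding that vector in \<open>Basis\<close> leaves fixed directions \<open>b\<close>, where it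
    does.\<close>
  let ?f' = "\<lambda>x v. \<Sum>b\<in>Basis. (frechet_derivative g (at x) v \<bullet> b) *\<^sub>R frechet_derivative f (at (g x)) b"
  show ?case
  proof (rule ck_on_SucI[where f' = ?f'])
    fix x assume x: "x \<in> S"
    then have f: "f differentiable (at (g x))" and g: "g differentiable (at x)"
      using Suc.prems assms(3) by auto
    have "((\<lambda>x. f (g x)) has_derivative (\<lambda>v. frechet_derivative f (at (g x)) (frechet_derivative g (at x) v))) (at x)"
      using has_derivative_compose[OF g[unfolded frechet_derivative_works] f[unfolded frechet_derivative_works]] .
    then show "((\<lambda>x. f (g x)) has_derivative ?f' x) (at x)"
      by (rule has_derivative_eq_rhs) (rule ext, rule linear_eq_sum_Basis[OF linear_frechet_derivative[OF f]])
  next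
    fix v
    have "ck_on k S (\<lambda>x. frechet_derivative f (at (g x)) b)" for b
      using Suc.IH[of "\<lambda>x. frechet_derivative f (at x) b"] Suc.prems ck_on_Suc_imp by auto
    moreover have "ck_on k S (\<lambda>x. frechet_derivative g (at x) v \<bullet> b)" for b
      using Suc.prems by (intro ck_on_bounded_linear[OF bounded_linear_inner_left assms(1)]) auto
    ultimately show "ck_on k S (\<lambda>x. ?f' x v)"
      by (intro ck_on_sum ck_on_bilinear[OF bounded_bilinear_scaleR] assms) auto
  qed (fact assms(1))
qed

lemma ck_on_local:
  assumes "open S" "\<And>x. x \<in> S \<Longrightarrow> \<exists>T. open T \<and> x \<in> T \<and> ck_on k T f"
  shows "ck_on k S f"
  using assms(2)
proof (induction k arbitrary: f)
  case 0
  then have "isCont f x" if "x \<in> S" for x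
    using that continuous_on_eq_continuous_at by fastforce
  then show ?case by (simp add: continuous_at_imp_continuous_on)
next
  case (Suc k)
  then have "f differentiable (at x)" if "x \<in> S" for x
    using that by fastforce
  moreover have "ck_on k S (\<lambda>x. frechet_derivative f (at x) v)" for v
    using Suc.IH[of "\<lambda>x. frechet_derivative f (at x) v"] Suc.prems by fastforce
  ultimately show ?case by simp
qed

lemma smooth_on_cong: "smooth_on S f \<Longrightarrow> open S \<Longrightarrow> (\<And>x. x \<in> S \<Longrightarrow> f x = g x) \<Longrightarrow> smooth_on S g"
  using ck_on_cong[of S f g] by (simp add: smooth_on_def)

lemma smooth_on_subset: "smooth_on S f \<Longrightarrow> T \<subseteq> S \<Longrightarrow> smooth_on T f"
  by (auto simp: smooth_on_def intro: ck_on_subset)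

lemma smooth_on_differentiable: "smooth_on S f \<Longrightarrow> x \<in> S \<Longrightarrow> f differentiable (at x)"
  unfolding smooth_on_def by (metis ck_on.simps(2))

lemma smooth_on_has_derivative:
  "smooth_on S f \<Longrightarrow> x \<in> S \<Longrightarrow> (f has_derivative frechet_derivative f (at x)) (at x)"
  using smooth_on_differentiable frechet_derivative_works by blast

lemma smooth_on_linear: "smooth_on S f \<Longrightarrow> x \<in> S \<Longrightarrow> linear (frechet_derivative f (at x))"
  using smooth_on_differentiable linear_frechet_derivative by blast

lemma smooth_on_frechet_derivative: "smooth_on S f \<Longrightarrow> smooth_on S (\<lambda>x. frechet_derivative f (at x) v)"
  unfolding smooth_on_def by (metis ck_on.simps(2))

lemma smooth_on_continuous_on: "smooth_on S f \<Longrightarrow> continuous_on S f"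
  unfolding smooth_on_def by (metis ck_on.simps(1))

lemma smooth_on_derivI:
  assumes "\<And>x. x \<in> S \<Longrightarrow> (f has_derivative f' x) (at x)" "open S" "\<And>v. smooth_on S (\<lambda>x. f' x v)"
  shows "smooth_on S f"
  unfolding smooth_on_def
proof
  fix k
  have "ck_on k S (\<lambda>x. f' x v)" for v using assms(3) by (simp add: smooth_on_def)
  then show "ck_on k S f" by (intro ck_on_Suc_imp[OF ck_on_SucI[OF assms(1,2)]])
qed

lemma smooth_on_const: "smooth_on S (\<lambda>x. c)"
  by (simp add: smooth_on_def ck_on_const)

lemma smooth_on_bounded_linear:
  assumes "bounded_linear L" "open S" "smooth_on S f"
  shows "smooth_on S (\<lambda>x. L (f x))"
  using assms ck_on_bounded_linear[OF assms(1,2)] by (simp add: smooth_on_def)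

lemma smooth_on_id: "open S \<Longrightarrow> smooth_on S (\<lambda>x. x)"
  by (rule smooth_on_derivI[where f' = "\<lambda>x v. v"]) (auto simp: smooth_on_const)

lemma smooth_on_add:
  "open S \<Longrightarrow> smooth_on S f \<Longrightarrow> smooth_on S g \<Longrightarrow> smooth_on S (\<lambda>x. f x + g x)"
  using ck_on_add[of S _ f g] by (simp add: smooth_on_def)

lemma smooth_on_compose:
  fixes g :: "'a::real_normed_vector \<Rightarrow> 'b::euclidean_space" and f :: "'b \<Rightarrow> 'c::real_normed_vector"
  assumes "open S" "open T" "\<And>x. x \<in> S \<Longrightarrow> g x \<in> T" "smooth_on S g" "smooth_on T f"
  shows "smooth_on S (\<lambda>x. f (g x))"
proof -
  have "g ` S \<subseteq> T" using assms(3) by blast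
  then show ?thesis using assms ck_on_compose[of S T g _ f] by (simp add: smooth_on_def)
qed

lemma smooth_on_Pair:
  assumes "open S" "smooth_on S f" "smooth_on S g"
  shows "smooth_on S (\<lambda>x. (f x, g x))"
proof -
  have L: "bounded_linear (\<lambda>y::'b. (y, 0::'c))" "bounded_linear (\<lambda>y::'c. (0::'b, y))"
    by (auto intro!: bounded_linear_Pair bounded_linear_ident bounded_linear_zero)
  have "smooth_on S (\<lambda>x. (f x, 0) + (0, g x))"
    by (rule smooth_on_add[OF assms(1) smooth_on_bounded_linear[OF L(1) assms(1,2)]
          smooth_on_bounded_linear[OF L(2) assms(1,3)]])
  then show ?thesis by simp
qed

lemma smooth_on_local:
  assumes "open S" "\<And>x. x \<in> S \<Longrightarrow> \<exists>T. open T \<and> x \<in> T \<and> smooth_on T f"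
  shows "smooth_on S f"
  unfolding smooth_on_def
proof
  fix k
  show "ck_on k S f"
  proof (rule ck_on_local[OF assms(1)])
    fix x assume "x \<in> S"
    then obtain T where "open T" "x \<in> T" "smooth_on T f" using assms(2) by blast
    then show "\<exists>T. open T \<and> x \<in> T \<and> ck_on k T f" by (auto simp: smooth_on_def)
  qed
qed

text \<open>Bootstrapping: once \<open>f\<close> is C^k, so is the composition of \<open>B v\<close>
  with \<open>f\<close>, which is the derivative of \<open>f\<close>, hence \<open>f\<close> is
  C^(k+1). Continuity starts the induction.\<close>

lemma smooth_on_implicit_ode:
  fixes f :: "'a::real_normed_vector \<Rightarrow> 'b::euclidean_space"
  assumes "open S" "open T" "\<And>x. x \<in> S \<Longrightarrow> f x \<in> T"
    and der: "\<And>x. x \<in> S \<Longrightarrow> (f has_derivative (\<lambda>v. B v (f x))) (at x)"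
    and B: "\<And>v. smooth_on T (B v)"
  shows "smooth_on S f"
proof -
  have "continuous_on S f"
    by (rule has_derivative_continuous_on) (rule has_derivative_at_withinI[OF der])
  then have "ck_on k S f" for k
  proof (induction k)
    case (Suc k)
    have B': "ck_on k T (B v)" for v using B by (simp add: smooth_on_def)
    have "f ` S \<subseteq> T" using assms(3) by blast
    have "ck_on k S (\<lambda>x. B v (f x))" for v
      by (rule ck_on_compose[OF \<open>open S\<close> \<open>open T\<close> \<open>f ` S \<subseteq> T\<close> Suc.IH[OF Suc.prems] B'])
    then show ?case by (intro ck_on_SucI[OF der \<open>open S\<close>])
  qed simp
  then show ?thesis by (simp add: smooth_on_def)
qed

text \<open>The product rule for a matrix-valued map \<open>L\<close> applied to a vector-valued map
  \<open>h\<close>. Differentiability is asked of the columns \<open>L y b\<close>, which is the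
  form in which families such as \<open>Dm z\<close> and \<open>DB w x\<close> arise below.\<close>

lemma has_derivative_linear_family:
  fixes L :: "'a::real_normed_vector \<Rightarrow> 'b::euclidean_space \<Rightarrow> 'c::real_normed_vector"
  assumes "open S" "x \<in> S" "\<And>y. y \<in> S \<Longrightarrow> linear (L y)"
    and L: "\<And>b. (\<lambda>y. L y b) differentiable (at x)"
    and h: "(h has_derivative h') (at x)"
  shows "((\<lambda>y. L y (h y)) has_derivative
     (\<lambda>u. frechet_derivative (\<lambda>y. L y (h x)) (at x) u + L x (h' u))) (at x)"
proof -
  have lin: "L y v = (\<Sum>b\<in>Basis. (v \<bullet> b) *\<^sub>R L y b)" if "y \<in> S" for y v
    by (rule linear_eq_sum_Basis[OF assms(3)[OF that]])
  define D where "D b = frechet_derivative (\<lambda>y. L y b) (at x)" for b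
  have D: "((\<lambda>y. L y b) has_derivative D b) (at x)" for b
    using L by (simp add: D_def frechet_derivative_works[symmetric])
  have "((\<lambda>y. \<Sum>b\<in>Basis. (h x \<bullet> b) *\<^sub>R L y b) has_derivative (\<lambda>u. \<Sum>b\<in>Basis. (h x \<bullet> b) *\<^sub>R D b u)) (at x)"
    by (auto intro!: derivative_eq_intros D)
  then have "((\<lambda>y. L y (h x)) has_derivative (\<lambda>u. \<Sum>b\<in>Basis. (h x \<bullet> b) *\<^sub>R D b u)) (at x)"
    by (rule has_derivative_transform_within_open[OF _ \<open>open S\<close> \<open>x \<in> S\<close>]) (rule lin[symmetric])
  from frechet_derivative_at[OF this]
  have Dhx: "frechet_derivative (\<lambda>y. L y (h x)) (at x) = (\<lambda>u. \<Sum>b\<in>Basis. (h x \<bullet> b) *\<^sub>R D b u)" ..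
  have "((\<lambda>y. \<Sum>b\<in>Basis. (h y \<bullet> b) *\<^sub>R L y b) has_derivative
      (\<lambda>u. \<Sum>b\<in>Basis. (h x \<bullet> b) *\<^sub>R D b u + (h' u \<bullet> b) *\<^sub>R L x b)) (at x)"
    by (rule has_derivative_sum) (auto intro!: derivative_eq_intros D h)
  moreover have "(\<lambda>u. \<Sum>b\<in>Basis. (h x \<bullet> b) *\<^sub>R D b u + (h' u \<bullet> b) *\<^sub>R L x b) =
      (\<lambda>u. frechet_derivative (\<lambda>y. L y (h x)) (at x) u + L x (h' u))"
    by (rule ext) (simp add: Dhx sum.distrib lin[OF \<open>x \<in> S\<close>, of "h' _"])
  ultimately have "((\<lambda>y. \<Sum>b\<in>Basis. (h y \<bullet> b) *\<^sub>R L y b) has_derivative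
      (\<lambda>u. frechet_derivative (\<lambda>y. L y (h x)) (at x) u + L x (h' u))) (at x)"
    by (rule subst[rotated])
  then show ?thesis
    by (rule has_derivative_transform_within_open[OF _ \<open>open S\<close> \<open>x \<in> S\<close>]) (rule lin[symmetric])
qed


section \<open>Symmetry of second derivatives\<close>

lemma has_real_derivative_along_line:
  assumes "(f has_derivative f') (at (x + s *\<^sub>R u))"
  shows "((\<lambda>s. f (x + s *\<^sub>R u)) has_real_derivative f' u) (at s)"
proof -
  have "((\<lambda>s. x + s *\<^sub>R u) has_derivative (\<lambda>h. h *\<^sub>R u)) (at s)"
    by (auto intro!: derivative_eq_intros)
  from has_derivative_compose[OF this assms]
  have "((\<lambda>s. f (x + s *\<^sub>R u)) has_derivative (\<lambda>h. f' (h *\<^sub>R u))) (at s)" .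
  moreover have "f' (h *\<^sub>R u) = f' u * h" for h
    using linear_scale[OF has_derivative_linear[OF assms]] by (simp add: mult.commute)
  ultimately show ?thesis by (simp add: has_field_derivative_def)
qed

text \<open>The mean value theorem is applied along \<open>u\<close> to the increment of
  \<open>f\<close> by \<open>h *\<^sub>R v\<close>, and then along \<open>v\<close> to the resulting
  difference of first derivatives. The whole parallelogram must lie in \<open>S\<close> since the
  intermediate points are unknown.\<close>

lemma second_difference_mvt:
  fixes f :: "'a::real_normed_vector \<Rightarrow> real"
  assumes f: "smooth_on S f" and h: "0 < h"
    and sub: "\<And>s t. 0 \<le> s \<Longrightarrow> s \<le> h \<Longrightarrow> 0 \<le> t \<Longrightarrow> t \<le> h \<Longrightarrow> x + s *\<^sub>R u + t *\<^sub>R v \<in> S"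
  obtains s t where "0 \<le> s" "s \<le> h" "0 \<le> t" "t \<le> h"
    "f (x + h *\<^sub>R u + h *\<^sub>R v) - f (x + h *\<^sub>R u) - f (x + h *\<^sub>R v) + f x =
     h * h * frechet_derivative (\<lambda>x. frechet_derivative f (at x) u) (at (x + s *\<^sub>R u + t *\<^sub>R v)) v"
proof -
  let ?D = "\<lambda>x. frechet_derivative f (at x) u"
  have sub0: "x + s *\<^sub>R u \<in> S" if "0 \<le> s" "s \<le> h" for s
    using sub[of s 0] that h by simp
  define a where "a s = f (x + s *\<^sub>R u + h *\<^sub>R v) - f (x + s *\<^sub>R u)" for s
  have a: "(a has_real_derivative ?D (x + s *\<^sub>R u + h *\<^sub>R v) - ?D (x + s *\<^sub>R u)) (at s)"
    if "0 \<le> s" "s \<le> h" for s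
    unfolding a_def
  proof (rule DERIV_diff)
    have "x + h *\<^sub>R v + s *\<^sub>R u \<in> S"
      using sub[of s h] that h by (simp add: algebra_simps)
    from has_real_derivative_along_line[OF smooth_on_has_derivative[OF f this]]
    show "((\<lambda>s. f (x + s *\<^sub>R u + h *\<^sub>R v)) has_real_derivative ?D (x + s *\<^sub>R u + h *\<^sub>R v)) (at s)"
      by (simp add: add_ac)
    show "((\<lambda>s. f (x + s *\<^sub>R u)) has_real_derivative ?D (x + s *\<^sub>R u)) (at s)"
      by (rule has_real_derivative_along_line[OF smooth_on_has_derivative[OF f sub0[OF that]]])
  qed
  obtain s where s: "0 < s" "s < h" "a h - a 0 = h * (?D (x + s *\<^sub>R u + h *\<^sub>R v) - ?D (x + s *\<^sub>R u))"
    using MVT2[OF h a] by auto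
  have b: "((\<lambda>t. ?D (x + s *\<^sub>R u + t *\<^sub>R v)) has_real_derivative
      frechet_derivative ?D (at (x + s *\<^sub>R u + t *\<^sub>R v)) v) (at t)" if "0 \<le> t" "t \<le> h" for t
    using s that
    by (intro has_real_derivative_along_line smooth_on_has_derivative[OF smooth_on_frechet_derivative[OF f] sub]) auto
  obtain t where t: "0 < t" "t < h" "?D (x + s *\<^sub>R u + h *\<^sub>R v) - ?D (x + s *\<^sub>R u) =
      h * frechet_derivative ?D (at (x + s *\<^sub>R u + t *\<^sub>R v)) v"
    using MVT2[OF h b] by auto
  show thesis
    by (rule that[of s t]) (use s t in \<open>auto simp: a_def\<close>)
qed

text \<open>The second difference over a parallelogram is symmetric in \<open>u\<close> and
  \<open>v\<close>, so up to the factor \<open>h * h\<close> it equals both mixed derivatives at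
  suitable nearby points; continuity of both lets the parallelogram shrink to
  \<open>x\<close>.\<close>

lemma frechet_derivative_commute_real:
  fixes f :: "'a::real_normed_vector \<Rightarrow> real"
  assumes f: "smooth_on S f" and "open S" "x \<in> S"
  shows "frechet_derivative (\<lambda>x. frechet_derivative f (at x) u) (at x) v =
         frechet_derivative (\<lambda>x. frechet_derivative f (at x) v) (at x) u"
proof -
  define A where "A u v x = frechet_derivative (\<lambda>x. frechet_derivative f (at x) u) (at x) v" for u v x
  have sm: "smooth_on S (A u v)" for u v
    unfolding A_def by (intro smooth_on_frechet_derivative f)
  have cont: "isCont (A u v) x" for u v
    using smooth_on_continuous_on[OF sm] assms continuous_on_eq_continuous_at by blast
  have "\<bar>A u v x - A v u x\<bar> \<le> e" if "e > 0" for e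
  proof -
    have "\<exists>d>0. \<forall>y. dist y x < d \<longrightarrow> dist (A u v y) (A u v x) < e / 2" for u v
      using cont[of u v] that unfolding continuous_within_eps_delta by (metis UNIV_I half_gt_zero)
    then obtain d1 d2 where d: "d1 > 0" "d2 > 0"
      "\<And>y. dist y x < d1 \<Longrightarrow> dist (A u v y) (A u v x) < e / 2"
      "\<And>y. dist y x < d2 \<Longrightarrow> dist (A v u y) (A v u x) < e / 2"
      by meson
    obtain d3 where d3: "d3 > 0" "ball x d3 \<subseteq> S"
      using assms open_contains_ball by blast
    define d where "d = min d3 (min d1 d2)"
    \<comment> \<open>This side length keeps the whole parallelogram within distance
      \<open>d\<close> of \<open>x\<close>; the summand 1 avoids division by zero when
      \<open>u = v = 0\<close>.\<close>
    define h where "h = d / (norm u + norm v + 1)"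
    have pos: "norm u + norm v + 1 > 0" by (smt (verit) norm_ge_zero)
    have "d > 0" using d d3 by (simp add: d_def)
    then have h: "h > 0" using pos by (simp add: h_def)
    have near: "dist (x + s *\<^sub>R u + t *\<^sub>R v) x < d" if "0 \<le> s" "s \<le> h" "0 \<le> t" "t \<le> h" for s t
    proof -
      have "dist (x + s *\<^sub>R u + t *\<^sub>R v) x = norm (s *\<^sub>R u + t *\<^sub>R v)"
        by (simp add: dist_norm add.assoc)
      also have "\<dots> \<le> s * norm u + t * norm v"
        using norm_triangle_ineq[of "s *\<^sub>R u" "t *\<^sub>R v"] that by simp
      also have "\<dots> \<le> h * norm u + h * norm v"
        using that by (intro add_mono mult_right_mono) auto
      also have "\<dots> < h * (norm u + norm v + 1)" using h by (simp add: algebra_simps)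
      also have "\<dots> = d" using pos by (simp add: h_def)
      finally show ?thesis .
    qed
    have near': "dist (x + s *\<^sub>R v + t *\<^sub>R u) x < d" if "0 \<le> s" "s \<le> h" "0 \<le> t" "t \<le> h" for s t
      using near[OF that(3,4,1,2)] by (simp add: add_ac)
    have inS: "y \<in> S" if "dist y x < d" for y
      using that d3 by (auto simp: d_def dist_commute)
    obtain s t where 1: "0 \<le> s" "s \<le> h" "0 \<le> t" "t \<le> h"
      "f (x + h *\<^sub>R u + h *\<^sub>R v) - f (x + h *\<^sub>R u) - f (x + h *\<^sub>R v) + f x = h * h * A u v (x + s *\<^sub>R u + t *\<^sub>R v)"
      using second_difference_mvt[OF f h inS[OF near]] unfolding A_def by blast
    obtain s' t' where 2: "0 \<le> s'" "s' \<le> h" "0 \<le> t'" "t' \<le> h"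
      "f (x + h *\<^sub>R v + h *\<^sub>R u) - f (x + h *\<^sub>R v) - f (x + h *\<^sub>R u) + f x = h * h * A v u (x + s' *\<^sub>R v + t' *\<^sub>R u)"
      using second_difference_mvt[OF f h inS[OF near']] unfolding A_def by blast
    have "f (x + h *\<^sub>R u + h *\<^sub>R v) - f (x + h *\<^sub>R u) - f (x + h *\<^sub>R v) + f x =
      f (x + h *\<^sub>R v + h *\<^sub>R u) - f (x + h *\<^sub>R v) - f (x + h *\<^sub>R u) + f x"
      by (simp add: add.assoc add.commute add.left_commute)
    then have "A u v (x + s *\<^sub>R u + t *\<^sub>R v) = A v u (x + s' *\<^sub>R v + t' *\<^sub>R u)"
      using 1(5) 2(5) h by simp
    moreover have "dist (A u v (x + s *\<^sub>R u + t *\<^sub>R v)) (A u v x) < e / 2"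
      using near[OF 1(1-4)] d(3) by (simp add: d_def)
    moreover have "dist (A v u (x + s' *\<^sub>R v + t' *\<^sub>R u)) (A v u x) < e / 2"
      using near'[OF 2(1-4)] d(4) by (simp add: d_def)
    ultimately show ?thesis unfolding dist_real_def by argo
  qed
  then have "A u v x = A v u x"
    using field_le_epsilon[of "\<bar>A u v x - A v u x\<bar>" 0] by simp
  then show ?thesis by (simp add: A_def)
qed

lemma frechet_derivative_inner:
  "f differentiable (at x) \<Longrightarrow>
    frechet_derivative (\<lambda>x. f x \<bullet> b) (at x) v = frechet_derivative f (at x) v \<bullet> b"
  using frechet_derivative_at[OF bounded_linear.has_derivative[OF bounded_linear_inner_left, of f _ "at x" b]]
  unfolding frechet_derivative_works by metis

lemma frechet_derivative_commute:
  fixes f :: "'a::real_normed_vector \<Rightarrow> 'b::euclidean_space"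
  assumes f: "smooth_on S f" and "open S" "x \<in> S"
  shows "frechet_derivative (\<lambda>x. frechet_derivative f (at x) u) (at x) v =
         frechet_derivative (\<lambda>x. frechet_derivative f (at x) v) (at x) u"
proof (rule euclidean_eqI)
  fix b :: 'b
  have fb: "smooth_on S (\<lambda>x. f x \<bullet> b)"
    by (rule smooth_on_bounded_linear[OF bounded_linear_inner_left \<open>open S\<close> f])
  have "frechet_derivative (\<lambda>x. frechet_derivative (\<lambda>x. f x \<bullet> b) (at x) u) (at x) v =
    frechet_derivative (\<lambda>x. frechet_derivative f (at x) u) (at x) v \<bullet> b" for u v
  proof -
    have d: "(\<lambda>x. frechet_derivative f (at x) u) differentiable (at x)"
      using smooth_on_frechet_derivative[OF f] smooth_on_differentiable \<open>x \<in> S\<close> by blast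
    have "((\<lambda>x. frechet_derivative f (at x) u \<bullet> b) has_derivative
        (\<lambda>v. frechet_derivative (\<lambda>x. frechet_derivative f (at x) u) (at x) v \<bullet> b)) (at x)"
      by (rule bounded_linear.has_derivative[OF bounded_linear_inner_left])
        (use d in \<open>simp add: frechet_derivative_works[symmetric]\<close>)
    then have "((\<lambda>x. frechet_derivative (\<lambda>x. f x \<bullet> b) (at x) u) has_derivative
        (\<lambda>v. frechet_derivative (\<lambda>x. frechet_derivative f (at x) u) (at x) v \<bullet> b)) (at x)"
      by (rule has_derivative_transform_within_open[OF _ \<open>open S\<close> \<open>x \<in> S\<close>])
        (simp add: frechet_derivative_inner smooth_on_differentiable[OF f])
    from frechet_derivative_at[OF this] show ?thesis by metis
  qed
  then show "frechet_derivative (\<lambda>x. frechet_derivative f (at x) u) (at x) v \<bullet> b =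
         frechet_derivative (\<lambda>x. frechet_derivative f (at x) v) (at x) u \<bullet> b"
    using frechet_derivative_commute_real[OF fb assms(2,3)] by metis
qed

section \<open>Static metrics on nilpotent Lie algebras\<close>

locale metric_frame =
  fixes g :: "'e::euclidean_space \<Rightarrow> 'e \<Rightarrow> real" and E :: "'e set"
  assumes metric: "invariant_metric g" and frame: "orthonormal_frame g E"
begin

lemma g_bilinear: "bilinear g"
  using metric by (simp add: invariant_metric_def)

lemma g_sym: "g x y = g y x"
  using metric by (simp add: invariant_metric_def)

lemma g_zeroD: "g x x = 0 \<Longrightarrow> x = 0"
  using metric unfolding invariant_metric_def by (metis less_irrefl)

lemmas g_simps = bilinear_ladd[OF g_bilinear] bilinear_radd[OF g_bilinear] bilinear_lmul[OF g_bilinear]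
  bilinear_rmul[OF g_bilinear] bilinear_lneg[OF g_bilinear] bilinear_rneg[OF g_bilinear]
  bilinear_lsub[OF g_bilinear] bilinear_rsub[OF g_bilinear]
  bilinear_lzero[OF g_bilinear] bilinear_rzero[OF g_bilinear]

lemma g_linear_left: "linear (\<lambda>x. g x y)" and g_linear_right: "linear (g x)"
  using g_bilinear by (simp_all add: bilinear_def)

lemma g_sum_left: "g (\<Sum>i\<in>I. f i) y = (\<Sum>i\<in>I. g (f i) y)"
  using linear_sum[OF g_linear_left] by simp

lemma finite_E: "finite E"
  using frame by (metis DIM_positive card.infinite less_irrefl orthonormal_frame_def)

lemma g_frame: "e \<in> E \<Longrightarrow> f \<in> E \<Longrightarrow> g e f = (if e = f then 1 else 0)"
  using frame by (simp add: orthonormal_frame_def)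

lemma sum_g_frame: "e \<in> E \<Longrightarrow> (\<Sum>f\<in>E. h f * g f e) = h e"
proof -
  assume e: "e \<in> E"
  have "(\<Sum>f\<in>E. h f * g f e) = (\<Sum>f\<in>E. if f = e then h f else 0)"
    by (rule sum.cong) (auto simp: g_frame e)
  then show ?thesis using e finite_E by simp
qed

lemma frame_expand: "x = (\<Sum>e\<in>E. g x e *\<^sub>R e)"
proof -
  have "independent E"
    unfolding independent_explicit
  proof (intro conjI allI impI ballI)
    fix u e assume u: "(\<Sum>v\<in>E. u v *\<^sub>R v) = 0" and e: "e \<in> E"
    have "0 = g (\<Sum>v\<in>E. u v *\<^sub>R v) e" by (simp add: u g_simps)
    also have "\<dots> = (\<Sum>v\<in>E. u v * g v e)" by (simp add: g_sum_left g_simps)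
    also have "\<dots> = u e" by (rule sum_g_frame[OF e])
    finally show "u e = 0" by simp
  qed (fact finite_E)
  moreover have "card E = DIM('e)" using frame by (simp add: orthonormal_frame_def)
  ultimately have "span E = UNIV"
    using card_ge_dim_independent[of E UNIV] by auto
  then have "x \<in> span E" by simp
  then obtain u where u: "x = (\<Sum>v\<in>E. u v *\<^sub>R v)"
    using span_finite[OF finite_E] by auto
  have "g x e = u e" if "e \<in> E" for e
    using sum_g_frame[OF that, of u] by (simp add: u g_sum_left g_simps)
  then show ?thesis using u by simp
qed

lemma linear_expand:
  assumes "linear f" shows "f x = (\<Sum>e\<in>E. g x e *\<^sub>R f e)"
proof -
  have "f x = f (\<Sum>e\<in>E. g x e *\<^sub>R e)" by (rule arg_cong[OF frame_expand])
  then show ?thesis by (simp add: linear_sum[OF assms] linear_scale[OF assms])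
qed

lemma g_expand: "g x y = (\<Sum>e\<in>E. g x e * g y e)"
  by (subst linear_expand[OF g_linear_right, of x y]) (simp add: g_sym mult.commute)

lemma eq_by_frame: "(\<And>e. e \<in> E \<Longrightarrow> g x e = g y e) \<Longrightarrow> x = y"
  by (rule trans[OF frame_expand trans[OF sum.cong frame_expand[symmetric]]]) auto

lemma bilinear_expand:
  fixes F :: "'e \<Rightarrow> 'e \<Rightarrow> real"
  assumes "bilinear F"
  shows "F x y = (\<Sum>a\<in>E. \<Sum>b\<in>E. g x a * g y b * F a b)"
proof -
  have l: "linear (\<lambda>x. F x y)" "linear (F x)" for x y using assms by (auto simp: bilinear_def)
  have "F x y = (\<Sum>a\<in>E. g x a *\<^sub>R F a y)" by (rule linear_expand[OF l(1)])
  also have "\<dots> = (\<Sum>a\<in>E. g x a * (\<Sum>b\<in>E. g y b * F a b))"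
    by (simp only: linear_expand[OF l(2), of _ y] real_scaleR_def)
  finally show ?thesis by (simp add: sum_distrib_left mult.assoc)
qed

definition tr :: "('e \<Rightarrow> 'e) \<Rightarrow> real" where
  "tr f = (\<Sum>e\<in>E. g (f e) e)"

lemma tr_commute:
  assumes "linear f" "linear h"
  shows "tr (\<lambda>x. f (h x)) = tr (\<lambda>x. h (f x))"
proof -
  have gf: "g (f x) y = (\<Sum>e\<in>E. g x e * g (f e) y)" for x y
    by (subst linear_expand[OF assms(1)]) (simp add: g_sum_left g_simps)
  have gh: "g (h x) y = (\<Sum>e\<in>E. g x e * g (h e) y)" for x y
    by (subst linear_expand[OF assms(2)]) (simp add: g_sum_left g_simps)
  have "tr (\<lambda>x. f (h x)) = (\<Sum>a\<in>E. \<Sum>b\<in>E. g (h a) b * g (f b) a)"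
    unfolding tr_def by (subst gf) (rule refl)
  also have "\<dots> = (\<Sum>b\<in>E. \<Sum>a\<in>E. g (f b) a * g (h a) b)"
    by (subst sum.swap) (simp add: mult.commute)
  also have "\<dots> = tr (\<lambda>x. h (f x))"
    unfolding tr_def by (subst gh) (rule refl)
  finally show ?thesis .
qed

text \<open>If \<open>p i\<close> projects onto the range of \<open>N ^^ i\<close> then \<open>N \<circ> p i = p (i + 1) \<circ> N \<circ> p i\<close>
  and \<open>p i \<circ> p (i + 1) = p (i + 1)\<close>, so the trace of \<open>N \<circ> p i\<close> does not depend on \<open>i\<close>.\<close>

lemma tr_nilpotent:
  assumes N: "linear N" and nil: "\<And>x. (N ^^ k) x = 0"
  shows "tr N = 0"
proof -
  have lin: "linear (N ^^ i)" for i
    by (induction i) (auto simp: linear_id[unfolded id_def] linear_compose[OF _ N, unfolded o_def] o_def id_def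
        intro: linear_compose[OF _ N, unfolded o_def])
  have "\<exists>p. p ` UNIV \<subseteq> range (N ^^ i) \<and> linear p \<and> (\<forall>v\<in>range (N ^^ i). p v = v)" for i
    using linear_exists_left_inverse_on[OF linear_id linear_subspace_image[OF lin subspace_UNIV], of i]
    by auto
  then obtain p where p: "\<And>i x. p i x \<in> range (N ^^ i)" "\<And>i. linear (p i)"
      "\<And>i v. v \<in> range (N ^^ i) \<Longrightarrow> p i v = v"
    by (metis rangeI subsetD)
  have step: "tr (\<lambda>x. N (p i x)) = tr (\<lambda>x. N (p (Suc i) x))" for i
  proof -
    have pp: "p i (p (Suc i) x) = p (Suc i) x" for x
    proof -
      obtain y where "p (Suc i) x = (N ^^ Suc i) y" using p(1) by blast
      also have "(N ^^ Suc i) y = (N ^^ i) (N y)" by (simp add: funpow_swap1)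
      finally show ?thesis using p(3) by (metis rangeI)
    qed
    have "N (p i x) = p (Suc i) (N (p i x))" for x
    proof -
      obtain y where "p i x = (N ^^ i) y" using p(1) by blast
      then have "N (p i x) = (N ^^ Suc i) y" by simp
      then have "N (p i x) \<in> range (N ^^ Suc i)" by (metis rangeI)
      then show ?thesis using p(3) by metis
    qed
    then have "tr (\<lambda>x. N (p i x)) = tr (\<lambda>x. p (Suc i) (N (p i x)))" by simp
    also have "\<dots> = tr (\<lambda>x. N (p i (p (Suc i) x)))"
      using tr_commute[OF p(2)[of "Suc i"] linear_compose[OF p(2)[of i] N]] by (simp add: o_def)
    finally show ?thesis by (simp add: pp)
  qed
  have pk: "p k x = 0" for x using p(1)[of k x] nil by auto
  \<comment> \<open>\<open>p 0\<close> is the identity, because \<open>range (N ^^ 0)\<close> is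
    everything, and \<open>p k\<close> is zero.\<close>
  have "tr N = tr (\<lambda>x. N (p 0 x))" using p(3)[of _ 0] by simp
  also have "\<dots> = tr (\<lambda>x. N (p k x))"
    by (induction k) (use step in auto)
  finally show ?thesis by (simp add: pk tr_def linear_0[OF N] g_simps)
qed

end

section \<open>Frame sums with an orthogonal complex structure\<close>

locale hermitian_frame = metric_frame +
  fixes J :: "'a \<Rightarrow> 'a"
  assumes J_linear: "linear J" and J_J: "J (J x) = - x" and g_J: "g (J x) (J y) = g x y"
begin

text \<open>\<open>J\<close> is an isometry, so the vectors \<open>J e\<close> form another
  orthonormal frame, and a metric trace does not depend on the frame.\<close>

lemma sum_frame_J:
  fixes F :: "'a \<Rightarrow> 'a \<Rightarrow> real"
  assumes F: "bilinear F"
  shows "(\<Sum>e\<in>E. F (J e) (J e)) = (\<Sum>e\<in>E. F e e)"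
proof -
  have gJ': "g (J e) a = - g (J a) e" for e a
    using g_J[of e "J a"] g_sym[of e "J a"] by (simp add: J_J g_simps)
  have gJ: "g (J e) a * g (J e) b = g (J a) e * g (J b) e" for e a b
    using gJ'[of e a] gJ'[of e b] by simp
  have "(\<Sum>e\<in>E. F (J e) (J e)) = (\<Sum>e\<in>E. \<Sum>a\<in>E. \<Sum>b\<in>E. g (J e) a * g (J e) b * F a b)"
    by (rule sum.cong[OF refl]) (rule bilinear_expand[OF F])
  also have "\<dots> = (\<Sum>a\<in>E. \<Sum>b\<in>E. \<Sum>e\<in>E. g (J e) a * g (J e) b * F a b)"
    by (subst sum.swap, rule sum.cong[OF refl], rule sum.swap)
  also have "\<dots> = (\<Sum>a\<in>E. \<Sum>b\<in>E. (\<Sum>e\<in>E. g (J a) e * g (J b) e) * F a b)"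
    by (simp only: gJ sum_distrib_right)
  also have "\<dots> = (\<Sum>a\<in>E. \<Sum>b\<in>E. g a b * F a b)"
    by (simp only: g_expand[symmetric] g_J)
  also have "\<dots> = (\<Sum>a\<in>E. F a a)"
  proof (rule sum.cong[OF refl])
    fix a assume a: "a \<in> E"
    then have "(\<Sum>b\<in>E. g a b * F a b) = (\<Sum>b\<in>E. F a b * g b a)"
      by (simp add: g_sym mult.commute)
    then show "(\<Sum>b\<in>E. g a b * F a b) = F a a" using sum_g_frame[OF a] by simp
  qed
  finally show ?thesis .
qed

lemma sum_frame_J':
  fixes F :: "'a \<Rightarrow> 'a \<Rightarrow> real"
  assumes F: "bilinear F"
  shows "(\<Sum>e\<in>E. F (J e) e) = - (\<Sum>e\<in>E. F e (J e))"
proof -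
  have "bilinear (\<lambda>x y. F x (J y))"
    using F J_linear unfolding bilinear_def by (auto intro: linear_compose[unfolded o_def])
  from sum_frame_J[OF this] show ?thesis
    by (simp add: J_J bilinear_rneg[OF F] sum_negf)
qed

text \<open>Infinitesimal version of frame independence: a skew \<open>A\<close> generates
  rotations, under which the trace of \<open>F\<close> is constant.\<close>

lemma sum_frame_skew:
  fixes F :: "'a \<Rightarrow> 'a \<Rightarrow> real"
  assumes F: "bilinear F" and A: "\<And>x y. g (A x) y = - g x (A y)"
  shows "(\<Sum>e\<in>E. F (A e) e + F e (A e)) = 0"
proof -
  have l: "linear (\<lambda>x. F x y)" "linear (F x)" for x y using F by (auto simp: bilinear_def)
  have gA: "g (A e) a * F a e = - (g (A a) e * F a e)" for e a
    using A[of e a] g_sym[of e "A a"] by simp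
  have "(\<Sum>e\<in>E. F (A e) e) = (\<Sum>e\<in>E. \<Sum>a\<in>E. g (A e) a * F a e)"
    by (rule sum.cong[OF refl]) (rule linear_expand[OF l(1), unfolded real_scaleR_def])
  also have "\<dots> = (\<Sum>a\<in>E. \<Sum>e\<in>E. g (A e) a * F a e)" by (rule sum.swap)
  also have "\<dots> = - (\<Sum>a\<in>E. \<Sum>e\<in>E. g (A a) e * F a e)"
    by (simp only: gA sum_negf)
  also have "(\<Sum>a\<in>E. \<Sum>e\<in>E. g (A a) e * F a e) = (\<Sum>a\<in>E. F a (A a))"
    by (rule sum.cong[OF refl]) (rule linear_expand[OF l(2), unfolded real_scaleR_def, symmetric])
  finally show ?thesis by (simp add: sum.distrib)
qed

end

text \<open>Nilpotency is present only through two traces, \<open>tr_ad\<close> (unimodularity) and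
  \<open>tr_ad_ad\<close> (the Killing form on the diagonal). \<open>dc_zero\<close> is the SKT
  condition; the condition on the Ricci form comes in as a hypothesis of
  \<open>abelian_if_part11_zero\<close>.\<close>

locale bismut_frame = hermitian_frame +
  fixes br D :: "'a \<Rightarrow> 'a \<Rightarrow> 'a"
  assumes br_bilinear: "bilinear br" and br_antisym: "br X Y = - br Y X"
    and jacobi: "br X (br Y Z) + br Y (br Z X) + br Z (br X Y) = 0"
    and bismut: "bismut_connection br J g D"
    and tr_ad: "tr (br X) = 0" and tr_ad_ad: "tr (\<lambda>Y. br X (br X Y)) = 0"
    and dc_zero: "ext_deriv3 br (torsion_form br g D) X Y Z W = 0"
begin

abbreviation T where "T \<equiv> torsion br D"
abbreviation c where "c \<equiv> torsion_form br g D"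

lemma D_bilinear: "bilinear D" and D_J: "D X (J Y) = J (D X Y)"
  and D_skew': "g (D X Y) Z + g Y (D X Z) = 0"
  and c_swap12: "c X Y Z = - c Y X Z" and c_swap23: "c X Y Z = - c X Z Y"
  using bismut unfolding bismut_connection_def by blast+

lemma D_skew: "g (D X Y) Z = - g Y (D X Z)"
  using D_skew'[of X Y Z] by simp

lemma c_swap13: "c X Y Z = - c Z Y X"
  using c_swap12[of X Y Z] c_swap23[of Y X Z] c_swap12[of Y Z X] by simp

lemma c_rot: "c X Y Z = c Y Z X"
  using c_swap12[of X Y Z] c_swap23[of Y X Z] by simp

lemmas J_simps = linear_add[OF J_linear] linear_diff[OF J_linear] linear_scale[OF J_linear]
  linear_neg[OF J_linear] linear_0[OF J_linear] J_J

lemmas br_simps = bilinear_ladd[OF br_bilinear] bilinear_radd[OF br_bilinear]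
  bilinear_lmul[OF br_bilinear] bilinear_rmul[OF br_bilinear] bilinear_lneg[OF br_bilinear]
  bilinear_rneg[OF br_bilinear] bilinear_lsub[OF br_bilinear] bilinear_rsub[OF br_bilinear]

lemmas D_simps = bilinear_ladd[OF D_bilinear] bilinear_radd[OF D_bilinear]
  bilinear_lmul[OF D_bilinear] bilinear_rmul[OF D_bilinear] bilinear_lneg[OF D_bilinear]
  bilinear_rneg[OF D_bilinear] bilinear_lsub[OF D_bilinear] bilinear_rsub[OF D_bilinear]

lemma T_simps: "T (X + X') Y = T X Y + T X' Y" "T X (Y + Y') = T X Y + T X Y'"
  "T (r *\<^sub>R X) Y = r *\<^sub>R T X Y" "T X (r *\<^sub>R Y) = r *\<^sub>R T X Y"
  "T (- X) Y = - T X Y" "T X (- Y) = - T X Y"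
  "T (X - X') Y = T X Y - T X' Y" "T X (Y - Y') = T X Y - T X Y'"
  by (simp_all add: torsion_def br_simps D_simps algebra_simps)

lemma c_simps: "c (X + X') Y Z = c X Y Z + c X' Y Z" "c X (Y + Y') Z = c X Y Z + c X Y' Z"
  "c X Y (Z + Z') = c X Y Z + c X Y Z'"
  "c (r *\<^sub>R X) Y Z = r * c X Y Z" "c X (r *\<^sub>R Y) Z = r * c X Y Z" "c X Y (r *\<^sub>R Z) = r * c X Y Z"
  "c (- X) Y Z = - c X Y Z" "c X (- Y) Z = - c X Y Z" "c X Y (- Z) = - c X Y Z"
  "c (X - X') Y Z = c X Y Z - c X' Y Z" "c X (Y - Y') Z = c X Y Z - c X Y' Z"
  "c X Y (Z - Z') = c X Y Z - c X Y Z'"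
  by (simp_all add: torsion_form_def T_simps g_simps)

lemma br_D: "br X Y = D X Y - D Y X - T X Y"
  by (simp add: torsion_def)

lemma T_antisym: "T X Y = - T Y X"
  using br_antisym[of X Y] by (simp add: torsion_def algebra_simps)

text \<open>\<open>\<tau>\<close> is the trace of the torsion against \<open>J\<close>: up to
  \<open>J\<close> and a factor, the dual of the Lee form. \<open>P\<close> is the norm square of
  the torsion polarised by \<open>J\<close> in both arguments. These two contractions are what the
  traced identities produce.\<close>

definition \<tau> :: 'a where "\<tau> = (\<Sum>e\<in>E. T e (J e))"
definition P :: real where "P = (\<Sum>e\<in>E. \<Sum>f\<in>E. g (T e f) (T (J e) (J f)))"
text \<open>The sign is opposite to that of \<open>curvature\<close>, so that \<open>s\<close> below
  is the scalar curvature of \<open>D\<close> in the usual convention.\<close>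

definition Rm :: "'a \<Rightarrow> 'a \<Rightarrow> 'a \<Rightarrow> 'a \<Rightarrow> real" where
  "Rm X Y Z W = g (D X (D Y Z) - D Y (D X Z) - D (br X Y) Z) W"
definition s :: real where "s = (\<Sum>e\<in>E. \<Sum>f\<in>E. Rm e f f e)"

lemma g_T: "g V (T X Y) = c V X Y"
  by (simp add: torsion_form_def)

lemma g_T_left: "g (T X Y) V = c V X Y"
  by (simp add: torsion_form_def g_sym)

text \<open>In \<open>g (D e e) X = - g e (D e X)\<close> write \<open>D e X\<close> as
  \<open>D X e + br e X + T e X\<close>. The first part pairs to zero with \<open>e\<close> as
  \<open>D\<close> is metric, the third as \<open>c\<close> is skew, and the rest sums to
  \<open>tr (br X) = 0\<close>.\<close>

lemma sum_D_frame: "(\<Sum>e\<in>E. D e e) = 0"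
proof -
  have "g (D e e) X = g (br X e) e" for e X
  proof -
    have "g (D e e) X = - g e (D X e + br e X + T e X)"
      using D_skew[of e e X] br_D[of e X] by (simp add: algebra_simps)
    also have "g e (D X e) = 0" using D_skew[of X e e] by (simp add: g_sym)
    moreover have "g e (T e X) = 0" using c_swap12[of e e X] by (simp add: g_T)
    ultimately show ?thesis using br_antisym[of e X] by (simp add: g_simps g_sym)
  qed
  then have "g (\<Sum>e\<in>E. D e e) X = 0" for X
    using tr_ad[of X] by (simp add: g_sum_left tr_def)
  then show ?thesis using g_zeroD by blast
qed

lemma sum_D_J_frame: "(\<Sum>e\<in>E. D e (J e)) = 0" "(\<Sum>e\<in>E. D (J e) e) = 0"
proof -
  show 1: "(\<Sum>e\<in>E. D e (J e)) = 0"
    using sum_D_frame by (simp add: D_J J_simps flip: linear_sum[OF J_linear])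
  have "g (\<Sum>e\<in>E. D (J e) e) X = 0" for X
  proof -
    have "bilinear (\<lambda>x y. g (D x y) X)"
      by (auto simp: bilinear_def linear_iff D_simps g_simps)
    from sum_frame_J'[OF this] have "(\<Sum>e\<in>E. g (D (J e) e) X) = - g (\<Sum>e\<in>E. D e (J e)) X"
      by (simp add: g_sum_left)
    then show ?thesis by (simp add: 1 g_sum_left g_simps)
  qed
  then show "(\<Sum>e\<in>E. D (J e) e) = 0" using g_zeroD by blast
qed

lemma sum_c_\<tau>: "(\<Sum>e\<in>E. c V e (J e)) = g V \<tau>"
  using linear_sum[OF g_linear_right, of V "\<lambda>e. T e (J e)" E] by (simp add: \<tau>_def torsion_form_def)

text \<open>\<open>D V\<close> is skew and commutes with \<open>J\<close>, hence acts as an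
  infinitesimal unitary transformation, which fixes the contraction of \<open>c\<close> with
  \<open>J\<close>. This clears derivative terms from both traced identities.\<close>

lemma sum_c_derivation: "(\<Sum>e\<in>E. c (D V e) (J e) U + c e (D V (J e)) U) = 0"
proof -
  have "bilinear (\<lambda>x y. c x (J y) U)"
    by (auto simp: bilinear_def linear_iff c_simps J_simps)
  from sum_frame_skew[OF this, of "D V"] show ?thesis
    by (simp add: D_J D_skew)
qed

text \<open>The first bracket on the right, with its sign, is the covariant derivative of
  \<open>c\<close> along \<open>W\<close>, as \<open>c\<close> is constant on invariant fields.
  Closedness of \<open>c\<close> is what gathers all derivatives into this one direction.\<close>

lemma bianchi:
  "Rm X Y Z W + Rm Y Z X W + Rm Z X Y W =
     - (c (D W X) Y Z + c (D W Y) Z X + c (D W Z) X Y)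
     - (g (T X W) (T Y Z) + g (T Y W) (T Z X) + g (T Z W) (T X Y))"
proof -
  \<comment> \<open>Replacing \<open>D Y Z - D Z Y\<close> by \<open>T Y Z + br Y Z\<close>, and
    then \<open>D X (br Y Z) - D (br Y Z) X\<close> in the same way, leaves torsion terms and a
    Jacobi sum.\<close>
  have expand: "D X (D Y Z) - D Y (D X Z) - D (br X Y) Z + (D Y (D Z X) - D Z (D Y X) - D (br Y Z) X)
      + (D Z (D X Y) - D X (D Z Y) - D (br Z X) Y)
    = D X (T Y Z) + D Y (T Z X) + D Z (T X Y) + T X (br Y Z) + T Y (br Z X) + T Z (br X Y)
      + (br X (br Y Z) + br Y (br Z X) + br Z (br X Y))"
    by (simp add: torsion_def D_simps br_simps algebra_simps)
  have skew: "g (D X (T Y Z)) W = - c (D X W) Y Z" for X Y Z W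
    by (simp add: D_skew g_T_left)
  have DT: "c (D X W) Y Z = c (br X W) Y Z + c (D W X) Y Z + g (T X W) (T Y Z)" for X Y Z W
    by (simp add: br_D g_T c_simps)
  have "Rm X Y Z W + Rm Y Z X W + Rm Z X Y W =
     - c (D X W) Y Z - c (D Y W) Z X - c (D Z W) X Y + c W X (br Y Z) + c W Y (br Z X) + c W Z (br X Y)"
    unfolding Rm_def using expand jacobi[of X Y Z]
    by (simp add: skew g_T_left flip: g_simps(1))
       (simp add: g_simps skew g_T_left)
  \<comment> \<open>\<open>dc_zero\<close> equates the brackets not involving \<open>W\<close> with
    those involving it; the latter cancel the brackets that \<open>DT\<close> produces when it
    exchanges \<open>D X W\<close> for \<open>D W X\<close>.\<close>
  moreover have "c W X (br Y Z) + c W Y (br Z X) + c W Z (br X Y) =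
      c (br X W) Y Z + c (br Y W) Z X + c (br Z W) X Y"
    using dc_zero[of X Y Z W] c_rot[of W X "br Y Z"] c_rot[of W Y "br Z X"] c_rot[of W Z "br X Y"]
      c_rot[of X "br Y Z" W] c_rot[of Y "br Z X" W] c_rot[of Z "br X Y" W]
      c_swap23[of "br X Y" Z W] c_swap23[of "br Y Z" X W] c_swap23[of "br Z X" Y W]
      br_antisym[of X Z] c_swap23[of "br Y W" X Z]
    by (simp add: ext_deriv3_def c_simps)
  ultimately show ?thesis by (simp add: DT[of X W] DT[of Y W] DT[of Z W])
qed

text \<open>Every bracket in \<open>dc_zero\<close> is replaced by \<open>D\<close> and
  \<open>T\<close>; the six torsion terms pair up, whence the factors 2. The parentheses group
  derivative terms so that \<open>sum_c_derivation\<close> applies once \<open>X\<close> and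
  \<open>Z\<close> run through the frame with \<open>Y = J X\<close> and
  \<open>W = J Z\<close>.\<close>

lemma dc_expand:
  "- c (D X Y) Z W - (c (D X Z) W Y + c Z (D X W) Y)
   + c (D Y X) Z W + (c (D Y Z) W X + c Z (D Y W) X)
   - (c (D Z X) Y W + c X (D Z Y) W) - c (D Z W) X Y
   + (c (D W X) Y Z + c X (D W Y) Z) + c (D W Z) X Y
   + 2 * g (T X Y) (T Z W) - 2 * g (T X Z) (T Y W) + 2 * g (T X W) (T Y Z) = 0"
proof -
  have gT: "g (T X Y) (T Z W) = c (T X Y) Z W" "g (T X Y) (T Z W) = c (T Z W) X Y" for X Y Z W
    by (simp_all add: torsion_form_def g_sym)
  show ?thesis
    using dc_zero[of X Y Z W] gT[of X Y Z W] gT[of X Z Y W] gT[of X W Y Z]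
      c_swap23[of "D X Z" Y W] c_rot[of Z "D X W" Y]
      c_swap23[of "D Y Z" X W] c_rot[of Z "D Y W" X]
      c_swap12[of X "D Z Y" W] c_swap12[of X "D W Y" Z]
    by (simp add: ext_deriv3_def br_D c_simps)
qed

lemma sum_T_J:
  "(\<Sum>e\<in>E. \<Sum>f\<in>E. g (T e (J f)) (T (J e) f)) = - P"
proof -
  have "(\<Sum>f\<in>E. g (T e (J f)) (T (J e) f)) = (\<Sum>f\<in>E. - g (T e f) (T (J e) (J f)))" for e
  proof -
    have "bilinear (\<lambda>x y. g (T e (J x)) (T (J e) y))"
      by (auto simp: bilinear_def linear_iff T_simps J_simps g_simps)
    from sum_frame_J[OF this] show ?thesis by (simp add: J_J T_simps g_simps)
  qed
  then show ?thesis by (simp add: P_def sum_negf)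
qed

lemma sum_g_\<tau>: "(\<Sum>e\<in>E. \<Sum>f\<in>E. g (T e (J e)) (T f (J f))) = g \<tau> \<tau>"
proof -
  have "g (T e (J e)) \<tau> = (\<Sum>f\<in>E. g (T e (J e)) (T f (J f)))" for e
    unfolding \<tau>_def by (rule linear_sum[OF g_linear_right])
  then have "(\<Sum>e\<in>E. \<Sum>f\<in>E. g (T e (J e)) (T f (J f))) = (\<Sum>e\<in>E. g (T e (J e)) \<tau>)" by simp
  also have "\<dots> = g (\<Sum>e\<in>E. T e (J e)) \<tau>" by (rule g_sum_left[symmetric])
  finally show ?thesis by (simp only: \<tau>_def)
qed

lemma sum_c_D: "(\<Sum>e\<in>E. \<Sum>f\<in>E. c (D e (J e)) f (J f)) = 0"
  "(\<Sum>e\<in>E. \<Sum>f\<in>E. c (D (J e) e) f (J f)) = 0"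
  using sum_D_J_frame by (simp_all add: sum_c_\<tau> g_simps flip: g_sum_left)

text \<open>Trace \<open>dc_expand\<close> over \<open>X = e\<close>, \<open>Y = J e\<close>,
  \<open>Z = f\<close>, \<open>W = J f\<close>. All derivative terms sum to zero, and by
  \<open>sum_T_J\<close> the last two torsion terms contribute \<open>- 2 * P\<close> each.\<close>

lemma g_\<tau>_\<tau>: "g \<tau> \<tau> = 2 * P"
proof -
  have derivation: "(\<Sum>e\<in>E. \<Sum>f\<in>E. c (D (h e) f) (J f) (k e) + c f (D (h e) (J f)) (k e)) = 0"
      "(\<Sum>e\<in>E. \<Sum>f\<in>E. c (D (h f) e) (J e) (k f) + c e (D (h f) (J e)) (k f)) = 0" for h k
    by (simp add: sum_c_derivation) (subst sum.swap, simp add: sum_c_derivation)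
  have c_D': "(\<Sum>e\<in>E. \<Sum>f\<in>E. c (D f (J f)) e (J e)) = 0" "(\<Sum>e\<in>E. \<Sum>f\<in>E. c (D (J f) f) e (J e)) = 0"
    using sum_c_D by (subst sum.swap, simp)+
  have "(\<Sum>e\<in>E. \<Sum>f\<in>E. - c (D e (J e)) f (J f) - (c (D e f) (J f) (J e) + c f (D e (J f)) (J e))
   + c (D (J e) e) f (J f) + (c (D (J e) f) (J f) e + c f (D (J e) (J f)) e)
   - (c (D f e) (J e) (J f) + c e (D f (J e)) (J f)) - c (D f (J f)) e (J e)
   + (c (D (J f) e) (J e) f + c e (D (J f) (J e)) f) + c (D (J f) f) e (J e)
   + 2 * g (T e (J e)) (T f (J f)) - 2 * g (T e f) (T (J e) (J f)) + 2 * g (T e (J f)) (T (J e) f)) = 0"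
    by (simp only: dc_expand sum.neutral_const)
  then have "2 * g \<tau> \<tau> - 2 * P - 2 * P = 0"
    unfolding sum.distrib sum_subtractf sum_negf sum_distrib_left[symmetric]
      sum_c_D c_D' sum_T_J sum_g_\<tau> P_def[symmetric]
    using derivation[of "\<lambda>e. e" J] derivation[of J "\<lambda>e. e"]
    by (simp add: sum.distrib)
  then show ?thesis by simp
qed

lemma Rm_J: "Rm X Y (J Z) (J W) = Rm X Y Z W"
  by (simp add: Rm_def D_J g_J flip: J_simps(2))

lemma Rm_skew: "Rm X Y W Z = - Rm X Y Z W" "Rm Y X Z W = - Rm X Y Z W"
proof -
  have "g (D X (D Y W)) Z = g W (D Y (D X Z))" for X Y
    using D_skew[of X "D Y W" Z] D_skew[of Y W "D X Z"] by simp
  moreover have "g (D V W) Z = - g (D V Z) W" for V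
    using D_skew[of V W Z] g_sym by simp
  ultimately show "Rm X Y W Z = - Rm X Y Z W"
    by (simp add: Rm_def g_simps) (simp add: g_sym)
  show "Rm Y X Z W = - Rm X Y Z W"
    by (simp add: Rm_def g_simps D_simps br_antisym[of Y X])
qed

text \<open>The Bianchi identity traced over \<open>e, J e, f, J f\<close>. By
  \<open>J\<close>-invariance the two other curvature terms of the cyclic sum give \<open>s\<close>
  each, the derivatives vanish, and the torsion terms leave \<open>2 * P - g \<tau> \<tau>\<close>,
  which is zero by \<open>g_\<tau>_\<tau>\<close>.\<close>

lemma bismut_scalar_trace:
  "(\<Sum>e\<in>E. \<Sum>f\<in>E. Rm e (J e) f (J f)) + 2 * s = 0"
proof -
  have s2: "(\<Sum>e\<in>E. \<Sum>f\<in>E. Rm (J e) f e (J f)) = s"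
  proof -
    have "(\<Sum>e\<in>E. Rm (J e) f e (J f)) = (\<Sum>e\<in>E. Rm e f f e)" for f
    proof -
      have "bilinear (\<lambda>x y. Rm x f y (J f))"
        by (auto simp: bilinear_def linear_iff Rm_def br_simps D_simps g_simps algebra_simps)
      from sum_frame_J'[OF this] show ?thesis
        by (simp add: Rm_J Rm_skew(1)[of _ f f] sum_negf)
    qed
    then show ?thesis unfolding s_def by (subst (1 2) sum.swap) simp
  qed
  have s3: "(\<Sum>e\<in>E. \<Sum>f\<in>E. Rm f e (J e) (J f)) = s"
    unfolding s_def by (subst sum.swap) (simp add: Rm_J)
  have zero: "(\<Sum>e\<in>E. \<Sum>f\<in>E. c (D (J f) e) (J e) f + c (D (J f) (J e)) f e) = 0"
  proof (subst sum.swap, rule sum.neutral, rule ballI)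
    fix f
    show "(\<Sum>e\<in>E. c (D (J f) e) (J e) f + c (D (J f) (J e)) f e) = 0"
      using sum_c_derivation[of "J f" f] c_rot by simp
  qed
  have c_D': "(\<Sum>e\<in>E. \<Sum>f\<in>E. c (D (J f) f) e (J e)) = 0"
    using sum_c_D(2) by (subst sum.swap) simp
  have "(\<Sum>e\<in>E. \<Sum>f\<in>E. Rm e (J e) f (J f) + Rm (J e) f e (J f) + Rm f e (J e) (J f)) =
    (\<Sum>e\<in>E. \<Sum>f\<in>E. - (c (D (J f) e) (J e) f + c (D (J f) (J e)) f e + c (D (J f) f) e (J e))
      - (g (T e (J f)) (T (J e) f) + g (T (J e) (J f)) (T f e) + g (T f (J f)) (T e (J e))))"
    by (simp only: bianchi)
  moreover have "(\<Sum>e\<in>E. \<Sum>f\<in>E. g (T (J e) (J f)) (T f e)) = - P"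
  proof -
    have "g (T (J e) (J f)) (T f e) = - g (T e f) (T (J e) (J f))" for e f
      using T_antisym[of f e] g_sym by (simp add: g_simps)
    then show ?thesis by (simp add: P_def sum_negf)
  qed
  moreover have "(\<Sum>e\<in>E. \<Sum>f\<in>E. g (T f (J f)) (T e (J e))) = g \<tau> \<tau>"
    using sum_g_\<tau> by (subst sum.swap) simp
  ultimately show ?thesis
    using s2 s3 zero c_D' sum_T_J g_\<tau>_\<tau>
    by (simp add: sum.distrib sum_subtractf sum_negf)
qed

text \<open>In structure constants \<open>C a b c = g [a, b] c\<close> the unimodularity and the vanishing of the
  Killing trace leave only the squares of \<open>C\<close> and of the torsion form.\<close>

lemma s_eq:
  "4 * s = - (\<Sum>a\<in>E. \<Sum>b\<in>E. \<Sum>d\<in>E. (g (br a b) d)\<^sup>2) - (\<Sum>a\<in>E. \<Sum>b\<in>E. \<Sum>d\<in>E. (c a b d)\<^sup>2)"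
proof -
  define C where "C a b d = g (br a b) d" for a b d
  define S where "S F = (\<Sum>a\<in>E. \<Sum>b\<in>E. \<Sum>d\<in>E. F a b d)" for F :: "'a \<Rightarrow> 'a \<Rightarrow> 'a \<Rightarrow> real"
  have S12: "S (\<lambda>a b d. F b a d) = S F" for F
    unfolding S_def by (rule sum.swap)
  have S23: "S (\<lambda>a b d. F a d b) = S F" for F
    unfolding S_def by (rule sum.cong[OF refl], rule sum.swap)
  have Srot: "S (\<lambda>a b d. F b d a) = S F" for F
    using S12[of "\<lambda>a b d. F a d b"] S23[of F] by simp
  have Srot': "S (\<lambda>a b d. F d a b) = S F" for F
    using Srot[of "\<lambda>a b d. F d a b"] by simp
  have Sadd: "S (\<lambda>a b d. F a b d + F' a b d) = S F + S F'" for F F'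
    by (simp add: S_def sum.distrib)
  have Smul: "S (\<lambda>a b d. r * F a b d) = r * S F" for F r
    by (simp add: S_def sum_distrib_left)
  have C12: "C a b d = - C b a d" for a b d
    unfolding C_def by (subst br_antisym) (simp add: g_simps)
  \<comment> \<open>For fixed \<open>a\<close> the inner double sum is the trace of the square of
    \<open>br a\<close>, written in matrix entries.\<close>
  have kill: "S (\<lambda>a b d. C a b d * C a d b) = 0"
  proof -
    have "(\<Sum>b\<in>E. \<Sum>d\<in>E. C a b d * C a d b) = tr (\<lambda>Y. br a (br a Y))" for a
    proof -
      have l: "linear (br a)" using br_bilinear by (simp add: bilinear_def)
      have "g (br a (br a b)) b = (\<Sum>d\<in>E. C a b d * C a d b)" for b
        by (subst linear_expand[OF l]) (simp add: g_sum_left g_simps C_def)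
      then show ?thesis by (simp add: tr_def)
    qed
    then show ?thesis by (simp add: S_def tr_ad_ad)
  qed
  \<comment> \<open>Antisymmetry turns one factor around, and renaming \<open>a\<close> and
    \<open>b\<close> reduces this mixed product to \<open>kill\<close>; \<open>zx\<close> and
    \<open>yz\<close> are rotations of it.\<close>
  have xy: "S (\<lambda>a b d. C a b d * C b d a) = 0"
  proof -
    have "C a b d * C b d a = - (C b a d * C b d a)" for a b d using C12[of a b d] by simp
    then have "S (\<lambda>a b d. C a b d * C b d a) = S (\<lambda>a b d. (-1) * (C b a d * C b d a))" by simp
    also have "\<dots> = 0" unfolding Smul using S12[of "\<lambda>a b d. C a b d * C a d b"] kill by simp
    finally show ?thesis .
  qed
  have zx: "S (\<lambda>a b d. C d a b * C a b d) = 0"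
    using Srot'[of "\<lambda>a b d. C a b d * C b d a"] xy by simp
  have yz: "S (\<lambda>a b d. C b d a * C d a b) = 0"
    using Srot[of "\<lambda>a b d. C a b d * C b d a"] xy by simp
  \<comment> \<open>The Koszul formula of a metric connection with skew torsion: an alternating sum
    of the three rotations of \<open>t\<close>, in which \<open>sk\<close> cancels all covariant
    derivatives except \<open>D a b\<close>.\<close>
  have koszul: "2 * g (D a b) d = C a b d - C b d a + C d a b + c a b d" for a b d
  proof -
    have t: "C a b d = g (D a b) d - g (D b a) d - c a b d" for a b d
    proof -
      have "C a b d = g (D a b - D b a - T a b) d" unfolding C_def by (simp only: br_D)
      also have "\<dots> = g (D a b) d - g (D b a) d - c d a b" by (simp only: g_simps g_T_left)
      finally show ?thesis by (simp only: c_rot[of d a b])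
    qed
    have sk: "g (D a b) d = - g (D a d) b" for a b d
      using D_skew[of a b d] g_sym[of b "D a d"] by simp
    show ?thesis
      using t[of a b d] t[of b d a] t[of d a b] sk[of b d a] sk[of d a b] sk[of a d b] c_rot[of a b d] c_rot[of b d a]
      by linarith
  qed
  \<comment> \<open>The curvature term with \<open>D a (D b b)\<close> sums to zero by
    \<open>sum_D_frame\<close>; the other two are expanded in the frame.\<close>
  have s_S: "s = S (\<lambda>a b d. g (D a b) d * g (D b a) d - C a b d * g (D d b) a)"
  proof -
    have "(\<Sum>b\<in>E. g (D a (D b b)) a) = 0" for a
    proof -
      have "linear (\<lambda>x. g (D a x) a)" by (auto simp: linear_iff D_simps g_simps)
      from linear_sum[OF this, of "\<lambda>b. D b b" E] show ?thesis
        by (simp add: sum_D_frame bilinear_rzero[OF D_bilinear] g_simps)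
    qed
    moreover have "g (D b (D a b)) a = - (\<Sum>d\<in>E. g (D a b) d * g (D b a) d)" for a b
      unfolding D_skew[of b "D a b" a] by (simp only: g_expand[symmetric])
    moreover have "g (D (br a b) b) a = (\<Sum>d\<in>E. C a b d * g (D d b) a)" for a b
    proof -
      have l: "linear (\<lambda>x. g (D x b) a)" by (auto simp: linear_iff D_simps g_simps)
      show ?thesis unfolding C_def by (rule linear_expand[OF l, unfolded real_scaleR_def])
    qed
    ultimately show ?thesis
      by (simp add: s_def S_def Rm_def g_simps sum_subtractf sum.distrib sum_negf)
  qed
  \<comment> \<open>In terms of \<open>x, y, z, t\<close> below, the terms linear in
    \<open>t\<close> cancel. After summation the squares of \<open>y\<close> and \<open>z\<close>
    have the same sum as that of \<open>x\<close>, so the coefficients 1 + 1 - 3 give -1.\<close>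
  have "4 * (g (D a b) d * g (D b a) d - C a b d * g (D d b) a) =
      C d a b * C d a b + C b d a * C b d a + (- 3) * (C a b d * C a b d) + (- 2) * (C b d a * C d a b)
      + 2 * (C a b d * C b d a) + 2 * (C d a b * C a b d) + (- 1) * (c a b d * c a b d)" for a b d
  proof -
    define x y z t where "x = C a b d" "y = C b d a" "z = C d a b" "t = c a b d"
    have 1: "2 * g (D a b) d = x - y + z + t" by (simp add: koszul x_y_z_t_def)
    have 2: "2 * g (D b a) d = - x - y + z - t" for d'
      using koszul[of b a d] C12[of b a d] C12[of a d b] C12[of d b a] c_swap12[of b a d]
      by (simp add: x_y_z_t_def)
    have 3: "2 * g (D d b) a = - y + x - z - t"
      using koszul[of d b a] C12[of d b a] C12[of b a d] C12[of a d b] c_swap13[of d b a]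
      by (simp add: x_y_z_t_def)
    have "4 * (g (D a b) d * g (D b a) d - C a b d * g (D d b) a) =
        (2 * g (D a b) d) * (2 * g (D b a) d) - 2 * x * (2 * g (D d b) a)"
      by (simp add: x_y_z_t_def)
    also have "\<dots> = z * z + y * y + (- 3) * (x * x) + (- 2) * (y * z) + 2 * (x * y) + 2 * (z * x) + (- 1) * (t * t)"
      unfolding 1 2 3 by (simp add: algebra_simps)
    finally show ?thesis by (simp add: x_y_z_t_def)
  qed
  then have "4 * s = S (\<lambda>a b d. C d a b * C d a b + C b d a * C b d a + (- 3) * (C a b d * C a b d)
      + (- 2) * (C b d a * C d a b)
      + 2 * (C a b d * C b d a) + 2 * (C d a b * C a b d) + (- 1) * (c a b d * c a b d))"
    unfolding s_S Smul[symmetric] by simp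
  also have "\<dots> = S (\<lambda>a b d. C d a b * C d a b) + S (\<lambda>a b d. C b d a * C b d a) - 3 * S (\<lambda>a b d. C a b d * C a b d)
      - S (\<lambda>a b d. c a b d * c a b d)"
    unfolding Sadd Smul xy yz zx by simp
  also have "\<dots> = - S (\<lambda>a b d. C a b d * C a b d) - S (\<lambda>a b d. c a b d * c a b d)"
    using Srot[of "\<lambda>a b d. C a b d * C a b d"] Srot'[of "\<lambda>a b d. C a b d * C a b d"] by simp
  finally show ?thesis by (simp add: S_def C_def power2_eq_square)
qed

text \<open>At the pair \<open>e, J e\<close> the two halves of the (1,1)-part agree, so the
  hypothesis kills the Ricci trace and with it \<open>s\<close>. Both sums in \<open>s_eq\<close>
  consist of squares and carry the same sign, so the structure constants vanish.\<close>

lemma abelian_if_part11_zero: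
  assumes "\<And>X Y. part11 J (ricci_form br J g D E) X Y = 0"
  shows "br X Y = 0"
proof -
  have curv: "g (curvature br D X Y Z) W = - Rm X Y Z W" for X Y Z W
    by (simp add: curvature_def Rm_def g_simps)
  have "(\<Sum>f\<in>E. Rm e (J e) f (J f)) = 0" for e
  proof -
    have "Rm (J e) (- e) f (J f) = Rm e (J e) f (J f)" for f
      using Rm_skew(2)[of "J e" e f "J f"]
      by (simp add: Rm_def D_simps br_simps g_simps)
    then show ?thesis
      using assms[of e "J e"] by (simp add: part11_def ricci_form_def curv J_J sum_negf)
  qed
  then have "s = 0" using bismut_scalar_trace by simp
  then have "(\<Sum>a\<in>E. \<Sum>b\<in>E. \<Sum>d\<in>E. (g (br a b) d)\<^sup>2) = 0"
    using s_eq sum_nonneg[of E "\<lambda>a. \<Sum>b\<in>E. \<Sum>d\<in>E. (g (br a b) d)\<^sup>2"]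
      sum_nonneg[of E "\<lambda>a. \<Sum>b\<in>E. \<Sum>d\<in>E. (c a b d)\<^sup>2"]
    by (smt (verit) sum_nonneg zero_le_power2)
  then have "g (br a b) d = 0" if "a \<in> E" "b \<in> E" "d \<in> E" for a b d
    using that finite_E by (simp add: sum_nonneg_eq_0_iff sum_nonneg)
  then have E: "br a b = 0" if "a \<in> E" "b \<in> E" for a b
    using that by (intro eq_by_frame) (simp add: g_simps)
  have l: "linear (\<lambda>x. br x y)" "linear (br x)" for x y
    using br_bilinear by (simp_all add: bilinear_def)
  have "br a Y = 0" if "a \<in> E" for a
    by (subst linear_expand[OF l(2)]) (simp add: E that)
  then show ?thesis
    by (subst linear_expand[OF l(1)]) simp
qed

end

lemma static_zero_imp_abelian:
  fixes br :: "'e::euclidean_space \<Rightarrow> 'e \<Rightarrow> 'e"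
  assumes br: "bilinear br" "\<And>X Y. br X Y = - br Y X"
      "\<And>X Y Z. br X (br Y Z) + br Y (br Z X) + br Z (br X Y) = 0"
    and nil: "\<And>X. \<exists>k. \<forall>Y. (br X ^^ k) Y = 0"
    and J: "invariant_complex_structure br J" and g: "hermitian_metric J g"
    and static: "static_metric br J g 0"
  shows "br X Y = 0"
proof -
  obtain D E where D: "bismut_connection br J g D" and E: "orthonormal_frame g E"
    and dc: "\<And>X Y Z W. ext_deriv3 br (torsion_form br g D) X Y Z W = 0"
    and ric: "\<And>X Y. - part11 J (ricci_form br J g D E) X Y = 0 * fundamental_form J g X Y"
    using static unfolding static_metric_def by blast
  interpret hermitian_frame g E J
    by unfold_locales
      (use J g E in \<open>simp_all add: invariant_complex_structure_def hermitian_metric_def linear_add linear_scale\<close>)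
  have lin: "linear (br X)" for X using br(1) by (simp add: bilinear_def)
  have "tr (br X) = 0" for X
  proof -
    obtain k where k: "\<And>Y. (br X ^^ k) Y = 0" using nil by meson
    show ?thesis by (rule tr_nilpotent[OF lin k])
  qed
  moreover have "tr (\<lambda>Y. br X (br X Y)) = 0" for X
  proof -
    obtain k where k: "\<And>Y. (br X ^^ k) Y = 0" using nil by meson
    have "linear (\<lambda>Y. br X (br X Y))" using linear_compose[OF lin lin] by (simp add: o_def)
    moreover have "((\<lambda>Y. br X (br X Y)) ^^ k) Y = 0" for Y
    proof -
      have "(\<lambda>Y. br X (br X Y)) = br X ^^ 2" by (auto simp: numeral_2_eq_2)
      then have "(\<lambda>Y. br X (br X Y)) ^^ k = br X ^^ (k + k)"
        by (simp add: funpow_mult mult_2)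
      then show ?thesis by (simp add: funpow_add k linear_0[OF lin])
    qed
    ultimately show ?thesis by (rule tr_nilpotent)
  qed
  ultimately interpret bismut_frame g E J br D
    by unfold_locales (rule br D dc | assumption)+
  show ?thesis using abelian_if_part11_zero ric by simp
qed

section \<open>Charts of a Lie group\<close>

lemma open_smooth_preimage:
  assumes "smooth_on S f" "open S" "open T"
  shows "open {x \<in> S. f x \<in> T}"
proof -
  have "{x \<in> S. f x \<in> T} = S \<inter> f -` T" by auto
  then show ?thesis
    using continuous_open_preimage[OF smooth_on_continuous_on[OF assms(1)] assms(2,3)] by simp
qed

locale lie_group_atlas = group G for G :: "('g::topological_space, 'k) monoid_scheme" (structure) +
  fixes A :: "('g, 'e::euclidean_space) chart set"
  assumes lie: "lie_group G A"
begin

lemma atlas_cover: "carrier G = (\<Union>(U, \<phi>)\<in>A. U)"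
  using lie by (simp add: lie_group_def smooth_manifold_def)

lemma chart_props:
  assumes "(U, \<phi>) \<in> A"
  shows "openin (top_of_set (carrier G)) U" "open (\<phi> ` U)" "U \<subseteq> carrier G"
    "inj_on \<phi> U" "continuous_on U \<phi>" "continuous_on (\<phi> ` U) (inv_into U \<phi>)"
proof -
  have *: "openin (top_of_set (carrier G)) U \<and> open (\<phi> ` U) \<and>
      homeomorphic_map (subtopology (top_of_set (carrier G)) U) (top_of_set (\<phi> ` U)) \<phi>"
    using lie assms unfolding lie_group_def smooth_manifold_def by blast
  then show "openin (top_of_set (carrier G)) U" "open (\<phi> ` U)" by auto
  then show sub: "U \<subseteq> carrier G" using openin_imp_subset by blast
  have h: "homeomorphic_map (top_of_set U) (top_of_set (\<phi> ` U)) \<phi>"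
    using * sub by (simp add: subtopology_subtopology Int_absorb1)
  show inj: "inj_on \<phi> U" using homeomorphic_imp_injective_map[OF h] by simp
  show "continuous_on U \<phi>"
    using homeomorphic_imp_continuous_map[OF h] by (simp add: continuous_map_iff_continuous)
  obtain \<psi> where \<psi>: "homeomorphic_maps (top_of_set U) (top_of_set (\<phi> ` U)) \<phi> \<psi>"
    using h homeomorphic_map_maps by blast
  then have "continuous_on (\<phi> ` U) \<psi>" "\<And>x. x \<in> U \<Longrightarrow> \<psi> (\<phi> x) = x"
    by (auto simp: homeomorphic_maps_def continuous_map_iff_continuous)
  then show "continuous_on (\<phi> ` U) (inv_into U \<phi>)"
    using inj by (subst continuous_on_cong[OF refl, of _ _ \<psi>]) auto
qed

lemma continuous_mult: "continuous_on (carrier G \<times> carrier G) (\<lambda>z. fst z \<otimes> snd z)"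
  using lie by (simp add: lie_group_def smooth_map_def continuous_map_iff_continuous case_prod_unfold)

lemma continuous_inv: "continuous_on (carrier G) (\<lambda>x. inv x)"
  using lie by (simp add: lie_group_def smooth_map_def continuous_map_iff_continuous)

lemma open_chart_preimage:
  assumes "(U, \<phi>) \<in> A" "open S" "continuous_on S f" "\<And>x. x \<in> S \<Longrightarrow> f x \<in> carrier G"
  shows "open {x \<in> S. f x \<in> U}"
proof -
  obtain O' where O': "open O'" "U = carrier G \<inter> O'"
    using chart_props(1)[OF assms(1)] by (metis openin_open)
  have "{x \<in> S. f x \<in> U} = S \<inter> f -` O'" using assms(4) O' by auto
  then show ?thesis using continuous_open_preimage[OF assms(3,2) O'(1)] by simp
qed

lemma smooth_mult_charts:
  assumes 1: "(U1, \<phi>1) \<in> A" and 2: "(U2, \<phi>2) \<in> A" and 3: "(U3, \<phi>3) \<in> A"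
  defines "S \<equiv> {z \<in> \<phi>1 ` U1 \<times> \<phi>2 ` U2. inv_into U1 \<phi>1 (fst z) \<otimes> inv_into U2 \<phi>2 (snd z) \<in> U3}"
  shows "open S" and "smooth_on S (\<lambda>z. \<phi>3 (inv_into U1 \<phi>1 (fst z) \<otimes> inv_into U2 \<phi>2 (snd z)))"
proof -
  note c1 = chart_props[OF 1] and c2 = chart_props[OF 2]
  have pair: "continuous_on (\<phi>1 ` U1 \<times> \<phi>2 ` U2) (\<lambda>z. (inv_into U1 \<phi>1 (fst z), inv_into U2 \<phi>2 (snd z)))"
    by (intro continuous_on_Pair continuous_on_compose2[OF c1(6)] continuous_on_compose2[OF c2(6)])
      (auto intro: continuous_intros)
  have "(\<lambda>z. (inv_into U1 \<phi>1 (fst z), inv_into U2 \<phi>2 (snd z))) ` (\<phi>1 ` U1 \<times> \<phi>2 ` U2) \<subseteq> carrier G \<times> carrier G"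
    using c1(3,4) c2(3,4) by auto
  from continuous_on_compose2[OF continuous_mult pair this]
  have "continuous_on (\<phi>1 ` U1 \<times> \<phi>2 ` U2) (\<lambda>z. inv_into U1 \<phi>1 (fst z) \<otimes> inv_into U2 \<phi>2 (snd z))"
    by simp
  then show op: "open S"
    unfolding S_def using c1 c2
    by (intro open_chart_preimage[OF 3] open_Times) (auto intro!: m_closed)
  have "(U1 \<times> U2, map_prod \<phi>1 \<phi>2) \<in> product_atlas A A"
    using 1 2 by (auto simp: product_atlas_def)
  then have sm: "smooth_on (map_prod \<phi>1 \<phi>2 ` {z \<in> U1 \<times> U2. (\<lambda>(x, y). x \<otimes> y) z \<in> U3})
      (\<phi>3 \<circ> (\<lambda>(x, y). x \<otimes> y) \<circ> inv_into (U1 \<times> U2) (map_prod \<phi>1 \<phi>2))"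
    using lie 3 unfolding lie_group_def smooth_map_def by blast
  have inj: "inj_on (map_prod \<phi>1 \<phi>2) (U1 \<times> U2)"
    using map_prod_inj_on c1(4) c2(4) by blast
  have S: "map_prod \<phi>1 \<phi>2 ` {z \<in> U1 \<times> U2. (\<lambda>(x, y). x \<otimes> y) z \<in> U3} = S"
    unfolding S_def using c1(4) c2(4) by (force simp: map_prod_def)
  show "smooth_on S (\<lambda>z. \<phi>3 (inv_into U1 \<phi>1 (fst z) \<otimes> inv_into U2 \<phi>2 (snd z)))"
  proof (rule smooth_on_cong[OF sm[unfolded S] op])
    fix z assume "z \<in> S"
    then obtain x y where xy: "x \<in> U1" "y \<in> U2" "z = map_prod \<phi>1 \<phi>2 (x, y)"
      by (auto simp: S_def)
    then have "inv_into (U1 \<times> U2) (map_prod \<phi>1 \<phi>2) z = (x, y)"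
      using inv_into_f_f[OF inj, of "(x, y)"] by simp
    then show "(\<phi>3 \<circ> (\<lambda>(x, y). x \<otimes> y) \<circ> inv_into (U1 \<times> U2) (map_prod \<phi>1 \<phi>2)) z =
        \<phi>3 (inv_into U1 \<phi>1 (fst z) \<otimes> inv_into U2 \<phi>2 (snd z))"
      using xy c1(4) c2(4) by simp
  qed
qed

lemma smooth_inv_charts:
  assumes 1: "(U1, \<phi>1) \<in> A" and 2: "(U2, \<phi>2) \<in> A"
  defines "S \<equiv> {x \<in> \<phi>1 ` U1. inv (inv_into U1 \<phi>1 x) \<in> U2}"
  shows "open S" and "smooth_on S (\<lambda>x. \<phi>2 (inv (inv_into U1 \<phi>1 x)))"
proof -
  note c1 = chart_props[OF 1]
  have "continuous_on (\<phi>1 ` U1) (\<lambda>x. inv (inv_into U1 \<phi>1 x))"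
    using c1(3,4) by (intro continuous_on_compose2[OF continuous_inv c1(6)]) auto
  then show op: "open S"
    unfolding S_def using c1 by (intro open_chart_preimage[OF 2]) auto
  have "smooth_on (\<phi>1 ` {x \<in> U1. inv x \<in> U2}) (\<phi>2 \<circ> (\<lambda>x. inv x) \<circ> inv_into U1 \<phi>1)"
    using lie 1 2 unfolding lie_group_def smooth_map_def by blast
  moreover have "\<phi>1 ` {x \<in> U1. inv x \<in> U2} = S"
    unfolding S_def using c1(4) by force
  ultimately show "smooth_on S (\<lambda>x. \<phi>2 (inv (inv_into U1 \<phi>1 x)))"
    by (simp add: o_def)
qed

text \<open>Multiplication with its first factor frozen at \<open>g\<close>, read in a third chart
  around \<open>g\<close>; \<open>g\<close> itself may lie outside \<open>U1\<close> and
  \<open>U2\<close>.\<close>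

lemma smooth_translation_charts:
  assumes g: "g \<in> carrier G" and 1: "(U1, \<phi>1) \<in> A" and 2: "(U2, \<phi>2) \<in> A"
  defines "S \<equiv> {x \<in> \<phi>1 ` U1. g \<otimes> inv_into U1 \<phi>1 x \<in> U2}"
  shows "open S" and "smooth_on S (\<lambda>x. \<phi>2 (g \<otimes> inv_into U1 \<phi>1 x))"
proof -
  obtain U \<phi> where U: "(U, \<phi>) \<in> A" "g \<in> U"
    using g atlas_cover by auto
  define M where "M = {z \<in> \<phi> ` U \<times> \<phi>1 ` U1. inv_into U \<phi> (fst z) \<otimes> inv_into U1 \<phi>1 (snd z) \<in> U2}"
  have inv: "inv_into U \<phi> (\<phi> g) = g"
    using U chart_props(4)[OF U(1)] by simp
  have sm: "smooth_on UNIV (\<lambda>x::'e. (\<phi> g, x))"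
    by (intro smooth_on_Pair smooth_on_const smooth_on_id) simp_all
  have "S = {x \<in> UNIV. (\<phi> g, x) \<in> M}"
    using U by (auto simp: S_def M_def inv)
  then show op: "open S"
    using open_smooth_preimage[OF sm open_UNIV smooth_mult_charts(1)[OF U(1) 1 2]] by (simp add: M_def)
  have "smooth_on S (\<lambda>x. \<phi>2 (inv_into U \<phi> (fst (\<phi> g, x)) \<otimes> inv_into U1 \<phi>1 (snd (\<phi> g, x))))"
    by (rule smooth_on_compose[OF op smooth_mult_charts(1)[OF U(1) 1 2] _ smooth_on_subset[OF sm]
          smooth_mult_charts(2)[OF U(1) 1 2]])
      (use U in \<open>auto simp: S_def inv\<close>)
  then show "smooth_on S (\<lambda>x. \<phi>2 (g \<otimes> inv_into U1 \<phi>1 x))"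
    by (simp add: inv)
qed

end

lemma open_slice:
  assumes "open S" shows "open {y. (x, y) \<in> S}" "open {y. (y, x) \<in> S}"
proof -
  have "open (Pair x -` S)" "open ((\<lambda>y. (y, x)) -` S)"
    by (intro open_vimage assms continuous_intros)+
  then show "open {y. (x, y) \<in> S}" "open {y. (y, x) \<in> S}" by (simp_all add: vimage_def)
qed

section \<open>The partial group law in a chart at the identity\<close>

locale lie_chart = lie_group_atlas G A
  for G :: "('g::topological_space, 'k) monoid_scheme" (structure)
    and A :: "('g, 'e::euclidean_space) chart set" +
  fixes U :: "'g set" and \<phi> :: "'g \<Rightarrow> 'e"
  assumes chart: "(U, \<phi>) \<in> A" and one_U: "\<one> \<in> U"
begin

text \<open>The group operations in the chart, \<open>m\<close> and \<open>\<iota>\<close>, take junk values outside \<open>DM\<close> and \<open>DI\<close>.\<close>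

definition \<Omega> where "\<Omega> = \<phi> ` U"
abbreviation \<psi> where "\<psi> \<equiv> inv_into U \<phi>"
definition e where "e = \<phi> \<one>"
definition m where "m x y = \<phi> (\<psi> x \<otimes> \<psi> y)"
abbreviation mm where "mm \<equiv> \<lambda>z. m (fst z) (snd z)"
definition \<iota> where "\<iota> x = \<phi> (inv (\<psi> x))"
definition DM where "DM = {z \<in> \<Omega> \<times> \<Omega>. \<psi> (fst z) \<otimes> \<psi> (snd z) \<in> U}"
definition DI where "DI = {x \<in> \<Omega>. inv (\<psi> x) \<in> U}"
abbreviation Dm where "Dm z \<equiv> frechet_derivative mm (at z)"

lemma open_\<Omega>: "open \<Omega>" and inj_\<phi>: "inj_on \<phi> U" and U_carrier: "U \<subseteq> carrier G"
  using chart_props[OF chart] by (simp_all add: \<Omega>_def)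

lemma \<psi>_U: "x \<in> \<Omega> \<Longrightarrow> \<psi> x \<in> U"
  by (simp add: \<Omega>_def inv_into_into)

lemma \<psi>_carrier [simp]: "x \<in> \<Omega> \<Longrightarrow> \<psi> x \<in> carrier G"
  using \<psi>_U U_carrier by blast

lemma \<phi>_\<psi> [simp]: "x \<in> \<Omega> \<Longrightarrow> \<phi> (\<psi> x) = x"
  by (simp add: \<Omega>_def f_inv_into_f)

lemma \<psi>_\<phi> [simp]: "p \<in> U \<Longrightarrow> \<psi> (\<phi> p) = p"
  by (simp add: inj_\<phi>)

lemma \<phi>_\<Omega> [simp]: "p \<in> U \<Longrightarrow> \<phi> p \<in> \<Omega>"
  by (simp add: \<Omega>_def)

lemma e_\<Omega> [simp]: "e \<in> \<Omega>" and \<psi>_e [simp]: "\<psi> e = \<one>"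
  using one_U by (simp_all add: e_def)

lemma DM_iff: "(x, y) \<in> DM \<longleftrightarrow> x \<in> \<Omega> \<and> y \<in> \<Omega> \<and> \<psi> x \<otimes> \<psi> y \<in> U"
  by (auto simp: DM_def)

lemma open_DM: "open DM" and smooth_mm: "smooth_on DM mm"
  using smooth_mult_charts[OF chart chart chart] by (simp_all add: DM_def \<Omega>_def m_def)

lemma open_DI: "open DI" and smooth_\<iota>: "smooth_on DI \<iota>"
  using smooth_inv_charts[OF chart chart] by (simp_all add: DI_def \<Omega>_def \<iota>_def[abs_def])

lemma DM_e [simp]: "x \<in> \<Omega> \<Longrightarrow> (x, e) \<in> DM" "x \<in> \<Omega> \<Longrightarrow> (e, x) \<in> DM"
  by (auto simp: DM_iff \<psi>_U)

lemma m_e [simp]: "x \<in> \<Omega> \<Longrightarrow> m x e = x" "x \<in> \<Omega> \<Longrightarrow> m e x = x"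
  by (auto simp: m_def)

lemma m_\<Omega> [simp]: "(x, y) \<in> DM \<Longrightarrow> m x y \<in> \<Omega>"
  by (simp add: m_def DM_iff)

lemma \<psi>_m [simp]: "(x, y) \<in> DM \<Longrightarrow> \<psi> (m x y) = \<psi> x \<otimes> \<psi> y"
  by (simp add: m_def DM_iff)

lemma \<iota>_\<Omega> [simp]: "x \<in> DI \<Longrightarrow> \<iota> x \<in> \<Omega>" and \<psi>_\<iota> [simp]: "x \<in> DI \<Longrightarrow> \<psi> (\<iota> x) = inv (\<psi> x)"
  and DI_\<Omega> [simp]: "x \<in> DI \<Longrightarrow> x \<in> \<Omega>"
  by (auto simp: \<iota>_def DI_def)

lemma e_DI [simp]: "e \<in> DI"
  using one_U by (simp add: DI_def del: DI_\<Omega>)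

lemma \<psi>_eqD: "x \<in> \<Omega> \<Longrightarrow> y \<in> \<Omega> \<Longrightarrow> \<psi> x = \<psi> y \<Longrightarrow> x = y"
  by (metis \<phi>_\<psi>)

text \<open>Both bracketings name the same group element, so when three of the partial products stay
  in the chart, the fourth does as well.\<close>

lemma mul_assoc:
  assumes "(x, y) \<in> DM" "(m x y, z) \<in> DM" "(y, z) \<in> DM"
  shows "(x, m y z) \<in> DM" "m (m x y) z = m x (m y z)"
proof -
  have "x \<in> \<Omega>" "y \<in> \<Omega>" "z \<in> \<Omega>" using assms by (auto simp: DM_iff)
  then have "\<psi> x \<otimes> \<psi> y \<otimes> \<psi> z = \<psi> x \<otimes> (\<psi> y \<otimes> \<psi> z)" by (simp add: m_assoc)
  then show D: "(x, m y z) \<in> DM" using assms by (simp add: DM_iff[of x] DM_iff[of "m x y"])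
  then show "m (m x y) z = m x (m y z)"
    using assms \<open>\<psi> x \<otimes> \<psi> y \<otimes> \<psi> z = \<psi> x \<otimes> (\<psi> y \<otimes> \<psi> z)\<close> by (intro \<psi>_eqD) auto
qed

lemma \<iota>_left: "x \<in> DI \<Longrightarrow> (\<iota> x, x) \<in> DM" "x \<in> DI \<Longrightarrow> m (\<iota> x) x = e"
  and \<iota>_right: "x \<in> DI \<Longrightarrow> (x, \<iota> x) \<in> DM" "x \<in> DI \<Longrightarrow> m x (\<iota> x) = e"
  using one_U by (auto simp: DM_iff m_def e_def)

lemma Dm_linear: "z \<in> DM \<Longrightarrow> linear (Dm z)"
  by (rule smooth_on_linear[OF smooth_mm])

lemma Dm_split: "z \<in> DM \<Longrightarrow> Dm z (u, v) = Dm z (u, 0) + Dm z (0, v)"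
  using linear_add[OF Dm_linear, of z "(u, 0)" "(0, v)"] by simp

lemma has_derivative_m:
  assumes "(f has_derivative f') (at a)" "(h has_derivative h') (at a)" "(f a, h a) \<in> DM"
  shows "((\<lambda>t. m (f t) (h t)) has_derivative (\<lambda>v. Dm (f a, h a) (f' v, h' v))) (at a)"
  using has_derivative_compose[OF has_derivative_Pair[OF assms(1,2)] smooth_on_has_derivative[OF smooth_mm assms(3)]]
  by simp

lemma has_derivative_m_right:
  "(x, y) \<in> DM \<Longrightarrow> ((\<lambda>y. m x y) has_derivative (\<lambda>v. Dm (x, y) (0, v))) (at y)"
  using has_derivative_m[OF has_derivative_const has_derivative_ident, of x y] by simp

lemma has_derivative_m_left:
  "(x, y) \<in> DM \<Longrightarrow> ((\<lambda>x. m x y) has_derivative (\<lambda>v. Dm (x, y) (v, 0))) (at x)"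
  using has_derivative_m[OF has_derivative_ident has_derivative_const, of x y] by simp

text \<open>The device by which group identities valid near a point are differentiated: equal germs
  have equal derivatives.\<close>

lemma derivative_transfer:
  assumes "(f has_derivative f') (at x)" "(h has_derivative h') (at x)" "open S" "x \<in> S"
    "\<And>y. y \<in> S \<Longrightarrow> f y = h y"
  shows "f' = h'"
  using has_derivative_unique[OF has_derivative_transform_within_open[OF assms(1,3,4,5)] assms(2)] by simp

lemma Dm_e_left: "x \<in> \<Omega> \<Longrightarrow> Dm (e, x) (0, v) = v"
  using derivative_transfer[OF has_derivative_m_right has_derivative_ident open_\<Omega>, of e x]
  by (simp add: fun_eq_iff)

lemma Dm_e_right: "x \<in> \<Omega> \<Longrightarrow> Dm (x, e) (v, 0) = v"
  using derivative_transfer[OF has_derivative_m_left has_derivative_ident open_\<Omega>, of x e]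
  by (simp add: fun_eq_iff)

definition B where "B w x = Dm (x, e) (0, w)"

lemma left_field_eq: "x \<in> \<Omega> \<Longrightarrow> left_field G (U, \<phi>) w x = B w x"
proof -
  assume x: "x \<in> \<Omega>"
  have "left_field G (U, \<phi>) w x = frechet_derivative (\<lambda>y. m x y) (at e) w"
    by (simp add: left_field_def m_def e_def)
  also have "frechet_derivative (\<lambda>y. m x y) (at e) = (\<lambda>v. Dm (x, e) (0, v))"
    using frechet_derivative_at[OF has_derivative_m_right[OF DM_e(1)[OF x]]] by simp
  finally show ?thesis by (simp add: B_def)
qed

lemma smooth_B: "smooth_on \<Omega> (B w)"
  unfolding B_def[abs_def]
  by (rule smooth_on_compose[OF open_\<Omega> open_DM _ smooth_on_Pair[OF open_\<Omega> smooth_on_id[OF open_\<Omega>] smooth_on_const]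
        smooth_on_frechet_derivative[OF smooth_mm]]) simp

lemma B_e [simp]: "B w e = w"
  by (simp add: B_def Dm_e_left)

lemma B_linear: "x \<in> \<Omega> \<Longrightarrow> linear (\<lambda>w. B w x)"
proof -
  assume "x \<in> \<Omega>"
  then have L: "linear (Dm (x, e))" by (simp add: Dm_linear)
  show ?thesis
    using linear_add[OF L, of "(0, _)" "(0, _)"] linear_scale[OF L, of _ "(0, _)"]
    by (simp add: B_def linear_iff)
qed

abbreviation DB where "DB w x \<equiv> frechet_derivative (B w) (at x)"

text \<open>Differentiate \<open>m (m x a) y = m x (m a y)\<close> in \<open>y\<close> at
  \<open>e\<close>.\<close>

lemma left_invariance: "(x, a) \<in> DM \<Longrightarrow> B w (m x a) = Dm (x, a) (0, B w a)"
proof -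
  assume xa: "(x, a) \<in> DM"
  then have x: "x \<in> \<Omega>" "a \<in> \<Omega>" by (auto simp: DM_iff)
  let ?S = "{y. (m x a, y) \<in> DM} \<inter> {y. (a, y) \<in> DM}"
  have "open ?S" "e \<in> ?S" using open_slice(1)[OF open_DM] xa x by auto
  have 1: "((\<lambda>y. m (m x a) y) has_derivative (\<lambda>v. Dm (m x a, e) (0, v))) (at e)"
    using xa by (intro has_derivative_m_right) simp
  have "((\<lambda>y. m x (m a y)) has_derivative (\<lambda>v. Dm (x, m a e) (0, Dm (a, e) (0, v)))) (at e)"
    using xa x has_derivative_m[OF has_derivative_const has_derivative_m_right, of a e x] by simp
  from derivative_transfer[OF 1 this \<open>open ?S\<close> \<open>e \<in> ?S\<close>]
  show ?thesis using mul_assoc(2)[OF xa] x by (simp add: B_def fun_eq_iff)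
qed

definition br where "br v w = DB w e v - DB v e w"

lemma lie_bracket_eq: "lie_bracket G (U, \<phi>) = br"
proof (intro ext)
  fix v w
  have "frechet_derivative (left_field G (U, \<phi>) w) (at e) = DB w e" for w
  proof -
    have "(left_field G (U, \<phi>) w has_derivative DB w e) (at e)"
      by (rule has_derivative_transform_within_open[OF smooth_on_has_derivative[OF smooth_B] open_\<Omega>])
        (simp_all add: left_field_eq)
    from frechet_derivative_at[OF this] show ?thesis by simp
  qed
  then show "lie_bracket G (U, \<phi>) v w = br v w"
    by (simp add: lie_bracket_def br_def flip: e_def)
qed

lemma has_derivative_Dm_family:
  assumes z: "z \<in> DM" and h: "(h has_derivative h') (at z)"
  shows "((\<lambda>z. Dm z (h z)) has_derivative
    (\<lambda>u. frechet_derivative (\<lambda>y. Dm y (h z)) (at z) u + Dm z (h' u))) (at z)"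
  by (rule has_derivative_linear_family[OF open_DM z Dm_linear
        smooth_on_differentiable[OF smooth_on_frechet_derivative[OF smooth_mm] z] h])

text \<open>Differentiate \<open>left_invariance\<close> in \<open>a\<close> at \<open>e\<close>
  along \<open>v\<close>. The second derivative of the product that appears is symmetric in
  \<open>v\<close> and \<open>w\<close> and drops out of the difference; what remains is the left
  translate of \<open>br v w\<close>.\<close>

lemma field_bracket:
  assumes x: "x \<in> \<Omega>"
  shows "DB w x (B v x) - DB v x (B w x) = B (br v w) x"
proof -
  let ?dd = "\<lambda>w v. frechet_derivative (\<lambda>z. Dm z (0, w)) (at (x, e)) (0, v)"
  have "DB w x (B v x) = ?dd w v + Dm (x, e) (0, DB w e v)" for v w
  proof -
    let ?S = "{a. (x, a) \<in> DM}"
    have S: "open ?S" "e \<in> ?S" using open_slice(1)[OF open_DM] x by auto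
    have 1: "((\<lambda>a. B w (m x a)) has_derivative (\<lambda>v. DB w x (B v x))) (at e)"
      using has_derivative_compose[OF has_derivative_m_right[of x e], of "B w" "DB w x"]
        smooth_on_has_derivative[OF smooth_B] x by (simp add: B_def)
    have "((\<lambda>z. (0::'e, B w (snd z))) has_derivative (\<lambda>\<zeta>. (0, DB w e (snd \<zeta>)))) (at (x, e))"
      using has_derivative_Pair[OF has_derivative_const
          has_derivative_compose[OF has_derivative_snd[OF has_derivative_ident], of "B w" "DB w e" "(x, e)" UNIV]]
        smooth_on_has_derivative[OF smooth_B e_\<Omega>] by simp
    from has_derivative_Dm_family[OF DM_e(1)[OF x] this]
    have "((\<lambda>z. Dm z (0, B w (snd z))) has_derivative
        (\<lambda>\<zeta>. frechet_derivative (\<lambda>z. Dm z (0, w)) (at (x, e)) \<zeta> + Dm (x, e) (0, DB w e (snd \<zeta>)))) (at (x, e))"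
      using x by simp
    from has_derivative_compose[OF has_derivative_Pair[OF has_derivative_const has_derivative_ident] this]
    have 2: "((\<lambda>a. Dm (x, a) (0, B w a)) has_derivative (\<lambda>v. ?dd w v + Dm (x, e) (0, DB w e v))) (at e)"
      by simp
    from derivative_transfer[OF 1 2 S] left_invariance show ?thesis by (simp add: fun_eq_iff)
  qed
  moreover have "?dd w v = ?dd v w"
    using frechet_derivative_commute[OF smooth_mm open_DM, of "(x, e)" "(0, w)" "(0, v)"] x by simp
  ultimately show ?thesis
    using linear_diff[OF B_linear[OF x], of "DB w e v" "DB v e w"] by (simp add: B_def br_def)
qed

lemma DB_linear: "x \<in> \<Omega> \<Longrightarrow> linear (DB w x)"
  by (rule smooth_on_linear[OF smooth_B])

lemma DB_linear_left: "linear (\<lambda>w. DB w e v)"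
proof -
  have D: "(B w has_derivative DB w e) (at e)" for w
    by (rule smooth_on_has_derivative[OF smooth_B e_\<Omega>])
  have "DB (w + w') e = (\<lambda>v. DB w e v + DB w' e v)" for w w'
    by (rule derivative_transfer[OF D has_derivative_add[OF D D] open_\<Omega> e_\<Omega>])
      (simp add: linear_add[OF B_linear])
  moreover have "DB (r *\<^sub>R w) e = (\<lambda>v. r *\<^sub>R DB w e v)" for r w
    by (rule derivative_transfer[OF D has_derivative_scaleR_right[OF D] open_\<Omega> e_\<Omega>])
      (simp add: linear_scale[OF B_linear])
  ultimately show ?thesis by (simp add: linear_iff)
qed

lemma br_bilinear: "bilinear br"
  unfolding bilinear_def br_def
  using linear_compose_sub[OF DB_linear[OF e_\<Omega>] DB_linear_left]
    linear_compose_sub[OF DB_linear_left DB_linear[OF e_\<Omega>]] by simp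

lemma br_antisym: "br v w = - br w v"
  by (simp add: br_def)

text \<open>Since \<open>field_bracket\<close> holds on a whole neighbourhood, it can be
  differentiated at \<open>e\<close>, which gives the field of \<open>br v w\<close> to first order.
  The second derivatives of the fields are symmetric and cancel in the cyclic sum.\<close>

lemma br_jacobi: "br u (br v w) + br v (br w u) + br w (br u v) = 0"
proof -
  let ?dd = "\<lambda>w v u. frechet_derivative (\<lambda>y. DB w y v) (at e) u"
  have H: "((\<lambda>x. DB w x (B v x)) has_derivative (\<lambda>u. ?dd w v u + DB w e (DB v e u))) (at e)" for w v
    using has_derivative_linear_family[OF open_\<Omega> e_\<Omega> DB_linear
        smooth_on_differentiable[OF smooth_on_frechet_derivative[OF smooth_B] e_\<Omega>]
        smooth_on_has_derivative[OF smooth_B e_\<Omega>], of w v] by simp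
  have "DB (br v w) e u = ?dd w v u + DB w e (DB v e u) - (?dd v w u + DB v e (DB w e u))" for u v w
    using derivative_transfer[OF has_derivative_diff[OF H H] smooth_on_has_derivative[OF smooth_B e_\<Omega>]
        open_\<Omega> e_\<Omega> field_bracket] by (metis (no_types, lifting))
  moreover have "?dd w v u = ?dd w u v" for w v u
    by (rule frechet_derivative_commute[OF smooth_B open_\<Omega> e_\<Omega>])
  ultimately show ?thesis
    unfolding br_def[of u] br_def[of v "br w u"] br_def[of w "br u v"]
    by (simp add: br_def linear_diff[OF DB_linear[OF e_\<Omega>]])
qed

end

section \<open>Nilpotency of the bracket\<close>

context lie_chart
begin

text \<open>\<open>KK\<close> is the commutator map in the chart, so \<open>N x\<close> is \<open>Ad x - 1\<close> for \<open>x\<close>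
  near the identity.  The group being nilpotent, the iterates of \<open>y \<mapsto> KK (x, y)\<close> become constant, hence \<open>N x\<close> is nilpotent, and so is
  its derivative \<open>ad v\<close>, the limit of \<open>N (e + t v) / t\<close>.\<close>

definition KK where "KK z = m (mm z) (\<iota> (m (snd z) (fst z)))"
definition DK where "DK = {z \<in> {z \<in> {z \<in> DM. (snd z, fst z) \<in> DM}. m (snd z) (fst z) \<in> DI}.
  (mm z, \<iota> (m (snd z) (fst z))) \<in> DM}"

text \<open>The nested comprehension in \<open>DK\<close> follows the order of evaluation of
  \<open>KK\<close>, so that each stage is an open preimage under a map already known to be
  smooth.\<close>

lemma open_DK: "open DK" and smooth_KK: "smooth_on DK KK"
proof -
  let ?S1 = "{z \<in> DM. (snd z, fst z) \<in> DM}"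
  let ?S2 = "{z \<in> ?S1. m (snd z) (fst z) \<in> DI}"
  have sw: "smooth_on S (\<lambda>z::'e \<times> 'e. (snd z, fst z))" if "open S" for S
    by (intro smooth_on_Pair that smooth_on_bounded_linear[OF _ that smooth_on_id[OF that]]
        bounded_linear_fst bounded_linear_snd)
  have o1: "open ?S1" by (rule open_smooth_preimage[OF sw[OF open_DM] open_DM open_DM])
  have s1: "smooth_on ?S1 (\<lambda>z. mm (snd z, fst z))"
    by (rule smooth_on_compose[OF o1 open_DM _ sw[OF o1] smooth_mm]) simp
  then have s1': "smooth_on ?S1 (\<lambda>z. m (snd z) (fst z))" by simp
  have o2: "open ?S2" by (rule open_smooth_preimage[OF s1' o1 open_DI])
  have s2: "smooth_on ?S2 (\<lambda>z. \<iota> (m (snd z) (fst z)))"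
    by (rule smooth_on_compose[OF o2 open_DI _ smooth_on_subset[OF s1'] smooth_\<iota>]) auto
  have s3: "smooth_on ?S2 (\<lambda>z. (mm z, \<iota> (m (snd z) (fst z))))"
    by (rule smooth_on_Pair[OF o2 smooth_on_subset[OF smooth_mm] s2]) auto
  show o3: "open DK" unfolding DK_def by (rule open_smooth_preimage[OF s3 o2 open_DM])
  have "smooth_on DK (\<lambda>z. mm (mm z, \<iota> (m (snd z) (fst z))))"
    by (rule smooth_on_compose[OF o3 open_DM _ smooth_on_subset[OF s3] smooth_mm]) (auto simp: DK_def)
  then show "smooth_on DK KK" by (simp add: KK_def[abs_def])
qed

lemma DK_e: "x \<in> DI \<Longrightarrow> (x, e) \<in> DK" and KK_e: "x \<in> DI \<Longrightarrow> KK (x, e) = e"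
  by (simp_all add: DK_def KK_def \<iota>_right)

lemma DK_D:
  assumes "(x, y) \<in> DK"
  shows "(x, y) \<in> DM" "(y, x) \<in> DM" "KK (x, y) \<in> \<Omega>"
    "\<psi> (KK (x, y)) = \<psi> x \<otimes> \<psi> y \<otimes> inv \<psi> x \<otimes> inv \<psi> y"
    "(KK (x, y), m y x) \<in> DM" "m (KK (x, y)) (m y x) = m x y"
proof -
  show xy: "(x, y) \<in> DM" "(y, x) \<in> DM" using assms by (auto simp: DK_def)
  then have c [simp]: "x \<in> \<Omega>" "y \<in> \<Omega>" by (auto simp: DM_iff)
  show K: "KK (x, y) \<in> \<Omega>" using assms by (auto simp: DK_def KK_def)
  have "\<psi> (KK (x, y)) = \<psi> x \<otimes> \<psi> y \<otimes> inv (\<psi> y \<otimes> \<psi> x)"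
    using assms by (simp add: DK_def KK_def)
  then show p: "\<psi> (KK (x, y)) = \<psi> x \<otimes> \<psi> y \<otimes> inv \<psi> x \<otimes> inv \<psi> y"
    by (simp add: inv_mult_group m_assoc)
  have eq: "\<psi> (KK (x, y)) \<otimes> \<psi> (m y x) = \<psi> (m x y)"
    using xy by (simp add: p m_assoc) (simp flip: m_assoc)
  show D: "(KK (x, y), m y x) \<in> DM"
    using K xy eq \<psi>_U[of "m x y"] by (simp add: DM_iff[of "KK (x, y)"])
  show "m (KK (x, y)) (m y x) = m x y"
    using eq D xy by (intro \<psi>_eqD) auto
qed

definition N where "N x w = frechet_derivative KK (at (x, e)) (0, w)"

lemma N_derivative: "x \<in> DI \<Longrightarrow> ((\<lambda>y. KK (x, y)) has_derivative N x) (at e)"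
  using has_derivative_compose[OF has_derivative_Pair[OF has_derivative_const has_derivative_ident]
      smooth_on_has_derivative[OF smooth_KK DK_e], of x UNIV]
  by (simp add: N_def[abs_def])

lemma N_linear: "x \<in> DI \<Longrightarrow> linear (N x)"
  using N_derivative has_derivative_linear by blast

lemma N_differentiable: "(\<lambda>x. N x w) differentiable (at e)"
proof -
  have "((\<lambda>x. (x, e)) has_derivative (\<lambda>v. (v, 0))) (at e)"
    by (intro has_derivative_Pair has_derivative_const has_derivative_ident)
  from has_derivative_compose[OF this smooth_on_has_derivative[OF smooth_on_frechet_derivative[OF smooth_KK] DK_e[OF e_DI]]]
  show ?thesis unfolding N_def[abs_def] differentiable_def by blast
qed

text \<open>Differentiate \<open>m (KK (x, y)) (m y x) = m x y\<close> in \<open>y\<close> at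
  \<open>e\<close>. The outcome says that right translation of \<open>N x w + w\<close> to
  \<open>x\<close> equals left translation of \<open>w\<close>, which characterises
  \<open>Ad x w\<close>.\<close>

lemma N_relation: "x \<in> DI \<Longrightarrow> Dm (e, x) (N x w + w, 0) = B w x"
proof -
  assume x: "x \<in> DI"
  then have [simp]: "x \<in> \<Omega>" by simp
  let ?S = "{y. (x, y) \<in> DK}"
  have S: "open ?S" "e \<in> ?S" using open_slice(1)[OF open_DK] DK_e[OF x] by auto
  have "((\<lambda>y. m y x) has_derivative (\<lambda>v. Dm (e, x) (v, 0))) (at e)"
    by (rule has_derivative_m_left) simp
  from has_derivative_m[OF N_derivative[OF x] this]
  have 1: "((\<lambda>y. m (KK (x, y)) (m y x)) has_derivative (\<lambda>v. Dm (e, x) (N x v, Dm (e, x) (v, 0)))) (at e)"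
    by (simp add: KK_e[OF x])
  have 2: "((\<lambda>y. m x y) has_derivative (\<lambda>v. Dm (x, e) (0, v))) (at e)"
    by (rule has_derivative_m_right) simp
  from derivative_transfer[OF 1 2 S] DK_D(6)
  have "Dm (e, x) (N x w, Dm (e, x) (w, 0)) = B w x" by (simp add: B_def fun_eq_iff)
  moreover have "Dm (e, x) (N x w + w, 0) = Dm (e, x) (N x w, 0) + Dm (e, x) (w, 0)"
    using linear_add[OF Dm_linear, of "(e, x)" "(N x w, 0)" "(w, 0)"] by simp
  ultimately show "Dm (e, x) (N x w + w, 0) = B w x"
    using Dm_split[of "(e, x)" "N x w" "Dm (e, x) (w, 0)"] Dm_e_left[of x] by simp
qed

lemma N_e: "N e w = 0"
  using N_relation[OF e_DI, of w] Dm_e_right[of e "N e w + w"] by simp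

text \<open>Differentiate \<open>N_relation\<close> in \<open>x\<close> at \<open>e\<close>. The
  right translation contributes a mixed second derivative of the product, which by symmetry is also
  the derivative of a left field, so that \<open>N' v = DB w e v - DB v e w\<close>.\<close>

lemma N_has_derivative_br: "((\<lambda>x. N x w) has_derivative (\<lambda>v. br v w)) (at e)"
proof -
  have ee: "(e, e) \<in> DM" by simp
  define N' where "N' = frechet_derivative (\<lambda>x. N x w) (at e)"
  have N': "((\<lambda>x. N x w) has_derivative N') (at e)"
    unfolding N'_def using N_differentiable frechet_derivative_works by blast
  from has_derivative_compose[OF has_derivative_snd[OF has_derivative_ident], of "\<lambda>x. N x w" N' "(e, e)" UNIV]
  have "((\<lambda>z. N (snd z) w) has_derivative (\<lambda>\<zeta>. N' (snd \<zeta>))) (at (e, e))" using N' by simp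
  from has_derivative_Pair[OF has_derivative_add[OF this has_derivative_const] has_derivative_const]
  have h: "((\<lambda>z. (N (snd z) w + w, 0::'e)) has_derivative (\<lambda>\<zeta>. (N' (snd \<zeta>), 0))) (at (e, e))" by simp
  from has_derivative_compose[OF has_derivative_Pair[OF has_derivative_const has_derivative_ident]
      has_derivative_Dm_family[OF ee h]]
  have 1: "((\<lambda>x. Dm (e, x) (N x w + w, 0)) has_derivative
      (\<lambda>v. frechet_derivative (\<lambda>y. Dm y (w, 0)) (at (e, e)) (0, v) + Dm (e, e) (N' v, 0))) (at e)"
    by (simp add: N_e)
  from derivative_transfer[OF 1 smooth_on_has_derivative[OF smooth_B e_\<Omega>] open_DI e_DI N_relation]
  have "frechet_derivative (\<lambda>y. Dm y (w, 0)) (at (e, e)) (0, v) + N' v = DB w e v" for v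
    by (simp add: Dm_e_right fun_eq_iff)
  moreover have "frechet_derivative (\<lambda>y. Dm y (w, 0)) (at (e, e)) (0, v) = DB v e w" for v
  proof -
    have "((\<lambda>x. (x, e)) has_derivative (\<lambda>v. (v, 0))) (at e)"
      by (intro has_derivative_Pair has_derivative_const has_derivative_ident)
    from has_derivative_compose[OF this smooth_on_has_derivative[OF smooth_on_frechet_derivative[OF smooth_mm] ee]]
    have "(B v has_derivative (\<lambda>w. frechet_derivative (\<lambda>y. Dm y (0, v)) (at (e, e)) (w, 0))) (at e)"
      unfolding B_def[abs_def] .
    from fun_cong[OF frechet_derivative_at[OF this], of w]
    show ?thesis using frechet_derivative_commute[OF smooth_mm open_DM ee, of "(w, 0)" "(0, v)"] by simp
  qed
  ultimately have "N' = (\<lambda>v. br v w)"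
    by (simp add: br_def fun_eq_iff eq_diff_eq add.commute)
  then show ?thesis using N' by simp
qed

lemma commutator_power_mem:
  assumes "p \<in> carrier G" "q \<in> carrier G"
  shows "((\<lambda>y. p \<otimes> y \<otimes> inv p \<otimes> inv y) ^^ j) q \<in> lower_central_series G j"
proof (induction j)
  case (Suc j)
  then show ?case using assms(1) by (auto intro!: generate.incl)
qed (simp add: assms)

text \<open>\<open>e\<close> is a fixed point of the map \<open>y \<mapsto> KK (x, y)\<close>, so by
  the chain rule its iterates have derivative \<open>N x ^^ j\<close> there. The iterated
  commutators descend the lower central series, which reaches the trivial group at
  \<open>k\<close>.\<close>

lemma N_nilpotent:
  assumes k: "lower_central_series G k = {\<one>}" and x: "x \<in> DI"
  shows "(N x ^^ k) w = 0"
proof -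
  let ?K = "\<lambda>y. KK (x, y)" and ?c = "\<lambda>q. \<psi> x \<otimes> q \<otimes> inv (\<psi> x) \<otimes> inv q"
  let ?S = "{y. (x, y) \<in> DK}"
  have S: "open ?S" "e \<in> ?S" using open_slice(1)[OF open_DK] DK_e[OF x] by auto
  \<comment> \<open>\<open>KK\<close> has its meaning only on \<open>DK\<close>, so the induction
    also carries a neighbourhood on which the iterates stay in the chart and agree with the group
    commutators.\<close>
  have step: "((?K ^^ j) has_derivative (N x ^^ j)) (at e) \<and> (?K ^^ j) e = e \<and>
    (\<exists>T. open T \<and> e \<in> T \<and> (\<forall>y\<in>T. (?K ^^ j) y \<in> \<Omega> \<and> \<psi> ((?K ^^ j) y) = (?c ^^ j) (\<psi> y)))" for j
  proof (induction j)
    case 0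
    have "\<exists>T. open T \<and> e \<in> T \<and> (\<forall>y\<in>T. y \<in> \<Omega>)"
      using open_\<Omega> e_\<Omega> by blast
    then show ?case by (simp add: id_def)
  next
    case (Suc j)
    then obtain T where T: "open T" "e \<in> T"
      "\<And>y. y \<in> T \<Longrightarrow> (?K ^^ j) y \<in> \<Omega> \<and> \<psi> ((?K ^^ j) y) = (?c ^^ j) (\<psi> y)" by blast
    have d: "((?K ^^ j) has_derivative (N x ^^ j)) (at e)" and f: "(?K ^^ j) e = e" using Suc by auto
    have "isCont (?K ^^ j) e" using d has_derivative_continuous by blast
    then obtain T' where T': "open T'" "e \<in> T'" "\<And>y. y \<in> T' \<Longrightarrow> (?K ^^ j) y \<in> ?S"
      using S f unfolding continuous_at_open by (metis (no_types, lifting))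
    have "((\<lambda>y. ?K ((?K ^^ j) y)) has_derivative (\<lambda>v. N x ((N x ^^ j) v))) (at e)"
      using has_derivative_compose[OF d, of ?K "N x"] N_derivative[OF x] f by simp
    moreover have "?K ((?K ^^ j) e) = e" using f KK_e[OF x] by simp
    moreover have "\<forall>y\<in>T \<inter> T'. ?K ((?K ^^ j) y) \<in> \<Omega> \<and> \<psi> (?K ((?K ^^ j) y)) = ?c ((?c ^^ j) (\<psi> y))"
    proof
      fix y assume y: "y \<in> T \<inter> T'"
      then have "(x, (?K ^^ j) y) \<in> DK" using T' by auto
      from DK_D(3,4)[OF this] T(3)[of y] y
      show "?K ((?K ^^ j) y) \<in> \<Omega> \<and> \<psi> (?K ((?K ^^ j) y)) = ?c ((?c ^^ j) (\<psi> y))" by simp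
    qed
    ultimately show ?case
      using open_Int[OF T(1) T'(1)] T(2) T'(2) by (auto simp: o_def)
  qed
  from step[of k] obtain T where T: "open T" "e \<in> T"
      "\<forall>y\<in>T. (?K ^^ k) y \<in> \<Omega> \<and> \<psi> ((?K ^^ k) y) = (?c ^^ k) (\<psi> y)"
    by (elim conjE exE)
  have "(?K ^^ k) y = e" if "y \<in> T \<inter> \<Omega>" for y
  proof (rule \<psi>_eqD)
    have "(?c ^^ k) (\<psi> y) \<in> lower_central_series G k"
      using x that by (intro commutator_power_mem) auto
    then show "\<psi> ((?K ^^ k) y) = \<psi> e" using T(3) that k by simp
  qed (use T that in auto)
  then have "N x ^^ k = (\<lambda>v. 0)"
    using derivative_transfer[of "?K ^^ k" "N x ^^ k" e "\<lambda>y. e" "\<lambda>v. 0" "T \<inter> \<Omega>"] step[of k]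
      open_Int[OF T(1) open_\<Omega>] T(2) by auto
  then show ?thesis by simp
qed

lemma br_nilpotent:
  assumes "nilpotent_group G"
  shows "\<exists>k. \<forall>w. (br v ^^ k) w = 0"
proof -
  obtain k where k: "lower_central_series G k = {\<one>}"
    using assms by (auto simp: nilpotent_group_def)
  \<comment> \<open>The limit is one-sided so that the absolute value in the difference quotient is
    \<open>t\<close> itself.\<close>
  define F where "F = at_right (0::real)"
  define a where "a t u = (1 / t) *\<^sub>R N (e + t *\<^sub>R v) u" for t u
  have br_lin: "linear (br v)" using br_bilinear by (simp add: bilinear_def)
  have ev: "eventually (\<lambda>t. t > 0 \<and> e + t *\<^sub>R v \<in> DI) F"
  proof -
    have "((\<lambda>t. e + t *\<^sub>R v) \<longlongrightarrow> e + 0 *\<^sub>R v) F" unfolding F_def by (intro tendsto_intros)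
    then have "eventually (\<lambda>t. e + t *\<^sub>R v \<in> DI) F"
      by (rule topological_tendstoD[OF _ open_DI]) simp
    moreover have "eventually (\<lambda>t. t > 0) F" unfolding F_def by (rule eventually_at_right_less)
    ultimately show ?thesis by eventually_elim auto
  qed
  have a_lin: "linear (a t)" if "e + t *\<^sub>R v \<in> DI" for t
    unfolding a_def by (intro linear_compose_scale_right N_linear that)
  have lim1: "((\<lambda>t. a t u) \<longlongrightarrow> br v u) F" for u
  proof -
    have line: "((\<lambda>t. e + t *\<^sub>R v) has_derivative (\<lambda>h. h *\<^sub>R v)) (at 0)"
      by (auto intro!: derivative_eq_intros)
    have "((\<lambda>t. N (e + t *\<^sub>R v) u) has_derivative (\<lambda>h. br (h *\<^sub>R v) u)) (at 0)"
      using has_derivative_compose[OF line, of "\<lambda>x. N x u" "\<lambda>v. br v u"] N_has_derivative_br by simp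
    then have "((\<lambda>t. N (e + t *\<^sub>R v) u) has_vector_derivative br v u) (at 0)"
      by (simp add: has_vector_derivative_def bilinear_lmul[OF br_bilinear])
    then have "((\<lambda>t. N (e + t *\<^sub>R v) u) has_vector_derivative br v u) (at 0 within {0<..})"
      by (rule has_vector_derivative_at_within)
    then have "((\<lambda>t. (N (e + t *\<^sub>R v) u - t *\<^sub>R br v u) /\<^sub>R \<bar>t\<bar>) \<longlongrightarrow> 0) F"
      unfolding F_def has_vector_derivative_def has_derivative_at_within by (simp add: N_e)
    moreover have "eventually (\<lambda>t. (N (e + t *\<^sub>R v) u - t *\<^sub>R br v u) /\<^sub>R \<bar>t\<bar> = a t u - br v u) F"
      using ev by eventually_elim (simp add: a_def algebra_simps divide_inverse)
    ultimately have "((\<lambda>t. a t u - br v u) \<longlongrightarrow> 0) F"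
      by (rule Lim_transform_eventually)
    then show ?thesis by (rule LIM_zero_cancel)
  qed
  \<comment> \<open>Iterating the limit needs moving arguments; for linear maps on a
    finite-dimensional space pointwise convergence suffices, by expansion in
    \<open>Basis\<close>.\<close>
  have lim2: "((\<lambda>t. a t (f t)) \<longlongrightarrow> br v u) F" if f: "(f \<longlongrightarrow> u) F" for f u
  proof -
    have "((\<lambda>t. \<Sum>b\<in>Basis. (f t \<bullet> b) *\<^sub>R a t b) \<longlongrightarrow> (\<Sum>b\<in>Basis. (u \<bullet> b) *\<^sub>R br v b)) F"
      by (intro tendsto_intros f lim1)
    moreover have "eventually (\<lambda>t. (\<Sum>b\<in>Basis. (f t \<bullet> b) *\<^sub>R a t b) = a t (f t)) F"
      using ev by eventually_elim (rule linear_eq_sum_Basis[OF a_lin, symmetric], simp)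
    ultimately have "((\<lambda>t. a t (f t)) \<longlongrightarrow> (\<Sum>b\<in>Basis. (u \<bullet> b) *\<^sub>R br v b)) F"
      by (rule Lim_transform_eventually)
    then show ?thesis by (simp only: linear_eq_sum_Basis[OF br_lin, symmetric])
  qed
  have lim3: "((\<lambda>t. (a t ^^ j) w) \<longlongrightarrow> (br v ^^ j) w) F" for j w
    by (induction j) (simp_all add: lim2)
  have pow: "(a t ^^ j) w = (1 / t) ^ j *\<^sub>R (N (e + t *\<^sub>R v) ^^ j) w" if "e + t *\<^sub>R v \<in> DI" for t j w
    by (induction j) (simp_all add: a_def linear_scale[OF N_linear[OF that]])
  have "eventually (\<lambda>t. (a t ^^ k) w = 0) F" for w
    using ev by eventually_elim (simp add: pow N_nilpotent[OF k])
  then have "((\<lambda>t. (a t ^^ k) w) \<longlongrightarrow> 0) F" for w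
    by (rule tendsto_eventually)
  then have "(br v ^^ k) w = 0" for w
    using tendsto_unique[OF _ lim3[of k w]] by (simp add: F_def)
  then show ?thesis by blast
qed

end

section \<open>Local exponential map for a vanishing bracket\<close>

text \<open>The primitive is the integral over \<open>t\<close> of \<open>\<alpha> (x - c)\<close>
  at the point \<open>c + t *\<^sub>R (x - c)\<close>. Differentiating under the integral and using
  closedness turns the integrand into the \<open>t\<close>-derivative of \<open>t\<close> times
  \<open>\<alpha> u\<close>, so only the end point \<open>t = 1\<close> contributes.\<close>

lemma poincare_lemma_1form:
  fixes \<alpha> :: "'a::euclidean_space \<Rightarrow> 'a \<Rightarrow> 'b::euclidean_space"
  assumes S: "open S" "convex S" "c \<in> S"
    and smooth: "\<And>u. smooth_on S (\<alpha> u)"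
    and lin: "\<And>x. x \<in> S \<Longrightarrow> linear (\<lambda>u. \<alpha> u x)"
    and closed: "\<And>x u v. x \<in> S \<Longrightarrow> frechet_derivative (\<alpha> u) (at x) v = frechet_derivative (\<alpha> v) (at x) u"
  shows "\<exists>f. \<forall>x\<in>S. (f has_derivative (\<lambda>u. \<alpha> u x)) (at x)"
proof -
  define y where "y x t = c + t *\<^sub>R (x - c)" for x :: 'a and t :: real
  define d where "d u x = frechet_derivative (\<alpha> u) (at x)" for u x
  have yS: "y x t \<in> S" if "x \<in> S" "t \<in> cbox 0 1" for x t
  proof -
    have "y x t = (1 - t) *\<^sub>R c + t *\<^sub>R x" by (simp add: y_def algebra_simps)
    then show ?thesis using convexD_alt[OF S(2,3), of x t] that by simp
  qed
  have der: "(\<alpha> u has_derivative d u x) (at x)" if "x \<in> S" for u x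
    unfolding d_def by (rule smooth_on_has_derivative[OF smooth that])
  have dlin: "linear (d u x)" if "x \<in> S" for u x
    unfolding d_def by (rule smooth_on_linear[OF smooth that])
  \<comment> \<open>The derivative in \<open>x\<close> of the integrand: one term from the moving
    base point, one from the moving direction \<open>x - c\<close>.\<close>
  define F where "F x t u = t *\<^sub>R d (x - c) (y x t) u + \<alpha> u (y x t)" for x t u
  have F_blin: "bounded_linear (F x t)" if "x \<in> S" "t \<in> cbox 0 1" for x t
    unfolding F_def linear_conv_bounded_linear[symmetric]
    by (intro linear_compose_add linear_compose_scale_right dlin lin yS that)
  have F_apply: "blinfun_apply (Blinfun (F x t)) = F x t" if "x \<in> S" "t \<in> cbox 0 1" for x t
    using F_blin[OF that] by (simp add: bounded_linear_Blinfun_apply)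
  have cont_y: "continuous_on (S \<times> cbox 0 1) (\<lambda>z. y (fst z) (snd z))"
    unfolding y_def by (intro continuous_intros)
  have y_img: "(\<lambda>z. y (fst z) (snd z)) ` (S \<times> cbox 0 1) \<subseteq> S" using yS by auto
  have cont_\<alpha>: "continuous_on (S \<times> cbox 0 1) (\<lambda>z. \<alpha> u (y (fst z) (snd z)))" for u
    by (rule continuous_on_compose2[OF smooth_on_continuous_on[OF smooth] cont_y y_img])
  have cont_d: "continuous_on (S \<times> cbox 0 1) (\<lambda>z. d u (y (fst z) (snd z)) v)" for u v
    unfolding d_def
    by (rule continuous_on_compose2[OF smooth_on_continuous_on[OF smooth_on_frechet_derivative[OF smooth]] cont_y y_img])
  have cont_F: "continuous_on (S \<times> cbox 0 1) (\<lambda>z. F (fst z) (snd z) u)" for u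
  proof -
    have "continuous_on (S \<times> cbox 0 1) (\<lambda>z. snd z *\<^sub>R (\<Sum>b\<in>Basis. ((fst z - c) \<bullet> b) *\<^sub>R d u (y (fst z) (snd z)) b)
        + \<alpha> u (y (fst z) (snd z)))"
      by (intro continuous_intros cont_\<alpha> cont_d)
    moreover have "F (fst z) (snd z) u = snd z *\<^sub>R (\<Sum>b\<in>Basis. ((fst z - c) \<bullet> b) *\<^sub>R d u (y (fst z) (snd z)) b)
        + \<alpha> u (y (fst z) (snd z))" if "z \<in> S \<times> cbox 0 1" for z
    proof -
      have z: "y (fst z) (snd z) \<in> S" using that yS by auto
      \<comment> \<open>Closedness moves the varying vector out of the index of \<open>d\<close>
        into its linear argument, where it can be expanded in fixed directions.\<close>
      have "d (fst z - c) (y (fst z) (snd z)) u = d u (y (fst z) (snd z)) (fst z - c)"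
        unfolding d_def by (rule closed[OF z])
      then show ?thesis unfolding F_def using linear_eq_sum_Basis[OF dlin[OF z, of u], of "fst z - c"] by presburger
    qed
    ultimately show ?thesis by (subst continuous_on_cong[OF refl])
  qed
  have leib: "((\<lambda>x. integral (cbox 0 1) (\<lambda>t. \<alpha> (x - c) (y x t))) has_derivative
      integral (cbox 0 1) (\<lambda>t. Blinfun (F x0 t))) (at x0 within S)" if x0: "x0 \<in> S" for x0
  proof (rule leibniz_rule[OF _ _ _ x0 S(2)])
    fix x t assume x: "x \<in> S" and t: "t \<in> cbox (0::real) 1"
    have hy: "((\<lambda>x. y x t) has_derivative (\<lambda>u. t *\<^sub>R u)) (at x)"
      unfolding y_def by (auto intro!: derivative_eq_intros)
    have dy: "((\<lambda>x. \<alpha> u (y x t)) has_derivative (\<lambda>v. d u (y x t) (t *\<^sub>R v))) (at x)" for u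
      by (rule has_derivative_compose[OF hy der[OF yS[OF x t]]])
    have "((\<lambda>x. \<alpha> (x - c) (y x t)) has_derivative
        (\<lambda>u. frechet_derivative (\<lambda>x'. \<alpha> (x - c) (y x' t)) (at x) u + \<alpha> u (y x t))) (at x)"
    proof (rule has_derivative_linear_family[OF S(1) x lin[OF yS[OF _ t]]])
      show "(\<lambda>x. \<alpha> b (y x t)) differentiable at x" for b using dy differentiableI by blast
      show "((\<lambda>x. x - c) has_derivative (\<lambda>u. u)) (at x)" by (auto intro!: derivative_eq_intros)
    qed
    moreover have "(\<lambda>u. frechet_derivative (\<lambda>x'. \<alpha> (x - c) (y x' t)) (at x) u + \<alpha> u (y x t)) = F x t"
      unfolding F_def using frechet_derivative_at[OF dy[of "x - c"]] linear_scale[OF dlin[OF yS[OF x t]]]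
      by (metis (no_types, lifting))
    ultimately show "((\<lambda>x. \<alpha> (x - c) (y x t)) has_derivative blinfun_apply (Blinfun (F x t))) (at x within S)"
      using F_apply[OF x t] by (simp add: has_derivative_at_withinI)
  next
    fix x assume x: "x \<in> S"
    have "continuous_on (cbox 0 1) (\<lambda>t. \<Sum>b\<in>Basis. ((x - c) \<bullet> b) *\<^sub>R \<alpha> b (y x t))"
    proof (intro continuous_intros)
      fix b
      show "continuous_on (cbox 0 1) (\<lambda>t. \<alpha> b (y x t))"
        by (rule continuous_on_compose2[OF smooth_on_continuous_on[OF smooth]])
          (use yS[OF x] in \<open>auto simp: y_def intro!: continuous_intros\<close>)
    qed
    moreover have "(\<Sum>b\<in>Basis. ((x - c) \<bullet> b) *\<^sub>R \<alpha> b (y x t)) = \<alpha> (x - c) (y x t)" if "t \<in> cbox 0 1" for t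
      by (rule linear_eq_sum_Basis[OF lin[OF yS[OF x that]], symmetric])
    ultimately have "continuous_on (cbox 0 1) (\<lambda>t. \<alpha> (x - c) (y x t))"
      by (subst (asm) continuous_on_cong[OF refl])
    then show "(\<lambda>t. \<alpha> (x - c) (y x t)) integrable_on cbox 0 1"
      by (rule integrable_continuous)
  next
    show "continuous_on (S \<times> cbox 0 1) (\<lambda>(x, t). Blinfun (F x t))"
    proof (rule continuous_on_blinfun_componentwise)
      fix i :: 'a
      show "continuous_on (S \<times> cbox 0 1) (\<lambda>z. blinfun_apply (case z of (x, t) \<Rightarrow> Blinfun (F x t)) i)"
        by (subst continuous_on_cong[OF refl, of _ _ "\<lambda>z. F (fst z) (snd z) i"]) (use cont_F in \<open>auto simp: F_apply\<close>)
    qed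
  qed
  have int: "integral (cbox 0 1) (\<lambda>t. Blinfun (F x t)) = Blinfun (\<lambda>u. \<alpha> u x)" if x: "x \<in> S" for x
  proof (rule blinfun_eqI)
    fix u
    have cont: "continuous_on (cbox 0 1) (\<lambda>t. Blinfun (F x t))"
    proof (rule continuous_on_blinfun_componentwise)
      fix i :: 'a
      have "continuous_on (cbox 0 1) (\<lambda>t. F (fst (x, t)) (snd (x, t)) i)"
        by (rule continuous_on_compose2[OF cont_F]) (use x in \<open>auto intro!: continuous_intros\<close>)
      then show "continuous_on (cbox 0 1) (\<lambda>t. blinfun_apply (Blinfun (F x t)) i)"
        by (subst continuous_on_cong[OF refl, of _ _ "\<lambda>t. F x t i"]) (auto simp: F_apply[OF x])
    qed
    have "integral (cbox 0 1) (\<lambda>t. Blinfun (F x t)) u = integral (cbox 0 1) (\<lambda>t. Blinfun (F x t) u)"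
      by (rule blinfun_apply_integral[OF integrable_continuous[OF cont]])
    also have "\<dots> = integral {0..1} (\<lambda>t. F x t u)"
      unfolding cbox_interval by (rule integral_cong) (use F_apply[OF x] in simp)
    also have "\<dots> = 1 *\<^sub>R \<alpha> u (y x 1) - 0 *\<^sub>R \<alpha> u (y x 0)"
    proof (rule integral_unique, rule fundamental_theorem_of_calculus)
      fix t :: real assume t: "t \<in> {0..1}"
      then have yt: "y x t \<in> S" using yS[OF x] by simp
      have "((\<lambda>t. y x t) has_derivative (\<lambda>h. h *\<^sub>R (x - c))) (at t)"
        unfolding y_def by (auto intro!: derivative_eq_intros)
      from has_derivative_compose[OF this der[OF yt, of u]]
      have "((\<lambda>t. t *\<^sub>R \<alpha> u (y x t)) has_derivative
          (\<lambda>h. t *\<^sub>R d u (y x t) (h *\<^sub>R (x - c)) + h *\<^sub>R \<alpha> u (y x t))) (at t)"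
        by (intro has_derivative_scaleR has_derivative_ident)
      moreover have "d u (y x t) (x - c) = d (x - c) (y x t) u"
        unfolding d_def by (rule closed[OF yt])
      ultimately have "((\<lambda>t. t *\<^sub>R \<alpha> u (y x t)) has_vector_derivative F x t u) (at t)"
        by (simp add: has_vector_derivative_def F_def linear_scale[OF dlin[OF yt]]
            scaleR_add_right mult.commute add.commute)
      then show "((\<lambda>t. t *\<^sub>R \<alpha> u (y x t)) has_vector_derivative F x t u) (at t within {0..1})"
        by (rule has_vector_derivative_at_within)
    qed simp
    finally show "blinfun_apply (integral (cbox 0 1) (\<lambda>t. Blinfun (F x t))) u = blinfun_apply (Blinfun (\<lambda>u. \<alpha> u x)) u"
      using lin[OF x] by (simp add: y_def bounded_linear_Blinfun_apply linear_conv_bounded_linear)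
  qed
  show ?thesis
  proof (intro exI ballI)
    fix x assume x: "x \<in> S"
    show "((\<lambda>x. integral (cbox 0 1) (\<lambda>t. \<alpha> (x - c) (y x t))) has_derivative (\<lambda>u. \<alpha> u x)) (at x)"
      using leib[OF x] lin[OF x] at_within_open[OF x S(1)] int[OF x]
      by (simp add: bounded_linear_Blinfun_apply linear_conv_bounded_linear)
  qed
qed


section \<open>Closed Maurer-Cartan form and local logarithm\<close>

locale abelian_chart = lie_chart G A U \<phi>
  for G :: "('g::topological_space, 'k) monoid_scheme" (structure)
    and A :: "('g, 'e::euclidean_space) chart set" and U :: "'g set" and \<phi> :: "'g \<Rightarrow> 'e" +
  assumes br_zero: "br v w = 0"
begin

text \<open>\<open>\<alpha>\<close> is the left-invariant Maurer-Cartan form.\<close>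

definition \<alpha> where "\<alpha> u x = Dm (\<iota> x, x) (0, u)"

lemma smooth_\<alpha>: "smooth_on DI (\<alpha> u)"
  unfolding \<alpha>_def[abs_def]
  by (rule smooth_on_compose[OF open_DI open_DM _ smooth_on_Pair[OF open_DI smooth_\<iota> smooth_on_id[OF open_DI]]
        smooth_on_frechet_derivative[OF smooth_mm]]) (rule \<iota>_left)

lemma \<alpha>_linear: "x \<in> DI \<Longrightarrow> linear (\<lambda>u. \<alpha> u x)"
proof -
  assume "x \<in> DI"
  then have L: "linear (Dm (\<iota> x, x))" by (simp add: Dm_linear \<iota>_left)
  show ?thesis
    using linear_add[OF L, of "(0, _)" "(0, _)"] linear_scale[OF L, of _ "(0, _)"]
    by (simp add: \<alpha>_def linear_iff)
qed

lemma \<alpha>_B: "x \<in> DI \<Longrightarrow> \<alpha> (B w x) x = w"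
  using left_invariance[OF \<iota>_left(1), of x w] by (simp add: \<alpha>_def \<iota>_left(2))

text \<open>\<open>\<alpha>_B\<close> makes \<open>w \<mapsto> B w x\<close> injective; an injective
  endomorphism of a finite-dimensional space is surjective, so the one-sided inverse is
  two-sided.\<close>

lemma B_\<alpha>: "x \<in> DI \<Longrightarrow> B (\<alpha> u x) x = u"
proof -
  assume x: "x \<in> DI"
  then have "inj (\<lambda>w. B w x)" by (intro inj_on_inverseI[of _ "\<lambda>u. \<alpha> u x"]) (simp add: \<alpha>_B)
  then have "surj (\<lambda>w. B w x)"
    by (rule linear_inj_imp_surj[OF B_linear[OF DI_\<Omega>[OF x]]])
  then obtain w where "u = B w x" by (rule surjE)
  then show ?thesis using \<alpha>_B[OF x] by simp
qed

lemma \<alpha>_e: "\<alpha> u e = u"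
  using \<alpha>_B[OF e_DI, of u] by simp

text \<open>The Maurer-Cartan equation with zero bracket. Differentiating
  \<open>\<alpha> (B w y) y = w\<close> expresses the derivative of \<open>\<alpha>\<close> through
  that of the fields; its skew part is \<open>\<alpha>\<close> of a commutator of left fields, zero
  by \<open>field_bracket\<close> and \<open>br_zero\<close>.\<close>

lemma \<alpha>_closed:
  assumes x: "x \<in> DI"
  shows "frechet_derivative (\<alpha> u) (at x) v = frechet_derivative (\<alpha> v) (at x) u"
proof -
  have xO: "x \<in> \<Omega>" using x by simp
  have 1: "frechet_derivative (\<alpha> (B w x)) (at x) v = - \<alpha> (DB w x v) x" for v w
  proof -
    have "((\<lambda>y. \<alpha> (B w y) y) has_derivative
        (\<lambda>v. frechet_derivative (\<lambda>y. \<alpha> (B w x) y) (at x) v + \<alpha> (DB w x v) x)) (at x)"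
      by (rule has_derivative_linear_family[OF open_DI x \<alpha>_linear smooth_on_differentiable[OF smooth_\<alpha> x]
            smooth_on_has_derivative[OF smooth_B xO]])
    from fun_cong[OF derivative_transfer[OF this has_derivative_const open_DI x \<alpha>_B], of v]
    show ?thesis by (simp add: eq_neg_iff_add_eq_0)
  qed
  have "frechet_derivative (\<alpha> u) (at x) v - frechet_derivative (\<alpha> v) (at x) u =
      \<alpha> (DB (\<alpha> v x) x (B (\<alpha> u x) x) - DB (\<alpha> u x) x (B (\<alpha> v x) x)) x"
    using 1[of "\<alpha> u x" v] 1[of "\<alpha> v x" u] by (simp add: B_\<alpha>[OF x] linear_diff[OF \<alpha>_linear[OF x]])
  also have "\<dots> = 0"
    unfolding field_bracket[OF xO] br_zero
    by (simp add: linear_0[OF B_linear[OF xO]] linear_0[OF \<alpha>_linear[OF x]])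
  finally show ?thesis by simp
qed

lemma local_logarithm:
  obtains r f where "r > 0" "ball e r \<subseteq> DI" "f e = 0"
    "\<And>x. x \<in> ball e r \<Longrightarrow> (f has_derivative (\<lambda>u. \<alpha> u x)) (at x)"
proof -
  obtain r where r: "r > 0" "ball e r \<subseteq> DI" using open_DI e_DI open_contains_ball by blast
  have "\<exists>f. \<forall>x\<in>ball e r. (f has_derivative (\<lambda>u. \<alpha> u x)) (at x)"
    by (rule poincare_lemma_1form[of _ e])
      (use r in \<open>auto intro: smooth_on_subset[OF smooth_\<alpha>] \<alpha>_linear \<alpha>_closed\<close>)
  then obtain f where f: "\<And>x. x \<in> ball e r \<Longrightarrow> (f has_derivative (\<lambda>u. \<alpha> u x)) (at x)" by blast
  have "((\<lambda>x. f x - f e) has_derivative (\<lambda>u. \<alpha> u x)) (at x)" if "x \<in> ball e r" for x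
    using has_derivative_diff[OF f[OF that] has_derivative_const] by simp
  then show thesis using that[of r "\<lambda>x. f x - f e"] r by simp
qed

text \<open>For fixed \<open>x\<close> the map \<open>y \<mapsto> f (m x y) - f y\<close> has zero
  derivative, since \<open>\<alpha>\<close> is left-invariant; on a ball it is constant, with value
  \<open>f x\<close> at \<open>y = e\<close>.\<close>

lemma additive_logarithm:
  assumes "ball e r \<subseteq> DI" "r > 0" "f e = 0"
    and f: "\<And>x. x \<in> ball e r \<Longrightarrow> (f has_derivative (\<lambda>u. \<alpha> u x)) (at x)"
  obtains s where "0 < s" "s \<le> r"
    "\<And>x y. x \<in> ball e s \<Longrightarrow> y \<in> ball e s \<Longrightarrow> (x, y) \<in> DM \<and> f (m x y) = f x + f y"
proof -
  let ?P = "{z \<in> DM. mm z \<in> ball e r}"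
  have "open ?P" by (rule open_smooth_preimage[OF smooth_mm open_DM open_ball])
  moreover have "(e, e) \<in> ?P" using assms(2) by simp
  ultimately obtain A1 A2 where A12: "open A1" "open A2" "(e, e) \<in> A1 \<times> A2" "A1 \<times> A2 \<subseteq> ?P"
    by (rule open_prod_elim)
  then have "open (A1 \<inter> A2)" "e \<in> A1 \<inter> A2" by auto
  then obtain s0 where s0: "s0 > 0" "ball e s0 \<subseteq> A1 \<inter> A2" using open_contains_ball by blast
  define s where "s = min s0 r"
  have s: "0 < s" "s \<le> r" "ball e s \<subseteq> A1 \<inter> A2" using s0 assms(2) by (auto simp: s_def)
  have P: "(x, y) \<in> DM" "m x y \<in> ball e r" if "x \<in> ball e s" "y \<in> ball e s" for x y
  proof -
    have "(x, y) \<in> A1 \<times> A2" using that s(3) by blast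
    then show "(x, y) \<in> DM" "m x y \<in> ball e r" using A12(4) by auto
  qed
  have "f (m x y) = f x + f y" if x: "x \<in> ball e s" and y: "y \<in> ball e s" for x y
  proof -
    have "((\<lambda>y. f (m x y) - f y) has_derivative (\<lambda>u. 0)) (at y)" if y: "y \<in> ball e s" for y
    proof -
      have yr: "y \<in> ball e r" using y s by auto
      then have yD: "y \<in> DI" using assms by auto
      have mD: "m x y \<in> DI" using P(2)[OF x y] assms by auto
      have "((\<lambda>y. f (m x y) - f y) has_derivative (\<lambda>u. \<alpha> (Dm (x, y) (0, u)) (m x y) - \<alpha> u y)) (at y)"
        by (intro has_derivative_diff f[OF yr]
            has_derivative_compose[OF has_derivative_m_right[OF P(1)[OF x y]] f[OF P(2)[OF x y]]])
      moreover have "\<alpha> (Dm (x, y) (0, u)) (m x y) = \<alpha> u y" for u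
        using \<alpha>_B[OF mD, of "\<alpha> u y"] unfolding left_invariance[OF P(1)[OF x y]] B_\<alpha>[OF yD] .
      ultimately show ?thesis by simp
    qed
    from has_derivative_zero_unique[OF convex_ball has_derivative_at_withinI[OF this] y, of e]
    have "f (m x y) - f y = f (m x e) - f e" using s by simp
    moreover have "x \<in> \<Omega>" using P(1)[OF x x] by (simp add: DM_iff)
    ultimately have "f (m x y) - f y = f x" using assms(3) by simp
    then show ?thesis by (simp add: algebra_simps)
  qed
  then show thesis using that[OF s(1,2)] P(1) by simp
qed

text \<open>The inverse \<open>E\<close> of the logarithm satisfies the differential equation \<open>DE(a) v = B v (E a)\<close>,
  which yields its smoothness.\<close>

lemma local_exponential:
  obtains \<delta> :: real and E f :: "'e \<Rightarrow> 'e" and W :: "'e set" where "\<delta> > 0" "smooth_on (ball 0 \<delta>) E" "E 0 = e"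
    "open W" "W \<subseteq> \<Omega>" "smooth_on W f" "f ` W \<subseteq> ball 0 \<delta>" "E ` ball 0 \<delta> \<subseteq> W"
    "\<And>x. x \<in> W \<Longrightarrow> E (f x) = x" "\<And>a. a \<in> ball 0 \<delta> \<Longrightarrow> f (E a) = a"
    "\<And>a b. a \<in> ball 0 \<delta> \<Longrightarrow> b \<in> ball 0 \<delta> \<Longrightarrow> a + b \<in> ball 0 \<delta> \<Longrightarrow>
       (E a, E b) \<in> DM \<and> m (E a) (E b) = E (a + b)"
proof -
  obtain r f where r: "r > 0" "ball e r \<subseteq> DI" and f0: "f e = 0"
    and f: "\<And>x. x \<in> ball e r \<Longrightarrow> (f has_derivative (\<lambda>u. \<alpha> u x)) (at x)"
    using local_logarithm by metis
  obtain s where s: "0 < s" "s \<le> r"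
    "\<And>x y. x \<in> ball e s \<Longrightarrow> y \<in> ball e s \<Longrightarrow> (x, y) \<in> DM \<and> f (m x y) = f x + f y"
    using additive_logarithm[OF r(2,1) f0 f] by metis
  have smf: "smooth_on (ball e r) f"
    by (rule smooth_on_derivI[OF f open_ball smooth_on_subset[OF smooth_\<alpha> r(2)]])
  have rD: "x \<in> DI" if "x \<in> ball e r" for x using that r(2) by blast
  define f' where "f' x = Blinfun (\<lambda>u. \<alpha> u x)" for x
  have f'_apply: "blinfun_apply (f' x) = (\<lambda>u. \<alpha> u x)" if "x \<in> ball e r" for x
    using \<alpha>_linear[OF rD[OF that]] by (simp add: f'_def bounded_linear_Blinfun_apply linear_conv_bounded_linear)
  have cont: "continuous_on (ball e r) f'"
  proof (rule continuous_on_blinfun_componentwise)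
    fix i
    show "continuous_on (ball e r) (\<lambda>x. blinfun_apply (f' x) i)"
      using smooth_on_continuous_on[OF smooth_on_subset[OF smooth_\<alpha>[of i] r(2)]]
      by (subst continuous_on_cong[OF refl, of _ _ "\<alpha> i"]) (simp_all add: f'_apply)
  qed
  have e_in: "e \<in> ball e r" using r by simp
  \<comment> \<open>By \<open>\<alpha>_e\<close> the derivative of the logarithm at \<open>e\<close>
    is the identity, so the identity serves as the inverse that the inverse function theorem asks
    for.\<close>
  have "id_blinfun o\<^sub>L f' e = id_blinfun"
    by (rule blinfun_eqI) (simp add: f'_apply[OF e_in] \<alpha>_e)
  then obtain U' V g g' where g: "open U'" "U' \<subseteq> ball e r" "e \<in> U'" "open V" "f e \<in> V" "homeomorphism U' V f g"
    "\<And>y. y \<in> V \<Longrightarrow> (g has_derivative g' y) (at y)"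
    "\<And>y. y \<in> V \<Longrightarrow> g' y = inv_into UNIV (blinfun_apply (f' (g y)))"
    "\<And>y. y \<in> V \<Longrightarrow> bij (blinfun_apply (f' (g y)))"
    using inverse_function_theorem[OF open_ball _ cont e_in, of f] f f'_apply by metis
  have gU: "g y \<in> U'" if "y \<in> V" for y
    using g(6) that by (auto simp: homeomorphism_def)
  have gf: "g (f x) = x" "f x \<in> V" if "x \<in> U'" for x
    using g(6) that by (auto simp: homeomorphism_def)
  have fg: "f (g y) = y" if "y \<in> V" for y
    using g(6) that by (auto simp: homeomorphism_def)
  have g'_B: "g' y v = B v (g y)" if y: "y \<in> V" for y v
  proof -
    have gy: "g y \<in> ball e r" using gU[OF y] g(2) by auto
    have "blinfun_apply (f' (g y)) (B v (g y)) = v"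
      using f'_apply[OF gy] \<alpha>_B[OF rD[OF gy]] by simp
    then show ?thesis using g(8,9)[OF y] by (metis bij_is_inj inv_f_f)
  qed
  have smg: "smooth_on V g"
  proof (rule smooth_on_implicit_ode[OF g(4) open_\<Omega> _ _ smooth_B])
    fix y assume y: "y \<in> V"
    show "g y \<in> \<Omega>" using gU[OF y] g(2) rD by auto
    show "(g has_derivative (\<lambda>v. B v (g y))) (at y)"
      by (rule has_derivative_eq_rhs[OF g(7)[OF y]]) (rule ext, rule g'_B[OF y])
  qed
  have g0: "g 0 = e" using gf(1)[OF g(3)] f0 by simp
  have V0: "0 \<in> V" using g(5) f0 by simp
  \<comment> \<open>Additivity of \<open>f\<close> yields \<open>m (g a) (g b) = g (a + b)\<close>
    once the product lies in \<open>U'\<close>, where \<open>g\<close> inverts \<open>f\<close>;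
    \<open>A1\<close> and \<open>A2\<close> ensure that.\<close>
  let ?P = "{z \<in> DM. mm z \<in> U'}"
  have "open ?P" by (rule open_smooth_preimage[OF smooth_mm open_DM g(1)])
  moreover have "(e, e) \<in> ?P" using g(3) by simp
  ultimately obtain A1 A2 where A12: "open A1" "open A2" "(e, e) \<in> A1 \<times> A2" "A1 \<times> A2 \<subseteq> ?P"
    by (rule open_prod_elim)
  have "open {y \<in> V. g y \<in> A1 \<inter> A2 \<inter> ball e s}"
    by (rule open_smooth_preimage[OF smg g(4)]) (use A12 in auto)
  moreover have "0 \<in> {y \<in> V. g y \<in> A1 \<inter> A2 \<inter> ball e s}"
    using V0 g0 A12(3) s(1) by auto
  ultimately obtain \<delta> where \<delta>: "\<delta> > 0" "ball 0 \<delta> \<subseteq> {y \<in> V. g y \<in> A1 \<inter> A2 \<inter> ball e s}"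
    using open_contains_ball by blast
  have \<delta>V: "a \<in> V" and \<delta>A: "g a \<in> A1" "g a \<in> A2" "g a \<in> ball e s" if "a \<in> ball 0 \<delta>" for a
    using \<delta>(2) that by blast+
  define W where "W = {x \<in> U'. f x \<in> ball 0 \<delta>}"
  have smf': "smooth_on U' f" by (rule smooth_on_subset[OF smf g(2)])
  show thesis
  proof (rule that[of \<delta> g W f])
    show "\<delta> > 0" "g 0 = e" by fact+
    show "smooth_on (ball 0 \<delta>) g" by (rule smooth_on_subset[OF smg]) (use \<delta>V in blast)
    show "open W" unfolding W_def by (rule open_smooth_preimage[OF smf' g(1) open_ball])
    show "W \<subseteq> \<Omega>" using g(2) rD by (auto simp: W_def)
    show "smooth_on W f" by (rule smooth_on_subset[OF smf']) (auto simp: W_def)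
    show "f ` W \<subseteq> ball 0 \<delta>" by (auto simp: W_def)
    show "g ` ball 0 \<delta> \<subseteq> W"
    proof
      fix x assume "x \<in> g ` ball 0 \<delta>"
      then obtain a where a: "a \<in> ball 0 \<delta>" "x = g a" by blast
      then show "x \<in> W" using gU[OF \<delta>V[OF a(1)]] fg[OF \<delta>V[OF a(1)]] by (simp add: W_def)
    qed
    show "g (f x) = x" if "x \<in> W" for x using that gf by (simp add: W_def)
    show "f (g a) = a" if "a \<in> ball 0 \<delta>" for a using fg[OF \<delta>V[OF that]] .
    fix a b :: 'e assume ab: "a \<in> ball 0 \<delta>" "b \<in> ball 0 \<delta>" "a + b \<in> ball 0 \<delta>"
    have "(g a, g b) \<in> A1 \<times> A2" using \<delta>A ab by blast
    then have D: "(g a, g b) \<in> DM" "m (g a) (g b) \<in> U'" using A12(4) by auto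
    have "f (m (g a) (g b)) = a + b"
      using s(3)[OF \<delta>A(3)[OF ab(1)] \<delta>A(3)[OF ab(2)]] fg[OF \<delta>V[OF ab(1)]] fg[OF \<delta>V[OF ab(2)]] by simp
    then show "(g a, g b) \<in> DM \<and> m (g a) (g b) = g (a + b)"
      using gf(1)[OF D(2)] D(1) by simp
  qed
qed

end

section \<open>Discrete subgroups of a vector space\<close>

locale discrete_subgroup =
  fixes \<Lambda> :: "'e::euclidean_space set" and d :: real
  assumes zero: "0 \<in> \<Lambda>" and diff: "x \<in> \<Lambda> \<Longrightarrow> y \<in> \<Lambda> \<Longrightarrow> x - y \<in> \<Lambda>"
    and d_pos: "d > 0" and discr: "x \<in> \<Lambda> \<Longrightarrow> norm x < d \<Longrightarrow> x = 0"
begin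

lemma minus: "x \<in> \<Lambda> \<Longrightarrow> - x \<in> \<Lambda>"
  using diff[OF zero] by simp

lemma plus: "x \<in> \<Lambda> \<Longrightarrow> y \<in> \<Lambda> \<Longrightarrow> x + y \<in> \<Lambda>"
  using diff[OF _ minus, of x y] by simp

lemma int_scale: "x \<in> \<Lambda> \<Longrightarrow> of_int k *\<^sub>R x \<in> \<Lambda>"
proof -
  assume x: "x \<in> \<Lambda>"
  have nat: "of_nat n *\<^sub>R x \<in> \<Lambda>" for n
    by (induction n) (simp_all add: zero plus[OF x] scaleR_left.add)
  show ?thesis
    using nat[of "nat k"] minus[OF nat[of "nat (- k)"]] by (cases "k \<ge> 0") simp_all
qed

lemma int_sum: "(\<And>b. b \<in> B \<Longrightarrow> h b \<in> \<Lambda>) \<Longrightarrow> (\<Sum>b\<in>B. of_int (n b) *\<^sub>R h b) \<in> \<Lambda>"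
  by (induction B rule: infinite_finite_induct) (simp_all add: zero plus int_scale)

lemma finite_bounded:
  assumes "bounded S" "S \<subseteq> \<Lambda>" shows "finite S"
proof -
  have "x = y" if "x \<in> S" "y \<in> S" "dist x y < d" for x y
    using discr[OF diff, of x y] that assms(2) by (auto simp: dist_norm)
  then have "uniform_discrete S" using d_pos by (auto simp: uniform_discrete_def)
  then show ?thesis using assms(1) uniform_discrete_finite_iff by blast
qed

text \<open>Among the lattice vectors in the larger span, \<open>w\<close> is taken with the least
  positive coordinate along \<open>v\<close>. Subtracting a multiple of \<open>w\<close> from
  \<open>x\<close> brings this coordinate below the minimum, hence to 0, and the remainder is
  handled by \<open>gen\<close>.\<close>

lemma lattice_basis_step:
  assumes B: "finite B" "independent B" "B \<subseteq> \<Lambda>"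
    and gen: "\<And>x. x \<in> \<Lambda> \<Longrightarrow> x \<in> span B \<Longrightarrow> \<exists>n. x = (\<Sum>b\<in>B. of_int (n b) *\<^sub>R b)"
    and v: "v \<in> \<Lambda>" "v \<notin> span B"
  obtains w where "w \<in> \<Lambda>" "w \<notin> span B" "span (insert w B) = span (insert v B)"
    "\<And>x. x \<in> \<Lambda> \<Longrightarrow> x \<in> span (insert v B) \<Longrightarrow> \<exists>n. x = (\<Sum>b\<in>insert w B. of_int (n b) *\<^sub>R b)"
proof -
  have ind: "independent (insert v B)" using B v by (simp add: independent_insert)
  have vB: "v \<notin> B" using v span_base by blast
  obtain q :: "'e \<Rightarrow> real" where q: "linear q" "\<forall>b\<in>insert v B. q b = (if b = v then 1 else 0)"
    using linear_independent_extend[OF ind, of "\<lambda>b. if b = v then 1 else 0"] by blast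
  have q_v: "q v = 1" and q_B: "\<And>b. b \<in> B \<Longrightarrow> q b = 0" using q(2) vB by auto
  have q_sum: "q (\<Sum>b\<in>B. t b *\<^sub>R b) = 0" for t
    by (simp add: linear_sum[OF q(1)] linear_scale[OF q(1)] q_B)
  have coord: "\<exists>t. x = q x *\<^sub>R v + (\<Sum>b\<in>B. t b *\<^sub>R b)" if "x \<in> span (insert v B)" for x
  proof -
    obtain k where "x - k *\<^sub>R v \<in> span B" using \<open>x \<in> span (insert v B)\<close> by (auto simp: span_insert)
    then obtain t where t: "x - k *\<^sub>R v = (\<Sum>b\<in>B. t b *\<^sub>R b)"
      using span_finite[OF B(1)] by auto
    then have x: "x = k *\<^sub>R v + (\<Sum>b\<in>B. t b *\<^sub>R b)" by (simp add: algebra_simps)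
    then have "q x = k" by (simp add: linear_add[OF q(1)] linear_scale[OF q(1)] q_v q_sum)
    then show ?thesis using x by blast
  qed
  \<comment> \<open>The box of coordinates bounds the candidates, so there are finitely many and a
    minimum exists; \<open>v\<close> itself is one of them.\<close>
  define P where "P = {x \<in> \<Lambda>. 0 < q x \<and> q x \<le> 1 \<and> (\<exists>t. (\<forall>b\<in>B. 0 \<le> t b \<and> t b \<le> 1) \<and> x = q x *\<^sub>R v + (\<Sum>b\<in>B. t b *\<^sub>R b))}"
  have "P \<subseteq> cball 0 (norm v + (\<Sum>b\<in>B. norm b))"
  proof
    fix x assume "x \<in> P"
    then obtain t where c: "0 < q x" "q x \<le> 1" and t: "\<And>b. b \<in> B \<Longrightarrow> 0 \<le> t b \<and> t b \<le> 1"
      and x: "x = q x *\<^sub>R v + (\<Sum>b\<in>B. t b *\<^sub>R b)" unfolding P_def by blast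
    have "norm x \<le> norm (q x *\<^sub>R v) + norm (\<Sum>b\<in>B. t b *\<^sub>R b)" by (metis norm_triangle_ineq x)
    also have "norm (q x *\<^sub>R v) \<le> norm v" using c by (simp add: mult_left_le_one_le)
    also have "norm (\<Sum>b\<in>B. t b *\<^sub>R b) \<le> (\<Sum>b\<in>B. norm b)"
      using t by (intro sum_norm_le) (simp add: mult_left_le_one_le)
    finally show "x \<in> cball 0 (norm v + (\<Sum>b\<in>B. norm b))" by simp
  qed
  then have "bounded P" using bounded_subset bounded_cball by blast
  then have finP: "finite P" by (rule finite_bounded) (auto simp: P_def)
  have "v \<in> P" unfolding P_def using v q_v by (auto intro!: exI[of _ "\<lambda>_. 0"])
  then have "Min (q ` P) \<in> q ` P" using finP by (intro Min_in) auto
  then obtain w where w: "w \<in> P" "q w = Min (q ` P)" by auto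
  have min: "q w \<le> q x" if "x \<in> P" for x using w(2) finP that by simp
  have w': "w \<in> \<Lambda>" "0 < q w" "q w \<le> 1" using w(1) by (auto simp: P_def)
  obtain tw where tw: "w = q w *\<^sub>R v + (\<Sum>b\<in>B. tw b *\<^sub>R b)" using w(1) by (auto simp: P_def)
  have sumB: "(\<Sum>b\<in>B. t b *\<^sub>R b) \<in> span B" for t by (intro span_sum span_scale span_base)
  have q_span: "q x = 0" if "x \<in> span B" for x
    using that span_finite[OF B(1)] q_sum by auto
  have wB: "w \<notin> span B" using q_span w' by force
  have "w - q w *\<^sub>R v \<in> span B" using sumB[of tw] tw by (metis add_diff_cancel_left')
  then have w_in: "w \<in> span (insert v B)" by (auto simp: span_insert)
  have "v - (1 / q w) *\<^sub>R w = - (1 / q w) *\<^sub>R (\<Sum>b\<in>B. tw b *\<^sub>R b)"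
    using w' arg_cong[OF tw, of "\<lambda>x. (1 / q w) *\<^sub>R x"] by (simp add: scaleR_add_right)
  then have "v - (1 / q w) *\<^sub>R w \<in> span B" using span_scale[OF sumB] by metis
  then have v_in: "v \<in> span (insert w B)" by (auto simp: span_insert)
  have span_eq: "span (insert w B) = span (insert v B)"
    using w_in v_in span_mono[of B "insert w B"] span_mono[of B "insert v B"] span_superset
    by (intro equalityI span_minimal subspace_span) auto
  have wnB: "w \<notin> B" using wB span_base by blast
  have "\<exists>n. x = (\<Sum>b\<in>insert w B. of_int (n b) *\<^sub>R b)" if x: "x \<in> \<Lambda>" "x \<in> span (insert v B)" for x
  proof -
    define k where "k = \<lfloor>q x / q w\<rfloor>"
    define y where "y = x - of_int k *\<^sub>R w"
    have y\<Lambda>: "y \<in> \<Lambda>" unfolding y_def by (intro diff int_scale x w')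
    have ys: "y \<in> span (insert v B)" unfolding y_def by (intro span_diff span_scale x w_in)
    have qy: "q y = q x - of_int k * q w"
      by (simp add: y_def linear_diff[OF q(1)] linear_scale[OF q(1)])
    have "of_int k \<le> q x / q w" "q x / q w < of_int k + 1" unfolding k_def by linarith+
    then have qy': "0 \<le> q y" "q y < q w"
      using w'(2) by (simp_all add: qy field_simps)
    obtain t where t: "y = q y *\<^sub>R v + (\<Sum>b\<in>B. t b *\<^sub>R b)" using coord[OF ys] by blast
    \<comment> \<open>Removing integer parts along \<open>B\<close> leaves the coordinate along
      \<open>v\<close> alone and puts the others into the box, so a positive coordinate along
      \<open>v\<close> would contradict the minimality of \<open>w\<close>.\<close>
    define z where "z = y - (\<Sum>b\<in>B. of_int \<lfloor>t b\<rfloor> *\<^sub>R b)"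
    have z\<Lambda>: "z \<in> \<Lambda>" unfolding z_def using B(3) by (intro diff int_sum y\<Lambda>) auto
    have qz: "q z = q y" using q_sum[of "\<lambda>b. of_int \<lfloor>t b\<rfloor>"] by (simp add: z_def linear_diff[OF q(1)])
    have z: "z = q z *\<^sub>R v + (\<Sum>b\<in>B. (t b - of_int \<lfloor>t b\<rfloor>) *\<^sub>R b)"
      unfolding qz by (subst z_def, subst t) (simp add: scaleR_diff_left sum_subtractf)
    have "q y = 0"
    proof (rule ccontr)
      assume "q y \<noteq> 0"
      then have c: "0 < q z" "q z \<le> 1" "q z < q w" using qy' qz w' by auto
      have frac: "\<forall>b\<in>B. 0 \<le> t b - of_int \<lfloor>t b\<rfloor> \<and> t b - of_int \<lfloor>t b\<rfloor> \<le> 1"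
        by (auto; linarith)
      have "\<exists>t. (\<forall>b\<in>B. 0 \<le> t b \<and> t b \<le> 1) \<and> z = q z *\<^sub>R v + (\<Sum>b\<in>B. t b *\<^sub>R b)"
        by (rule exI[of _ "\<lambda>b. t b - of_int \<lfloor>t b\<rfloor>"], rule conjI, rule frac, rule z)
      then have "z \<in> P" using z\<Lambda> c(1,2) by (simp add: P_def)
      then show False using min c(3) by force
    qed
    then have "y \<in> span B" using t sumB[of t] by simp
    then obtain n where n: "y = (\<Sum>b\<in>B. of_int (n b) *\<^sub>R b)" using gen[OF y\<Lambda>] by blast
    have "x = of_int k *\<^sub>R w + (\<Sum>b\<in>B. of_int (n b) *\<^sub>R b)" using n by (simp add: y_def algebra_simps)
    also have "(\<Sum>b\<in>B. of_int (n b) *\<^sub>R b) = (\<Sum>b\<in>B. of_int ((n(w := k)) b) *\<^sub>R b)"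
      by (rule sum.cong) (use wnB in auto)
    finally have "x = (\<Sum>b\<in>insert w B. of_int ((n(w := k)) b) *\<^sub>R b)"
      using B(1) wnB by simp
    then show ?thesis by blast
  qed
  then show thesis using that[OF w'(1) wB span_eq] by blast
qed

lemma lattice_basis:
  assumes "finite F" "independent F" "F \<subseteq> \<Lambda>"
  shows "\<exists>B. finite B \<and> independent B \<and> B \<subseteq> \<Lambda> \<and> span B = span F \<and>
    (\<forall>x\<in>\<Lambda> \<inter> span F. \<exists>n. x = (\<Sum>b\<in>B. of_int (n b) *\<^sub>R b))"
  using assms
proof (induction F rule: finite_induct)
  case empty
  then show ?case by (intro exI[of _ "{}"]) (simp add: independent_empty)
next
  case (insert v F)
  have "independent F" by (rule independent_mono[OF insert.prems(1)]) auto
  then obtain B where B: "finite B" "independent B" "B \<subseteq> \<Lambda>" "span B = span F"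
      "\<forall>x\<in>\<Lambda> \<inter> span F. \<exists>n. x = (\<Sum>b\<in>B. of_int (n b) *\<^sub>R b)"
    using insert.IH insert.prems(2) by (metis insert_subset)
  have v: "v \<in> \<Lambda>" "v \<notin> span B"
    using insert.prems insert.hyps B(4) by (auto simp: independent_insert)
  have span_eq: "span (insert v B) = span (insert v F)"
    using B(4) by (simp add: span_insert)
  obtain w where w: "w \<in> \<Lambda>" "w \<notin> span B" "span (insert w B) = span (insert v B)"
    "\<And>x. x \<in> \<Lambda> \<Longrightarrow> x \<in> span (insert v B) \<Longrightarrow> \<exists>n. x = (\<Sum>b\<in>insert w B. of_int (n b) *\<^sub>R b)"
    using lattice_basis_step[OF B(1-3) _ v] B(4,5) by auto
  show ?case
    by (rule exI[of _ "insert w B"])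
      (use B w span_eq in \<open>simp add: independent_insert\<close>)
qed

theorem linear_image_integer_lattice:
  assumes "span \<Lambda> = UNIV"
  obtains L :: "'e \<Rightarrow> 'e" where "linear L" "bij L" "L ` integer_lattice = \<Lambda>"
proof -
  obtain F where F: "F \<subseteq> \<Lambda>" "independent F" "\<Lambda> \<subseteq> span F"
    using maximal_independent_subset[of \<Lambda>] by blast
  then have finF: "finite F" using independent_imp_finite by blast
  have spanF: "span F = UNIV" using F(3) assms span_minimal[OF F(3)] by auto
  obtain B where B: "finite B" "independent B" "B \<subseteq> \<Lambda>" "span B = UNIV"
    and gen: "\<And>x. x \<in> \<Lambda> \<Longrightarrow> \<exists>n. x = (\<Sum>b\<in>B. of_int (n b) *\<^sub>R b)"
    using lattice_basis[OF finF F(2,1)] spanF by auto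
  have "card B = DIM('e)"
    using dim_eq_card_independent[OF B(2)] dim_span[of B] B(4) by simp
  then obtain h :: "'e \<Rightarrow> 'e" where h: "bij_betw h Basis B"
    using B(1) finite_same_card_bij[OF finite_Basis, of B] by auto
  define L where "L x = (\<Sum>b\<in>Basis. (x \<bullet> b) *\<^sub>R h b)" for x :: 'e
  have lin: "linear L"
    by (rule linearI) (simp_all add: L_def inner_left_distrib scaleR_add_left sum.distrib scaleR_sum_right)
  have L_Basis: "L b = h b" if "b \<in> Basis" for b
  proof -
    have "L b = (\<Sum>c\<in>Basis. if c = b then h c else 0)"
      unfolding L_def by (rule sum.cong) (use that in \<open>auto simp: inner_Basis\<close>)
    then show ?thesis using that by simp
  qed
  have "B \<subseteq> range L"
  proof
    fix c assume "c \<in> B"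
    then obtain b where "b \<in> Basis" "c = h b" using h by (auto simp: bij_betw_def)
    then show "c \<in> range L" using L_Basis by (metis rangeI)
  qed
  then have "span B \<subseteq> range L"
    by (intro span_minimal linear_subspace_image[OF lin subspace_UNIV])
  then have surj: "surj L" using B(4) by auto
  then have "bij L" using linear_surj_imp_inj[OF lin] by (simp add: bij_def)
  moreover have "L ` integer_lattice = \<Lambda>"
  proof
    show "L ` integer_lattice \<subseteq> \<Lambda>"
    proof
      fix y assume "y \<in> L ` integer_lattice"
      then obtain x where x: "y = L x" "\<And>b. b \<in> Basis \<Longrightarrow> x \<bullet> b \<in> \<int>" by (auto simp: integer_lattice_def)
      have "y = (\<Sum>b\<in>Basis. of_int \<lfloor>x \<bullet> b\<rfloor> *\<^sub>R h b)"
        unfolding x(1) L_def by (rule sum.cong) (use x(2) in \<open>auto elim: Ints_cases\<close>)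
      also have "\<dots> \<in> \<Lambda>" using h B(3) by (intro int_sum) (auto simp: bij_betw_def)
      finally show "y \<in> \<Lambda>" .
    qed
    show "\<Lambda> \<subseteq> L ` integer_lattice"
    proof
      fix y assume "y \<in> \<Lambda>"
      then obtain n where n: "y = (\<Sum>c\<in>B. of_int (n c) *\<^sub>R c)" using gen by blast
      also have "\<dots> = (\<Sum>b\<in>Basis. of_int (n (h b)) *\<^sub>R h b)"
        by (rule sum.reindex_bij_betw[OF h, symmetric])
      also have "\<dots> = L (\<Sum>b\<in>Basis. of_int (n (h b)) *\<^sub>R b)"
        by (simp add: linear_sum[OF lin] linear_scale[OF lin] L_Basis)
      finally show "y \<in> L ` integer_lattice" by (auto simp: integer_lattice_def)
    qed
  qed
  ultimately show thesis using that lin by blast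
qed

end

section \<open>Global exponential map\<close>

lemma (in lie_group_atlas) continuous_translation:
  assumes g: "g \<in> carrier G"
  shows "continuous_on (carrier G) (\<lambda>x. g \<otimes> x)"
proof -
  have c: "continuous_on (carrier G) (\<lambda>x. (g, x))" by (intro continuous_intros)
  have "(\<lambda>x. (g, x)) ` carrier G \<subseteq> carrier G \<times> carrier G" using g by auto
  from continuous_on_compose2[OF continuous_mult c this] show ?thesis by simp
qed

text \<open>A subgroup containing a neighbourhood of the identity is open, and its complement is a
  union of translates of it, hence open too; connectedness finishes.\<close>

lemma (in lie_group_atlas) open_subgroup_eq_carrier:
  assumes conn: "connected (carrier G)" and H: "subgroup H G"
    and V: "openin (top_of_set (carrier G)) V" "\<one> \<in> V" "V \<subseteq> H"
  shows "H = carrier G"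
proof -
  have Hc: "H \<subseteq> carrier G" by (rule subgroup.subset[OF H])
  have nbhd: "\<exists>T. openin (top_of_set (carrier G)) T \<and> g \<in> T \<and> T \<subseteq> {x \<in> carrier G. inv g \<otimes> x \<in> H}"
    if g: "g \<in> carrier G" for g
  proof -
    have "openin (top_of_set (carrier G)) (carrier G \<inter> (\<lambda>x. inv g \<otimes> x) -` V)"
      by (rule continuous_openin_preimage[OF continuous_translation _ V(1)]) (use g in auto)
    then show ?thesis using V g by (intro exI[of _ "carrier G \<inter> (\<lambda>x. inv g \<otimes> x) -` V"]) auto
  qed
  have op: "openin (top_of_set (carrier G)) H"
  proof (subst openin_subopen, rule ballI)
    fix g assume g: "g \<in> H"
    then obtain T where T: "openin (top_of_set (carrier G)) T" "g \<in> T" "T \<subseteq> {x \<in> carrier G. inv g \<otimes> x \<in> H}"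
      using nbhd Hc by blast
    have "x \<in> H" if "x \<in> T" for x
    proof -
      have x: "x \<in> carrier G" "inv g \<otimes> x \<in> H" using T that by auto
      then have "g \<otimes> (inv g \<otimes> x) \<in> H" using g subgroup.m_closed[OF H] by blast
      then show ?thesis using x(1) g Hc by (simp add: subset_iff flip: m_assoc)
    qed
    then show "\<exists>T. openin (top_of_set (carrier G)) T \<and> g \<in> T \<and> T \<subseteq> H" using T by blast
  qed
  have op': "openin (top_of_set (carrier G)) (carrier G - H)"
  proof (subst openin_subopen, rule ballI)
    fix g assume g: "g \<in> carrier G - H"
    then obtain T where T: "openin (top_of_set (carrier G)) T" "g \<in> T" "T \<subseteq> {x \<in> carrier G. inv g \<otimes> x \<in> H}"
      using nbhd by blast
    have "x \<notin> H" if "x \<in> T" for x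
    proof
      assume xH: "x \<in> H"
      have x: "x \<in> carrier G" "inv g \<otimes> x \<in> H" using T that by auto
      have "x \<otimes> inv (inv g \<otimes> x) \<in> H"
        by (intro subgroup.m_closed[OF H xH] subgroup.m_inv_closed[OF H x(2)])
      moreover have "x \<otimes> inv (inv g \<otimes> x) = g"
        using g x(1) by (simp add: inv_mult_group) (simp flip: m_assoc)
      ultimately show False using g by simp
    qed
    then show "\<exists>T. openin (top_of_set (carrier G)) T \<and> g \<in> T \<and> T \<subseteq> carrier G - H" using T by blast
  qed
  have "closedin (top_of_set (carrier G)) H" using op' Hc by (simp add: closedin_def)
  then show ?thesis using conn op subgroup.one_closed[OF H] by (auto simp: connected_clopen)
qed

text \<open>A homomorphism from the vector group onto \<open>G\<close> that is a local
  diffeomorphism, expressed in charts: \<open>X_inverse\<close> provides a smooth local section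
  \<open>l\<close> through every prescribed \<open>v\<close>. \<open>X\<close> may have a
  kernel.\<close>

locale vector_parametrization = lie_group_atlas G A
  for G :: "('g::topological_space, 'k) monoid_scheme" (structure)
    and A :: "('g, 'e::euclidean_space) chart set" +
  fixes X :: "'e \<Rightarrow> 'g"
  assumes X_carrier [simp]: "X v \<in> carrier G"
    and X_add: "X (v + w) = X v \<otimes> X w"
    and X_surj: "g \<in> carrier G \<Longrightarrow> \<exists>v. g = X v"
    and X_smooth: "(V, \<theta>) \<in> A \<Longrightarrow> open {v. X v \<in> V} \<and> smooth_on {v. X v \<in> V} (\<lambda>v. \<theta> (X v))"
    and X_inverse: "(V, \<theta>) \<in> A \<Longrightarrow> X v \<in> V \<Longrightarrow> \<exists>S l. open S \<and> \<theta> (X v) \<in> S \<and> S \<subseteq> \<theta> ` V \<and>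
        smooth_on S l \<and> l (\<theta> (X v)) = v \<and> (\<forall>x\<in>S. X (l x) = inv_into V \<theta> x)"

section \<open>Extension of the local exponential by powers\<close>

locale local_exponential_data = abelian_chart G A U \<phi>
  for G :: "('g::topological_space, 'k) monoid_scheme" (structure)
    and A :: "('g, 'e::euclidean_space) chart set" and U :: "'g set" and \<phi> :: "'g \<Rightarrow> 'e" +
  fixes \<delta> :: real and E f :: "'e \<Rightarrow> 'e" and W :: "'e set"
  assumes \<delta>: "\<delta> > 0" and smooth_E: "smooth_on (ball 0 \<delta>) E" and E_0: "E 0 = e"
    and W: "open W" "W \<subseteq> \<Omega>" and smooth_f: "smooth_on W f" "f ` W \<subseteq> ball 0 \<delta>"
    and E_W: "E ` ball 0 \<delta> \<subseteq> W"
    and E_f: "x \<in> W \<Longrightarrow> E (f x) = x" and f_E: "a \<in> ball 0 \<delta> \<Longrightarrow> f (E a) = a"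
    and E_add: "a \<in> ball 0 \<delta> \<Longrightarrow> b \<in> ball 0 \<delta> \<Longrightarrow> a + b \<in> ball 0 \<delta> \<Longrightarrow>
       (E a, E b) \<in> DM \<and> m (E a) (E b) = E (a + b)"
    and conn: "connected (carrier G)"
begin

definition \<epsilon> where "\<epsilon> a = \<psi> (E a)"

lemma E_\<Omega>: "norm a < \<delta> \<Longrightarrow> E a \<in> \<Omega>"
  using E_W W(2) by (auto simp: image_subset_iff)

lemma e_W: "e \<in> W"
proof -
  have "E 0 \<in> W" using E_W \<delta> by (metis centre_in_ball image_subset_iff)
  then show ?thesis by (simp add: E_0)
qed

lemma \<epsilon>_carrier: "norm a < \<delta> \<Longrightarrow> \<epsilon> a \<in> carrier G"
  using E_\<Omega> by (simp add: \<epsilon>_def)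

lemma \<epsilon>_0: "\<epsilon> 0 = \<one>"
  by (simp add: \<epsilon>_def E_0)

lemma \<epsilon>_add: "norm a < \<delta> \<Longrightarrow> norm b < \<delta> \<Longrightarrow> norm (a + b) < \<delta> \<Longrightarrow> \<epsilon> (a + b) = \<epsilon> a \<otimes> \<epsilon> b"
  using E_add[of a b] \<psi>_m[of "E a" "E b"] by (simp add: \<epsilon>_def)

lemma \<epsilon>_commute: "norm a < \<delta> \<Longrightarrow> norm b < \<delta> \<Longrightarrow> norm (a + b) < \<delta> \<Longrightarrow> \<epsilon> a \<otimes> \<epsilon> b = \<epsilon> b \<otimes> \<epsilon> a"
  using \<epsilon>_add[of a b] \<epsilon>_add[of b a] by (simp add: add.commute)

lemma \<epsilon>_pow: "norm (real k *\<^sub>R b) < \<delta> \<Longrightarrow> \<epsilon> (real k *\<^sub>R b) = \<epsilon> b [^] k"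
proof (induction k)
  case (Suc k)
  have le: "norm (real k *\<^sub>R b) \<le> norm (real (Suc k) *\<^sub>R b)" "norm b \<le> norm (real (Suc k) *\<^sub>R b)"
    by (simp_all add: mult_right_mono mult_le_cancel_right1)
  then have "\<epsilon> (real k *\<^sub>R b + b) = \<epsilon> (real k *\<^sub>R b) \<otimes> \<epsilon> b"
    using Suc.prems by (intro \<epsilon>_add) (auto simp: algebra_simps)
  then show ?case using Suc le by (simp add: algebra_simps)
qed (simp add: \<epsilon>_0)

text \<open>\<open>v\<close> is cut into \<open>k\<close> pieces inside the ball where
  \<open>\<epsilon>\<close> is a local homomorphism. Adding 1 makes \<open>k\<close> positive and
  \<open>norm v / \<delta> < k\<close> strict; by \<open>X_eq\<close> every other admissible number
  of pieces gives the same value.\<close>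

definition X where
  "X v = (let k = nat \<lceil>norm v / \<delta>\<rceil> + 1 in \<epsilon> ((1 / real k) *\<^sub>R v) [^] k)"

text \<open>Subdivisions into \<open>k\<close> and into \<open>l\<close> pieces are compared through
  their common refinement into \<open>k * l\<close> pieces.\<close>

lemma X_eq:
  assumes k: "norm v < real k * \<delta>"
  shows "X v = \<epsilon> ((1 / real k) *\<^sub>R v) [^] k"
proof -
  define l where "l = nat \<lceil>norm v / \<delta>\<rceil> + 1"
  have "norm v / \<delta> < real l" unfolding l_def by linarith
  then have l: "norm v < real l * \<delta>" using \<delta> by (simp add: field_simps)
  have pos: "k > 0" "l > 0" using k norm_ge_zero[of v] by (auto simp: l_def intro!: Nat.gr0I simp del: norm_ge_zero)
  define b where "b = (1 / real (k * l)) *\<^sub>R v"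
  have lb: "real l *\<^sub>R b = (1 / real k) *\<^sub>R v" and kb: "real k *\<^sub>R b = (1 / real l) *\<^sub>R v"
    using pos by (simp_all add: b_def)
  have n: "norm (real l *\<^sub>R b) < \<delta>" "norm (real k *\<^sub>R b) < \<delta>"
    using k l pos by (simp_all only: lb kb) (simp_all add: field_simps)
  moreover have "norm b \<le> norm (real l *\<^sub>R b)" using pos by (simp add: mult_le_cancel_right1)
  ultimately have b: "\<epsilon> b \<in> carrier G" by (intro \<epsilon>_carrier) simp
  have "\<epsilon> ((1 / real k) *\<^sub>R v) [^] k = \<epsilon> b [^] (l * k)"
    using \<epsilon>_pow[OF n(1)] b by (simp add: lb nat_pow_pow)
  also have "\<dots> = \<epsilon> ((1 / real l) *\<^sub>R v) [^] l"
    using \<epsilon>_pow[OF n(2)] b by (simp add: kb nat_pow_pow mult.commute)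
  also have "\<dots> = X v" by (simp add: X_def l_def Let_def)
  finally show ?thesis by simp
qed

lemma X_\<epsilon>: "norm a < \<delta> \<Longrightarrow> X a = \<epsilon> a"
  using X_eq[of a 1] \<epsilon>_carrier by simp

lemma ex_scale: "\<exists>k. norm v < real k * r" if "r > 0"
  using reals_Archimedean3[OF that] by blast

lemma scale_mono: "norm v < real k * r \<Longrightarrow> r > 0 \<Longrightarrow> k \<le> l \<Longrightarrow> norm v < real l * r"
  by (smt (verit) mult_right_mono of_nat_le_iff)

lemma X_in_carrier: "X v \<in> carrier G"
proof -
  obtain k where k: "norm v < real k * \<delta>" using ex_scale[OF \<delta>] by blast
  then have "k > 0" using norm_ge_zero[of v] by (auto intro!: Nat.gr0I simp del: norm_ge_zero)
  then have "norm ((1 / real k) *\<^sub>R v) < \<delta>" using k by (simp add: field_simps)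
  then show ?thesis using X_eq[OF k] \<epsilon>_carrier by simp
qed

lemma X_plus: "X (v + w) = X v \<otimes> X w"
proof -
  \<comment> \<open>The radius \<open>\<delta> / 2\<close> leaves room for the sum of the two
    pieces; a common \<open>k\<close> then serves both vectors.\<close>
  obtain k1 k2 where "norm v < real k1 * (\<delta> / 2)" "norm w < real k2 * (\<delta> / 2)"
    using ex_scale[of "\<delta> / 2" v] ex_scale[of "\<delta> / 2" w] \<delta> by auto
  then obtain k where k: "norm v < real k * (\<delta> / 2)" "norm w < real k * (\<delta> / 2)"
    using scale_mono[of v k1 "\<delta> / 2" "max k1 k2"] scale_mono[of w k2 "\<delta> / 2" "max k1 k2"] \<delta> by auto
  then have pos: "k > 0" using norm_ge_zero[of v] by (auto intro!: Nat.gr0I simp del: norm_ge_zero)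
  define a b where "a = (1 / real k) *\<^sub>R v" and "b = (1 / real k) *\<^sub>R w"
  have ab: "norm a < \<delta> / 2" "norm b < \<delta> / 2"
    using k pos by (simp_all add: a_def b_def field_simps)
  then have ab': "norm a < \<delta>" "norm b < \<delta>" "norm (a + b) < \<delta>"
    using \<delta> norm_triangle_ineq[of a b] by auto
  have n: "norm v < real k * \<delta>" "norm w < real k * \<delta>" "norm (v + w) < real k * \<delta>"
    using k \<delta> norm_triangle_ineq[of v w] norm_ge_zero[of v] norm_ge_zero[of w] by linarith+
  have "X (v + w) = \<epsilon> (a + b) [^] k"
    using X_eq[OF n(3)] by (simp add: a_def b_def scaleR_add_right)
  also have "\<dots> = (\<epsilon> a \<otimes> \<epsilon> b) [^] k" using \<epsilon>_add[OF ab'] by simp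
  also have "\<dots> = \<epsilon> a [^] k \<otimes> \<epsilon> b [^] k"
    by (intro pow_mult_distrib \<epsilon>_commute \<epsilon>_carrier ab')
  finally show ?thesis using X_eq[OF n(1)] X_eq[OF n(2)] by (simp add: a_def b_def)
qed

lemma X_zero: "X 0 = \<one>"
  using X_\<epsilon>[of 0] \<delta> by (simp add: \<epsilon>_0)

lemma X_neg: "X (- v) = inv (X v)"
  using X_plus[of "- v" v] X_zero X_in_carrier by (metis inv_equality left_minus)

lemma X_onto: "range X = carrier G"
proof (rule open_subgroup_eq_carrier[OF conn])
  show "subgroup (range X) G"
  proof (rule subgroupI)
    fix a assume "a \<in> range X"
    then obtain v where "a = X v" by blast
    then show "inv a \<in> range X" by (simp flip: X_neg)
  next
    fix a b assume "a \<in> range X" "b \<in> range X"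
    then obtain v w where "a = X v" "b = X w" by blast
    then show "a \<otimes> b \<in> range X" by (simp flip: X_plus)
  qed (use X_in_carrier in auto)
  have "openin (top_of_set (carrier G)) (U \<inter> \<phi> -` W)"
  proof (rule openin_trans[OF _ chart_props(1)[OF chart]])
    show "openin (top_of_set U) (U \<inter> \<phi> -` W)"
      by (rule continuous_openin_preimage_gen[OF chart_props(5)[OF chart] W(1)])
  qed
  then show "openin (top_of_set (carrier G)) (U \<inter> \<phi> -` W)" .
  show "\<one> \<in> U \<inter> \<phi> -` W"
    using one_U e_W by (simp add: e_def)
  show "U \<inter> \<phi> -` W \<subseteq> range X"
  proof
    fix p assume p: "p \<in> U \<inter> \<phi> -` W"
    then have "norm (f (\<phi> p)) < \<delta>" using smooth_f(2) by (auto simp: image_subset_iff)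
    then have "X (f (\<phi> p)) = p" using p E_f[of "\<phi> p"] by (simp add: X_\<epsilon> \<epsilon>_def)
    then show "p \<in> range X" by (metis rangeI)
  qed
qed

lemma X_near: "norm (v - v0) < \<delta> \<Longrightarrow> X v = X v0 \<otimes> \<psi> (E (v - v0))"
  using X_plus[of v0 "v - v0"] X_\<epsilon>[of "v - v0"] by (simp add: \<epsilon>_def)

text \<open>Near \<open>v0\<close> the map \<open>X\<close> is the local exponential of
  \<open>v - v0\<close> followed by left translation by \<open>X v0\<close>, both smooth in
  charts.\<close>

lemma X_smooth_near:
  assumes V: "(V, \<theta>) \<in> A" and v0: "X v0 \<in> V"
  obtains Q where "open Q" "v0 \<in> Q" "Q \<subseteq> {v. X v \<in> V}" "smooth_on Q (\<lambda>v. \<theta> (X v))"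
proof -
  let ?S = "{x \<in> \<Omega>. X v0 \<otimes> \<psi> x \<in> V}"
  have S: "open ?S" "smooth_on ?S (\<lambda>x. \<theta> (X v0 \<otimes> \<psi> x))"
    using smooth_translation_charts[OF X_in_carrier chart V, of v0] by (simp_all add: \<Omega>_def)
  have shift: "smooth_on (ball v0 \<delta>) (\<lambda>v. v + (- v0))"
    by (intro smooth_on_add smooth_on_id smooth_on_const open_ball)
  have "smooth_on (ball v0 \<delta>) (\<lambda>v. E (v + (- v0)))"
    by (rule smooth_on_compose[OF open_ball open_ball _ shift smooth_E])
      (simp add: dist_norm norm_minus_commute)
  then have sE: "smooth_on (ball v0 \<delta>) (\<lambda>v. E (v - v0))" by simp
  define Q where "Q = {v \<in> ball v0 \<delta>. E (v - v0) \<in> ?S}"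
  have Q: "open Q" unfolding Q_def by (rule open_smooth_preimage[OF sE open_ball S(1)])
  have near: "X v = X v0 \<otimes> \<psi> (E (v - v0))" if "v \<in> Q" for v
    using that by (intro X_near) (simp add: Q_def dist_norm norm_minus_commute)
  have "smooth_on Q (\<lambda>v. \<theta> (X v0 \<otimes> \<psi> (E (v - v0))))"
    by (rule smooth_on_compose[OF Q S(1) _ smooth_on_subset[OF sE] S(2)]) (auto simp: Q_def)
  then have "smooth_on Q (\<lambda>v. \<theta> (X v))"
    by (rule smooth_on_cong[OF _ Q]) (simp add: near)
  moreover have "v0 \<in> Q" using \<delta> v0 X_in_carrier by (simp add: Q_def E_0)
  moreover have "Q \<subseteq> {v. X v \<in> V}" using near by (auto simp: Q_def)
  ultimately show thesis using that Q by blast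
qed

lemma X_inverse_near:
  assumes V: "(V, \<theta>) \<in> A" and v0: "X v0 \<in> V"
  shows "\<exists>S l. open S \<and> \<theta> (X v0) \<in> S \<and> S \<subseteq> \<theta> ` V \<and>
        smooth_on S l \<and> l (\<theta> (X v0)) = v0 \<and> (\<forall>x\<in>S. X (l x) = inv_into V \<theta> x)"
proof -
  note c = chart_props[OF V]
  define g where "g = X v0"
  have g: "g \<in> carrier G" "g \<in> V" using v0 X_in_carrier by (auto simp: g_def)
  let ?T = "{x \<in> \<theta> ` V. inv g \<otimes> inv_into V \<theta> x \<in> U}"
  have T: "open ?T" "smooth_on ?T (\<lambda>x. \<phi> (inv g \<otimes> inv_into V \<theta> x))"
    using smooth_translation_charts[OF inv_closed[OF g(1)] V chart] by auto
  define S where "S = {x \<in> ?T. \<phi> (inv g \<otimes> inv_into V \<theta> x) \<in> W}"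
  have S: "open S" unfolding S_def by (rule open_smooth_preimage[OF T(2,1) W(1)])
  \<comment> \<open>Translate by the inverse of \<open>g\<close> to the identity, take the logarithm
    there, and shift back by \<open>v0\<close>.\<close>
  define l where "l x = f (\<phi> (inv g \<otimes> inv_into V \<theta> x)) + v0" for x
  have f_e: "f e = 0" using f_E[of 0] \<delta> by (simp add: E_0)
  have base: "inv g \<otimes> inv_into V \<theta> (\<theta> g) = \<one>" using g c(4) by simp
  have "\<theta> g \<in> S" using g one_U e_W by (simp add: S_def base flip: e_def)
  moreover have "l (\<theta> g) = v0" by (simp add: l_def base f_e flip: e_def)
  moreover have "smooth_on S l" unfolding l_def
    by (intro smooth_on_add[OF S] smooth_on_const smooth_on_compose[OF S W(1) _ smooth_on_subset[OF T(2)] smooth_f(1)])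
      (auto simp: S_def)
  moreover have "X (l x) = inv_into V \<theta> x" if x: "x \<in> S" for x
  proof -
    let ?p = "inv_into V \<theta> x"
    have p: "?p \<in> V" "inv g \<otimes> ?p \<in> U" "\<phi> (inv g \<otimes> ?p) \<in> W" using x by (auto simp: S_def inv_into_into)
    then have pc: "?p \<in> carrier G" using c(3) by auto
    have "norm (f (\<phi> (inv g \<otimes> ?p))) < \<delta>" using p smooth_f(2) by (auto simp: image_subset_iff)
    then have "X (f (\<phi> (inv g \<otimes> ?p))) = inv g \<otimes> ?p"
      using p(2) E_f[OF p(3)] by (simp add: X_\<epsilon> \<epsilon>_def)
    then have "X (v0 + f (\<phi> (inv g \<otimes> ?p))) = g \<otimes> (inv g \<otimes> ?p)" by (simp add: X_plus g_def)
    then show ?thesis using g pc by (simp add: l_def add.commute flip: m_assoc)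
  qed
  ultimately show ?thesis
    using S unfolding g_def by (intro exI[of _ S] exI[of _ l]) (auto simp: S_def)
qed

lemma X_kernel: "norm v < \<delta> \<Longrightarrow> X v = \<one> \<Longrightarrow> v = 0"
  using f_E[of v] f_E[of 0] \<delta> \<psi>_eqD[OF E_\<Omega>, of v e] by (simp add: X_\<epsilon> \<epsilon>_def E_0)

lemma X_parametrization: "vector_parametrization G A X"
proof
  show "X v \<in> carrier G" "X (v + w) = X v \<otimes> X w" for v w
    by (rule X_in_carrier, rule X_plus)
  show "\<exists>v. g = X v" if "g \<in> carrier G" for g
    using that X_onto by auto
  show "open {v. X v \<in> V} \<and> smooth_on {v. X v \<in> V} (\<lambda>v. \<theta> (X v))" if V: "(V, \<theta>) \<in> A" for V \<theta>
  proof
    show op: "open {v. X v \<in> V}"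
    proof (subst open_subopen, rule ballI)
      fix v assume "v \<in> {v. X v \<in> V}"
      then show "\<exists>T. open T \<and> v \<in> T \<and> T \<subseteq> {v. X v \<in> V}"
        using X_smooth_near[OF V, of v] by (metis mem_Collect_eq)
    qed
    show "smooth_on {v. X v \<in> V} (\<lambda>v. \<theta> (X v))"
    proof (rule smooth_on_local[OF op])
      fix v assume "v \<in> {v. X v \<in> V}"
      then show "\<exists>T. open T \<and> v \<in> T \<and> smooth_on T (\<lambda>v. \<theta> (X v))"
        using X_smooth_near[OF V, of v] by (metis mem_Collect_eq)
    qed
  qed
  show "\<exists>S l. open S \<and> \<theta> (X v) \<in> S \<and> S \<subseteq> \<theta> ` V \<and>
        smooth_on S l \<and> l (\<theta> (X v)) = v \<and> (\<forall>x\<in>S. X (l x) = inv_into V \<theta> x)"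
    if "(V, \<theta>) \<in> A" "X v \<in> V" for V \<theta> v
    by (rule X_inverse_near[OF that])
qed

end

lemma (in abelian_chart) exists_parametrization:
  assumes "connected (carrier G)"
  obtains X and \<delta> :: real where "vector_parametrization G A X" "\<delta> > 0" "\<And>v. norm v < \<delta> \<Longrightarrow> X v = \<one> \<Longrightarrow> v = 0"
proof -
  obtain \<delta> E f W where "local_exponential_data G A U \<phi> \<delta> E f W"
  proof (rule local_exponential)
    fix \<delta> :: real and E f :: "'e \<Rightarrow> 'e" and W
    assume *: "\<delta> > 0" "smooth_on (ball 0 \<delta>) E" "E 0 = e"
      "open W" "W \<subseteq> \<Omega>" "smooth_on W f" "f ` W \<subseteq> ball 0 \<delta>" "E ` ball 0 \<delta> \<subseteq> W"
      "\<And>x. x \<in> W \<Longrightarrow> E (f x) = x" "\<And>a. a \<in> ball 0 \<delta> \<Longrightarrow> f (E a) = a"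
      "\<And>a b. a \<in> ball 0 \<delta> \<Longrightarrow> b \<in> ball 0 \<delta> \<Longrightarrow> a + b \<in> ball 0 \<delta> \<Longrightarrow>
         (E a, E b) \<in> DM \<and> m (E a) (E b) = E (a + b)"
    show thesis
      by (rule that) (unfold_locales; (rule * assms; assumption?))
  qed
  then interpret local_exponential_data G A U \<phi> \<delta> E f W .
  show thesis using that[OF X_parametrization \<delta>] X_kernel by blast
qed

section \<open>Compact quotients of abelian Lie groups\<close>

text \<open>The composites of \<open>inv_into\<close> maps that describe maps between quotients
  agree with a smooth formula only locally, and the formula depends on the point.\<close>

lemma smooth_on_locally_eq:
  assumes "\<And>x. x \<in> M \<Longrightarrow> \<exists>T g. open T \<and> x \<in> T \<and> T \<subseteq> M \<and> smooth_on T g \<and> (\<forall>y\<in>T. F y = g y)"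
  shows "smooth_on M F"
proof (rule smooth_on_local)
  show "open M" using assms by (subst open_subopen) meson
  fix x assume "x \<in> M"
  then obtain T g where T: "open T" "x \<in> T" "smooth_on T g" "\<forall>y\<in>T. F y = g y" using assms by meson
  have "smooth_on T F" by (rule smooth_on_cong[OF T(3,1)]) (simp add: T(4))
  then show "\<exists>T. open T \<and> x \<in> T \<and> smooth_on T F" using T by blast
qed

lemma quotient_map_quotient_topology: "quotient_map X (quotient_topology X p) p"
proof -
  have "topspace (quotient_topology X p) = p ` topspace X"
  proof
    show "topspace (quotient_topology X p) \<subseteq> p ` topspace X"
      using openin_quotient_topology[of X p "topspace (quotient_topology X p)"] by simp
    have "{x \<in> topspace X. p x \<in> p ` topspace X} = topspace X" by auto
    then have "openin (quotient_topology X p) (p ` topspace X)"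
      by (simp add: openin_quotient_topology)
    then show "p ` topspace X \<subseteq> topspace (quotient_topology X p)" by (rule openin_subset)
  qed
  then show ?thesis by (auto simp: quotient_map_def openin_quotient_topology)
qed

lemma integer_lattice_closed:
  "0 \<in> integer_lattice" "x \<in> integer_lattice \<Longrightarrow> y \<in> integer_lattice \<Longrightarrow> x + y \<in> integer_lattice"
  "x \<in> integer_lattice \<Longrightarrow> - x \<in> integer_lattice"
  by (auto simp: integer_lattice_def inner_left_distrib)

definition torus_proj :: "'e::euclidean_space \<Rightarrow> 'e set" where
  "torus_proj v = integer_lattice #>\<^bsub>vector_group\<^esub> v"

lemma torus_proj_eq: "torus_proj v = (\<lambda>z. z + v) ` integer_lattice"
  by (auto simp: torus_proj_def r_coset_def vector_group_def)

lemma torus_proj_eq_iff: "torus_proj v = torus_proj w \<longleftrightarrow> v - w \<in> integer_lattice"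
proof
  assume "torus_proj v = torus_proj w"
  moreover have "v \<in> torus_proj v"
    unfolding torus_proj_eq using integer_lattice_closed(1) by force
  ultimately show "v - w \<in> integer_lattice" by (auto simp: torus_proj_eq)
next
  assume d: "v - w \<in> integer_lattice"
  have "z + v \<in> (\<lambda>z. z + w) ` integer_lattice" if "z \<in> integer_lattice" for z
    by (rule image_eqI[of _ _ "z + (v - w)"]) (simp_all add: integer_lattice_closed that d)
  moreover have "z + w \<in> (\<lambda>z. z + v) ` integer_lattice" if "z \<in> integer_lattice" for z
  proof (rule image_eqI[of _ _ "z + - (v - w)"])
    show "z + - (v - w) \<in> integer_lattice" by (intro integer_lattice_closed that d)
  qed simp
  ultimately show "torus_proj v = torus_proj w" unfolding torus_proj_eq by blast
qed

lemma torus_quotient_map: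
  "quotient_map euclidean (quotient_space (vector_group :: 'e::euclidean_space monoid) integer_lattice) torus_proj"
  using quotient_map_quotient_topology[of "top_of_set (UNIV :: 'e set)" torus_proj]
  by (simp add: quotient_space_def vector_group_def torus_proj_def[abs_def])

lemma torus_atlas_eq:
  "quotient_atlas vector_group {(UNIV, \<lambda>x::'e::euclidean_space. x)} integer_lattice =
    {(torus_proj ` W, inv_into W torus_proj) |W. open W \<and> inj_on torus_proj W}"
proof -
  have "torus_proj = (\<lambda>v::'e. integer_lattice #>\<^bsub>vector_group\<^esub> v)"
    by (rule ext) (rule torus_proj_def)
  then show ?thesis
    by (auto simp: quotient_atlas_def vector_group_def o_def)
qed

context vector_parametrization
begin

lemma X_zero [simp]: "X 0 = \<one>"
proof -
  have "X 0 \<otimes> X 0 = X 0" using X_add[of 0 0] by simp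
  then show ?thesis using X_carrier by (metis l_cancel_one')
qed

lemma X_neg: "X (- v) = inv (X v)"
  using X_add[of "- v" v] by (metis X_carrier X_zero inv_equality left_minus)

lemma X_diff: "X (v - w) = X v \<otimes> inv (X w)"
  using X_add[of v "- w"] by (simp add: X_neg)

lemma X_continuous: "continuous_on UNIV X"
proof -
  have "isCont X v" for v
  proof -
    obtain V \<theta> where V: "(V, \<theta>) \<in> A" "X v \<in> V" using atlas_cover X_carrier[of v] by auto
    note c = chart_props[OF V(1)]
    have op: "open {v. X v \<in> V}" and sm: "smooth_on {v. X v \<in> V} (\<lambda>v. \<theta> (X v))"
      using X_smooth[OF V(1)] by auto
    have "(\<lambda>v. \<theta> (X v)) ` {v. X v \<in> V} \<subseteq> \<theta> ` V" by auto
    from continuous_on_compose2[OF c(6) smooth_on_continuous_on[OF sm] this]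
    have "continuous_on {v. X v \<in> V} (\<lambda>v. inv_into V \<theta> (\<theta> (X v)))" .
    then have "continuous_on {v. X v \<in> V} X"
      by (rule continuous_on_eq) (simp add: c(4))
    then show ?thesis using op V(2) by (simp add: continuous_on_eq_continuous_at)
  qed
  then show ?thesis by (simp add: continuous_at_imp_continuous_on)
qed

lemma X_preimage_open: "openin (top_of_set (carrier G)) T \<Longrightarrow> open {v. X v \<in> T}"
  using continuous_openin_preimage[OF X_continuous, of "carrier G" T] by (simp add: vimage_def)

text \<open>Through each \<open>v\<close> in an open set runs a local section; the points at which
  its value stays in that set belong to the image and form a neighbourhood of
  \<open>X v\<close>.\<close>

lemma X_open_map: "open_map euclidean (top_of_set (carrier G)) X"
  unfolding open_map_def
proof (intro allI impI)
  fix O' :: "'e set" assume "openin euclidean O'"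
  then have O': "open O'" by simp
  show "openin (top_of_set (carrier G)) (X ` O')"
  proof (subst openin_subopen, rule ballI)
    fix g assume "g \<in> X ` O'"
    then obtain v where v: "v \<in> O'" "g = X v" by blast
    obtain V \<theta> where V: "(V, \<theta>) \<in> A" "X v \<in> V" using atlas_cover X_carrier[of v] by auto
    note c = chart_props[OF V(1)]
    from X_inverse[OF V] obtain S l where S: "open S" "\<theta> (X v) \<in> S" "S \<subseteq> \<theta> ` V" "smooth_on S l" "l (\<theta> (X v)) = v"
      "\<forall>x\<in>S. X (l x) = inv_into V \<theta> x"
      by (elim exE conjE)
    let ?S = "{x \<in> S. l x \<in> O'}"
    have "open ?S" by (rule open_smooth_preimage[OF S(4,1) O'])
    then have "openin (top_of_set V) (V \<inter> \<theta> -` ?S)"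
      by (rule continuous_openin_preimage_gen[OF c(5)])
    then have "openin (top_of_set (carrier G)) (V \<inter> \<theta> -` ?S)"
      using c(1) by (rule openin_trans)
    moreover have "g \<in> V \<inter> \<theta> -` ?S" using v V S by simp
    moreover have "V \<inter> \<theta> -` ?S \<subseteq> X ` O'"
    proof
      fix p assume p: "p \<in> V \<inter> \<theta> -` ?S"
      then have "X (l (\<theta> p)) = p" using S(6) c(4) by simp
      then show "p \<in> X ` O'" using p by (metis (no_types, lifting) IntD2 imageI mem_Collect_eq vimageE)
    qed
    ultimately show "\<exists>T. openin (top_of_set (carrier G)) T \<and> g \<in> T \<and> T \<subseteq> X ` O'" by blast
  qed
qed

lemma X_quotient_map: "quotient_map euclidean (top_of_set (carrier G)) X"
proof (rule continuous_open_imp_quotient_map[OF _ X_open_map])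
  show "continuous_map euclidean (top_of_set (carrier G)) X"
    using X_continuous by (auto simp: continuous_map_in_subtopology)
  show "X ` topspace euclidean = topspace (top_of_set (carrier G))"
    using X_surj by auto
qed

lemma coset_eq_iff:
  assumes H: "subgroup H G" and a: "a \<in> carrier G" and b: "b \<in> carrier G"
  shows "H #> a = H #> b \<longleftrightarrow> a \<otimes> inv b \<in> H"
proof
  assume "H #> a = H #> b"
  then have "a \<in> H #> b" using rcos_self[OF a H] by simp
  then obtain h where h: "h \<in> H" "a = h \<otimes> b" by (auto simp: r_coset_def)
  have "h \<in> carrier G" using h(1) subgroup.subset[OF H] by blast
  then show "a \<otimes> inv b \<in> H" using h b by (simp add: m_assoc)
next
  assume h: "a \<otimes> inv b \<in> H"
  have "a = (a \<otimes> inv b) \<otimes> b" using a b by (simp add: m_assoc)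
  then have "a \<in> H #> b" using h by (auto simp: r_coset_def)
  then show "H #> a = H #> b" using repr_independence[OF _ b H] by simp
qed

lemma coset_X_eq_iff:
  assumes "subgroup H G"
  shows "H #> X v = H #> X w \<longleftrightarrow> X (v - w) \<in> H"
  by (simp add: coset_eq_iff[OF assms] X_diff)

lemma coset_quotient_map: "quotient_map euclidean (quotient_space G H) (\<lambda>v. H #> X v)"
  using quotient_map_compose[OF X_quotient_map quotient_map_quotient_topology, of "\<lambda>g. H #> g"]
  by (simp add: quotient_space_def o_def)

text \<open>Discreteness at the identity forces points of the preimage near 0 to map to the
  identity, and the kernel being trivial within \<open>\<delta>\<close> then forces them to be 0;
  hence the minimum of both radii.\<close>

lemma preimage_discrete_subgroup:
  assumes H: "subgroup H G" "discrete H" and \<delta>: "\<delta> > 0" "\<And>v. norm v < \<delta> \<Longrightarrow> X v = \<one> \<Longrightarrow> v = 0"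
  obtains d where "discrete_subgroup {v. X v \<in> H} d"
proof -
  have "\<one> isolated_in H" using H(2) subgroup.one_closed[OF H(1)] by (rule discreteD)
  then obtain T where T: "open T" "T \<inter> H = {\<one>}" by (auto simp: isolated_in_def)
  have "open {v. X v \<in> carrier G \<inter> T}" by (rule X_preimage_open) (simp add: openin_open_Int T(1))
  then have "open {v. X v \<in> T}" by simp
  moreover have "0 \<in> {v. X v \<in> T}" using T by auto
  ultimately obtain r where r: "r > 0" "ball 0 r \<subseteq> {v. X v \<in> T}" using open_contains_ball by blast
  have "discrete_subgroup {v. X v \<in> H} (min r \<delta>)"
  proof
    show "0 \<in> {v. X v \<in> H}" using subgroup.one_closed[OF H(1)] by simp
    show "v - w \<in> {v. X v \<in> H}" if "v \<in> {v. X v \<in> H}" "w \<in> {v. X v \<in> H}" for v w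
      using that subgroup.m_closed[OF H(1)] subgroup.m_inv_closed[OF H(1)] by (simp add: X_diff)
    show "min r \<delta> > 0" using r \<delta> by simp
    fix v assume v: "v \<in> {v. X v \<in> H}" "norm v < min r \<delta>"
    then have "v \<in> ball 0 r" by simp
    then have "X v \<in> T \<inter> H" using r(2) v(1) by blast
    then show "v = 0" using T(2) v(2) \<delta>(2) by auto
  qed
  then show thesis by (rule that)
qed

text \<open>A linear functional vanishing on the preimage of \<open>H\<close> descends to a continuous unbounded
  function on the quotient unless it is zero.\<close>

lemma preimage_spans:
  assumes H: "subgroup H G" and comp: "compact_space (quotient_space G H)"
  shows "span {v. X v \<in> H} = UNIV"
proof (rule ccontr)
  assume "span {v. X v \<in> H} \<noteq> UNIV"
  then obtain a where a: "a \<noteq> 0" "\<forall>x\<in>span {v. X v \<in> H}. a \<bullet> x = 0"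
    using span_not_UNIV_orthogonal by blast
  define q where "q v = H #> X v" for v
  \<comment> \<open>The choice of \<open>v\<close> does not matter: two choices differ by a point of
    the preimage of \<open>H\<close>, which \<open>a\<close> annihilates.\<close>
  define l where "l C = a \<bullet> (SOME v. q v = C)" for C
  have l: "l (q v) = a \<bullet> v" for v
  proof -
    have "q (SOME w. q w = q v) = q v" by (rule someI[of _ v]) simp
    then have "(SOME w. q w = q v) - v \<in> {v. X v \<in> H}"
      unfolding q_def using coset_X_eq_iff[OF H] by simp
    from bspec[OF a(2) span_base[OF this]]
    have "a \<bullet> ((SOME w. q w = q v) - v) = 0" .
    then show ?thesis by (simp add: l_def inner_diff_right)
  qed
  have qm: "quotient_map euclidean (quotient_space G H) q"
    using coset_quotient_map[of H] by (simp add: q_def[abs_def])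
  have "continuous_map euclidean euclideanreal (l \<circ> q)"
    by (simp add: o_def l continuous_on_inner continuous_on_const continuous_on_id)
  then have "continuous_map (quotient_space G H) euclideanreal l"
    by (rule continuous_compose_quotient_map[OF qm])
  then have "compactin euclideanreal (l ` topspace (quotient_space G H))"
    using comp unfolding compact_space_def by (rule image_compactin[rotated])
  then have "bounded (l ` topspace (quotient_space G H))"
    using compact_imp_bounded by simp
  moreover have "l ` topspace (quotient_space G H) = UNIV"
  proof -
    have "r \<in> l ` topspace (quotient_space G H)" for r
    proof -
      have "q ((r / (a \<bullet> a)) *\<^sub>R a) \<in> topspace (quotient_space G H)"
        using quotient_imp_surjective_map[OF qm] by auto
      moreover have "l (q ((r / (a \<bullet> a)) *\<^sub>R a)) = r" using a(1) by (simp add: l)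
      ultimately show ?thesis by (metis imageI)
    qed
    then show ?thesis by blast
  qed
  ultimately show False using not_bounded_UNIV by metis
qed

lemma linear_reparametrization:
  assumes L: "linear L" "bij L"
  shows "vector_parametrization G A (\<lambda>v. X (L v))"
proof
  define L' where "L' = inv_into UNIV L"
  have L': "linear L'" unfolding L'_def
    using inj_linear_imp_inv_linear[OF L(1) bij_is_inj[OF L(2)]] .
  have L_L': "L (L' x) = x" "L' (L x) = x" for x
    using L(2) by (simp_all add: L'_def bij_is_surj surj_f_inv_f bij_is_inj inv_f_f)
  have smL: "smooth_on UNIV L"
    using smooth_on_bounded_linear[OF _ open_UNIV smooth_on_id[OF open_UNIV]] L(1)
    by (simp add: linear_conv_bounded_linear)
  show "X (L v) \<in> carrier G" for v by simp
  show "X (L (v + w)) = X (L v) \<otimes> X (L w)" for v w by (simp add: linear_add[OF L(1)] X_add)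
  show "\<exists>v. g = X (L v)" if "g \<in> carrier G" for g
    using X_surj[OF that] L_L'(1) by metis
  show "open {v. X (L v) \<in> V} \<and> smooth_on {v. X (L v) \<in> V} (\<lambda>v. \<theta> (X (L v)))" if V: "(V, \<theta>) \<in> A" for V \<theta>
  proof
    have X: "open {v. X v \<in> V}" "smooth_on {v. X v \<in> V} (\<lambda>v. \<theta> (X v))" using X_smooth[OF V] by auto
    show op: "open {v. X (L v) \<in> V}"
      using open_smooth_preimage[OF smL open_UNIV X(1)] by simp
    show "smooth_on {v. X (L v) \<in> V} (\<lambda>v. \<theta> (X (L v)))"
      by (rule smooth_on_compose[OF op X(1) _ smooth_on_subset[OF smL] X(2)]) auto
  qed
  show "\<exists>S l. open S \<and> \<theta> (X (L v)) \<in> S \<and> S \<subseteq> \<theta> ` V \<and>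
        smooth_on S l \<and> l (\<theta> (X (L v))) = v \<and> (\<forall>x\<in>S. X (L (l x)) = inv_into V \<theta> x)"
    if V: "(V, \<theta>) \<in> A" "X (L v) \<in> V" for V \<theta> v
  proof -
    from X_inverse[OF V] obtain S l where S: "open S" "\<theta> (X (L v)) \<in> S" "S \<subseteq> \<theta> ` V" "smooth_on S l" "l (\<theta> (X (L v))) = L v"
      "\<forall>x\<in>S. X (l x) = inv_into V \<theta> x"
      by (elim exE conjE)
    have "smooth_on S (\<lambda>x. L' (l x))"
      using smooth_on_bounded_linear[OF _ S(1,4)] L' by (simp add: linear_conv_bounded_linear)
    then show ?thesis
      using S by (intro exI[of _ S] exI[of _ "\<lambda>x. L' (l x)"]) (simp add: L_L')
  qed
qed

end

section \<open>The diffeomorphism with the standard torus\<close>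

locale lattice_parametrization = vector_parametrization G A X
  for G :: "('g::topological_space, 'k) monoid_scheme" (structure)
    and A :: "('g, 'e::euclidean_space) chart set" and X :: "'e \<Rightarrow> 'g" +
  fixes \<Gamma> :: "'g set"
  assumes \<Gamma>: "subgroup \<Gamma> G" and X_mem_iff: "X v \<in> \<Gamma> \<longleftrightarrow> v \<in> integer_lattice"
begin

definition p where "p g = \<Gamma> #> g"
definition q where "q v = p (X v)"
abbreviation QG where "QG \<equiv> quotient_space G \<Gamma>"
abbreviation QT where "QT \<equiv> quotient_space (vector_group :: 'e monoid) integer_lattice"

lemma q_eq_iff: "q v = q w \<longleftrightarrow> v - w \<in> integer_lattice"
  by (simp add: q_def p_def coset_X_eq_iff[OF \<Gamma>] X_mem_iff)

text \<open>\<open>q\<close> and \<open>torus_proj\<close> are quotient maps on the same space;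
  equal fibres let each factor through the other, which yields \<open>to_torus\<close> and
  \<open>of_torus\<close> and makes the choices in them harmless.\<close>

lemma q_eq_iff_torus: "q v = q w \<longleftrightarrow> torus_proj v = torus_proj w"
  by (simp add: q_eq_iff torus_proj_eq_iff)

lemma q_quotient_map: "quotient_map euclidean QG q"
  using coset_quotient_map[of \<Gamma>] by (simp add: q_def[abs_def] p_def)

definition to_torus :: "'g set \<Rightarrow> 'e set" where "to_torus C = torus_proj (SOME v. q v = C)"
definition of_torus :: "'e set \<Rightarrow> 'g set" where "of_torus C = q (SOME v. torus_proj v = C)"

lemma to_torus_q [simp]: "to_torus (q v) = torus_proj v"
proof -
  have "q (SOME w. q w = q v) = q v" by (rule someI[of _ v]) simp
  then show ?thesis by (simp add: to_torus_def q_eq_iff_torus)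
qed

lemma of_torus_proj [simp]: "of_torus (torus_proj v) = q v"
proof -
  have "torus_proj (SOME w. torus_proj w = torus_proj v) = torus_proj v" by (rule someI[of _ v]) simp
  then show ?thesis by (simp add: of_torus_def flip: q_eq_iff_torus)
qed

lemma to_torus_continuous: "continuous_map QG QT to_torus"
proof (rule continuous_compose_quotient_map[OF q_quotient_map])
  have "to_torus \<circ> q = torus_proj" by (rule ext) simp
  then show "continuous_map euclidean QT (to_torus \<circ> q)"
    using quotient_imp_continuous_map[OF torus_quotient_map] by simp
qed

lemma of_torus_continuous: "continuous_map QT QG of_torus"
proof (rule continuous_compose_quotient_map[OF torus_quotient_map])
  have "of_torus \<circ> torus_proj = q" by (rule ext) simp
  then show "continuous_map euclidean QG (of_torus \<circ> torus_proj)"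
    using quotient_imp_continuous_map[OF q_quotient_map] by simp
qed

lemma torus_homeomorphic_maps: "homeomorphic_maps QG QT to_torus of_torus"
proof -
  have "of_torus (to_torus C) = C" if "C \<in> topspace QG" for C
  proof -
    have "C \<in> range q" using that quotient_imp_surjective_map[OF q_quotient_map] by simp
    then show ?thesis by auto
  qed
  moreover have "to_torus (of_torus C) = C" if "C \<in> topspace QT" for C
  proof -
    have "range (torus_proj :: 'e \<Rightarrow> _) = topspace QT"
      using quotient_imp_surjective_map[OF torus_quotient_map] by simp
    then have "C \<in> range torus_proj" using that by simp
    then show ?thesis by auto
  qed
  ultimately show ?thesis
    using to_torus_continuous of_torus_continuous by (simp add: homeomorphic_maps_def)
qed

lemma p_eq_lift:
  assumes g: "g \<in> carrier G" and eq: "p g = q v"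
  obtains z where "z \<in> integer_lattice" "g = X (v + z)"
proof -
  obtain w where w: "g = X w" using X_surj[OF g] by blast
  then have "w - v \<in> integer_lattice" using eq q_eq_iff[of w v] by (simp add: q_def)
  then show thesis using that[of "w - v"] w by simp
qed

lemma p_X_shift: "z \<in> integer_lattice \<Longrightarrow> p (X (v + z)) = q v"
  using q_eq_iff[of "v + z" v] by (simp add: q_def)

lemma torus_proj_shift: "z \<in> integer_lattice \<Longrightarrow> torus_proj (v + z) = torus_proj v"
  by (simp add: torus_proj_eq_iff)

context
  fixes U :: "'g set" and \<phi> :: "'g \<Rightarrow> 'e" and W' :: "'g set" and W :: "'e set"
  assumes chart: "(U, \<phi>) \<in> A" and W': "openin (top_of_set (carrier G)) W'" "W' \<subseteq> U" "inj_on p W'"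
    and W: "open W" "inj_on torus_proj W"
begin

abbreviation \<theta> where "\<theta> \<equiv> \<phi> \<circ> inv_into W' p"

lemma W'_carrier: "W' \<subseteq> carrier G"
  using W'(2) chart_props(3)[OF chart] by blast

lemma inv_p [simp]: "g \<in> W' \<Longrightarrow> inv_into W' p (p g) = g"
  using W'(3) by (rule inv_into_f_f)

lemma \<theta>_p: "g \<in> W' \<Longrightarrow> \<theta> (p g) = \<phi> g"
  by simp

lemma \<theta>_inverse: "g \<in> W' \<Longrightarrow> inv_into (p ` W') \<theta> (\<phi> g) = p g"
proof -
  assume g: "g \<in> W'"
  have "inj_on \<theta> (p ` W')"
  proof (rule inj_onI)
    fix C C' assume C: "C \<in> p ` W'" "C' \<in> p ` W'" "\<theta> C = \<theta> C'"
    then obtain a b where ab: "C = p a" "C' = p b" "a \<in> W'" "b \<in> W'" by blast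
    then have "\<phi> a = \<phi> b" using C(3) \<theta>_p[of a] \<theta>_p[of b] by simp
    then have "a = b"
      using inj_onD[OF chart_props(4)[OF chart]] W'(2) ab(3,4) by blast
    then show "C = C'" using ab by simp
  qed
  then show ?thesis using inv_into_f_f[of \<theta> "p ` W'" "p g"] g by simp
qed

lemma open_\<phi>_W': "open (\<phi> ` W')"
proof -
  note c = chart_props[OF chart]
  obtain T where T: "open T" "W' = carrier G \<inter> T" using W'(1) by (metis openin_open)
  have "\<phi> ` W' = \<phi> ` U \<inter> inv_into U \<phi> -` T"
  proof
    show "\<phi> ` W' \<subseteq> \<phi> ` U \<inter> inv_into U \<phi> -` T"
      using T(2) W'(2) c(4) by auto
    show "\<phi> ` U \<inter> inv_into U \<phi> -` T \<subseteq> \<phi> ` W'"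
      using T(2) W'(2) c(3,4) by auto
  qed
  then show ?thesis using continuous_open_preimage[OF c(6,2) T(1)] by simp
qed

text \<open>Near each point the expression is \<open>y \<mapsto> l y + - z\<close>, with
  \<open>l\<close> a smooth local section of \<open>X\<close> and \<open>z\<close> the lattice
  vector that brings it back into the sheet \<open>W\<close> on which \<open>torus_proj\<close> is
  inverted.\<close>

lemma to_torus_smooth:
  "smooth_on (\<theta> ` {C \<in> p ` W'. to_torus C \<in> torus_proj ` W})
     (inv_into W torus_proj \<circ> to_torus \<circ> inv_into (p ` W') \<theta>)"
proof (rule smooth_on_locally_eq)
  let ?F = "inv_into W torus_proj \<circ> to_torus \<circ> inv_into (p ` W') \<theta>"
  let ?M = "\<theta> ` {C \<in> p ` W'. to_torus C \<in> torus_proj ` W}"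
  note c = chart_props[OF chart]
  fix x assume "x \<in> ?M"
  then obtain g w where g: "g \<in> W'" "x = \<phi> g" and w: "w \<in> W" "to_torus (p g) = torus_proj w" by auto
  have gc: "g \<in> carrier G" "g \<in> U" using g(1) W'_carrier W'(2) by auto
  obtain v where v: "g = X v" using X_surj[OF gc(1)] by blast
  then have "torus_proj v = torus_proj w" using w(2) by (simp flip: q_def)
  then have "p g = q w" using v by (simp add: q_def[symmetric] q_eq_iff_torus)
  then obtain z where z: "z \<in> integer_lattice" "g = X (w + z)" using p_eq_lift[OF gc(1)] by blast
  have "X (w + z) \<in> U" using gc z by simp
  from X_inverse[OF chart this] obtain S l where S: "open S" "\<phi> (X (w + z)) \<in> S" "S \<subseteq> \<phi> ` U" "smooth_on S l"
      "l (\<phi> (X (w + z))) = w + z" "\<forall>x\<in>S. X (l x) = inv_into U \<phi> x"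
    by (elim exE conjE)
  have sm: "smooth_on S (\<lambda>x. l x + - z)" by (rule smooth_on_add[OF S(1,4) smooth_on_const])
  define T where "T = {y \<in> S. l y + - z \<in> W} \<inter> \<phi> ` W'"
  have opT: "open T" unfolding T_def
    by (intro open_Int open_\<phi>_W' open_smooth_preimage[OF sm S(1) W(1)])
  have T: "y \<in> ?M \<and> ?F y = l y + - z" if y: "y \<in> T" for y
  proof -
    obtain h where h: "h \<in> W'" "y = \<phi> h" using y by (auto simp: T_def)
    have yS: "y \<in> S" "l y + - z \<in> W" using y by (auto simp: T_def)
    have "X (l y) = h" using S(6) yS(1) h W'(2) c(4) by (metis inv_into_f_f subsetD)
    then have "p h = q (l y)" by (simp add: q_def)
    then have tt: "to_torus (p h) = torus_proj (l y + - z)"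
      using torus_proj_shift[of "- z" "l y"] integer_lattice_closed(3)[OF z(1)] by simp
    have "p h \<in> {C \<in> p ` W'. to_torus C \<in> torus_proj ` W}" using h yS(2) tt by auto
    then have "\<theta> (p h) \<in> ?M" by (rule imageI)
    then have "y \<in> ?M" using h by simp
    moreover have "?F y = l y + - z"
      using h \<theta>_inverse[OF h(1)] tt yS(2) W(2) by simp
    ultimately show ?thesis by blast
  qed
  have "x \<in> T" using g z S(2,5) w(1) by (auto simp: T_def)
  then show "\<exists>T g. open T \<and> x \<in> T \<and> T \<subseteq> ?M \<and> smooth_on T g \<and> (\<forall>y\<in>T. ?F y = g y)"
    using opT T smooth_on_subset[OF sm, of T]
    by (intro exI[of _ T] exI[of _ "\<lambda>x. l x + - z"]) (auto simp: T_def)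
qed

text \<open>Near each point the expression is \<open>v \<mapsto> \<phi> (X (v + z))\<close>, where
  the lattice vector \<open>z\<close> corrects \<open>v\<close> so that \<open>X (v + z)\<close>
  lies in the sheet \<open>W'\<close> of the quotient chart.\<close>

lemma of_torus_smooth:
  "smooth_on (inv_into W torus_proj ` {D \<in> torus_proj ` W. of_torus D \<in> p ` W'})
     (\<theta> \<circ> of_torus \<circ> inv_into (torus_proj ` W) (inv_into W torus_proj))"
proof (rule smooth_on_locally_eq)
  let ?F = "\<theta> \<circ> of_torus \<circ> inv_into (torus_proj ` W) (inv_into W torus_proj)"
  let ?M = "inv_into W torus_proj ` {D \<in> torus_proj ` W. of_torus D \<in> p ` W'}"
  have inv: "inv_into (torus_proj ` W) (inv_into W torus_proj) w = torus_proj w" if "w \<in> W" for w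
  proof -
    have "inj_on (inv_into W torus_proj) (torus_proj ` W)" by (rule inj_on_inv_into) simp
    from inv_into_f_f[OF this, of "torus_proj w"] show ?thesis using that W(2) by simp
  qed
  fix x assume "x \<in> ?M"
  then obtain w g where w: "w \<in> W" "x = w" and g: "g \<in> W'" "of_torus (torus_proj w) = p g"
    using W(2) by auto
  have gc: "g \<in> carrier G" using g(1) W'_carrier by blast
  have "p g = q w" using g(2) by simp
  then obtain z where z: "z \<in> integer_lattice" "g = X (w + z)" using p_eq_lift[OF gc] by blast
  have U: "open {v. X v \<in> U}" "smooth_on {v. X v \<in> U} (\<lambda>v. \<phi> (X v))" using X_smooth[OF chart] by auto
  have shift: "smooth_on UNIV (\<lambda>v. v + z)"
    by (intro smooth_on_add smooth_on_id smooth_on_const open_UNIV)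
  define T where "T = W \<inter> {v \<in> UNIV. v + z \<in> {v. X v \<in> W'}}"
  have opT: "open T" unfolding T_def
    by (intro open_Int W(1) open_smooth_preimage[OF shift open_UNIV] X_preimage_open W'(1))
  have sm: "smooth_on T (\<lambda>v. \<phi> (X (v + z)))"
    by (rule smooth_on_compose[OF opT U(1) _ smooth_on_subset[OF shift] U(2)])
      (use W'(2) in \<open>auto simp: T_def\<close>)
  have T: "y \<in> ?M \<and> ?F y = \<phi> (X (y + z))" if y: "y \<in> T" for y
  proof -
    have yW: "y \<in> W" "X (y + z) \<in> W'" using y by (auto simp: T_def)
    have q: "q y = p (X (y + z))" using p_X_shift[OF z(1)] by simp
    have "torus_proj y \<in> {D \<in> torus_proj ` W. of_torus D \<in> p ` W'}" using yW q by simp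
    then have "inv_into W torus_proj (torus_proj y) \<in> ?M" by (rule imageI)
    then have "y \<in> ?M" using yW W(2) by simp
    moreover have "?F y = \<phi> (X (y + z))"
      using inv[OF yW(1)] q \<theta>_p[OF yW(2)] by simp
    ultimately show ?thesis by blast
  qed
  have "x \<in> T" using w g z by (simp add: T_def)
  then show "\<exists>T g. open T \<and> x \<in> T \<and> T \<subseteq> ?M \<and> smooth_on T g \<and> (\<forall>y\<in>T. ?F y = g y)"
    using opT T sm by (intro exI[of _ T] exI[of _ "\<lambda>v. \<phi> (X (v + z))"]) auto
qed

end

lemma quotient_atlas_eq:
  "quotient_atlas G A \<Gamma> = {(p ` W, \<phi> \<circ> inv_into W p) |U \<phi> W.
     (U, \<phi>) \<in> A \<and> openin (top_of_set (carrier G)) W \<and> W \<subseteq> U \<and> inj_on p W}"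
  unfolding quotient_atlas_def p_def[abs_def] ..

lemma quotient_is_torus: "is_torus G A \<Gamma>"
  unfolding is_torus_def diffeomorphic_def
proof (intro exI conjI)
  show "homeomorphic_maps QG QT to_torus of_torus" by (rule torus_homeomorphic_maps)
  show "smooth_map QG (quotient_atlas G A \<Gamma>) QT (quotient_atlas vector_group {(UNIV, \<lambda>x. x)} integer_lattice) to_torus"
    unfolding smooth_map_def
  proof (intro conjI to_torus_continuous ballI, clarify)
    fix C \<chi>1 D \<chi>2
    assume "(C, \<chi>1) \<in> quotient_atlas G A \<Gamma>"
      and "(D, \<chi>2) \<in> quotient_atlas vector_group {(UNIV, \<lambda>x::'e. x)} integer_lattice"
    then show "smooth_on (\<chi>1 ` {x \<in> C. to_torus x \<in> D}) (\<chi>2 \<circ> to_torus \<circ> inv_into C \<chi>1)"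
      unfolding quotient_atlas_eq torus_atlas_eq using to_torus_smooth by auto
  qed
  show "smooth_map QT (quotient_atlas vector_group {(UNIV, \<lambda>x. x)} integer_lattice) QG (quotient_atlas G A \<Gamma>) of_torus"
    unfolding smooth_map_def
  proof (intro conjI of_torus_continuous ballI, clarify)
    fix C \<chi>1 D \<chi>2
    assume "(D, \<chi>2) \<in> quotient_atlas G A \<Gamma>"
      and "(C, \<chi>1) \<in> quotient_atlas vector_group {(UNIV, \<lambda>x::'e. x)} integer_lattice"
    then show "smooth_on (\<chi>1 ` {x \<in> C. of_torus x \<in> D}) (\<chi>2 \<circ> of_torus \<circ> inv_into C \<chi>1)"
      unfolding quotient_atlas_eq torus_atlas_eq using of_torus_smooth by auto
  qed
qed

end

text \<open>The library states this only for subsets of normed spaces.\<close>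

lemma simply_connected_imp_connected_topological:
  fixes S :: "'a::topological_space set"
  assumes "simply_connected S"
  shows "connected S"
proof (rule path_connected_imp_connected)
  have "path_component S a b" if "a \<in> S" "b \<in> S" for a b
  proof -
    \<comment> \<open>Constant loops at \<open>a\<close> and \<open>b\<close> are homotopic by
      hypothesis, and following one parameter through the homotopy joins \<open>a\<close> to
      \<open>b\<close>.\<close>
    have "homotopic_loops S (\<lambda>_. a) (\<lambda>_. b)"
      by (rule assms[unfolded simply_connected_def, rule_format])
        (use that in \<open>auto simp: path_def pathstart_def pathfinish_def path_image_def\<close>)
    from homotopic_loops_imp_path_component_value[OF this, of 0] show ?thesis by simp
  qed
  then show "path_connected S" by (simp add: path_connected_component)
qed

lemma abelian_nilmanifold_is_torus:
  fixes G :: "('g::topological_space, 'k) monoid_scheme"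
    and A :: "('g, 'e::euclidean_space) chart set"
  assumes nil: "nilmanifold G A \<Gamma>" and \<kappa>: "\<kappa> \<in> A" "\<one>\<^bsub>G\<^esub> \<in> fst \<kappa>"
    and abelian: "\<And>v w. lie_bracket G \<kappa> v w = 0"
  shows "is_torus G A \<Gamma>"
proof -
  obtain U \<phi> where U: "\<kappa> = (U, \<phi>)" by fastforce
  have lie: "lie_group G A" and \<Gamma>: "subgroup \<Gamma> G" "discrete \<Gamma>" and comp: "compact_space (quotient_space G \<Gamma>)"
    and conn: "connected (carrier G)"
    using nil by (auto simp: nilmanifold_def intro: simply_connected_imp_connected_topological)
  interpret group G using lie by (simp add: lie_group_def)
  interpret lie_chart G A U \<phi>
    using lie \<kappa> U by unfold_locales auto
  interpret abelian_chart G A U \<phi>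
    using abelian by unfold_locales (simp add: U lie_bracket_eq)
  obtain Y and \<delta> :: real where Y: "vector_parametrization G A Y" and
    \<delta>: "\<delta> > 0" "\<And>v. norm v < \<delta> \<Longrightarrow> Y v = \<one>\<^bsub>G\<^esub> \<Longrightarrow> v = 0"
    using exists_parametrization[OF conn] by blast
  interpret Y: vector_parametrization G A Y by (rule Y)
  obtain d where d: "discrete_subgroup {v. Y v \<in> \<Gamma>} d"
    using Y.preimage_discrete_subgroup[OF \<Gamma> \<delta>] by blast
  \<comment> \<open>A linear change of coordinates turns the lattice over \<open>\<Gamma>\<close>
    into the integer lattice, so that the fibres match those of the standard torus.\<close>
  obtain L :: "'e \<Rightarrow> 'e" where L: "linear L" "bij L" "L ` integer_lattice = {v. Y v \<in> \<Gamma>}"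
    using discrete_subgroup.linear_image_integer_lattice[OF d Y.preimage_spans[OF \<Gamma>(1) comp]] by blast
  interpret L: vector_parametrization G A "\<lambda>v. Y (L v)"
    by (rule Y.linear_reparametrization[OF L(1,2)])
  interpret lattice_parametrization G A "\<lambda>v. Y (L v)" \<Gamma>
  proof
    show "Y (L v) \<in> \<Gamma> \<longleftrightarrow> v \<in> integer_lattice" for v
    proof -
      have "Y (L v) \<in> \<Gamma> \<longleftrightarrow> L v \<in> L ` integer_lattice" using L(3) by auto
      then show ?thesis using bij_is_inj[OF L(2)] by (simp add: inj_image_mem_iff)
    qed
  qed (use \<Gamma>(1) in \<open>auto simp: subgroup_def\<close>)
  show ?thesis by (rule quotient_is_torus)
qed

theorem theorem2p3:
  fixes G :: "('g::topological_space, 'k) monoid_scheme"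
    and A :: "('g, 'e::euclidean_space) chart set"
    and \<Gamma> :: "'g set" and \<kappa> :: "('g, 'e) chart" and J :: "'e \<Rightarrow> 'e"
  assumes "nilmanifold G A \<Gamma>"
    and "\<not> is_torus G A \<Gamma>"
    and "\<kappa> \<in> A" and "\<one>\<^bsub>G\<^esub> \<in> fst \<kappa>"
    and "invariant_complex_structure (lie_bracket G \<kappa>) J"
  shows "\<not> (\<exists>g. hermitian_metric J g \<and> static_metric (lie_bracket G \<kappa>) J g 0)"
proof
  assume "\<exists>g. hermitian_metric J g \<and> static_metric (lie_bracket G \<kappa>) J g 0"
  then obtain g where g: "hermitian_metric J g" "static_metric (lie_bracket G \<kappa>) J g 0" by blast
  obtain U \<phi> where U: "\<kappa> = (U, \<phi>)" by fastforce
  have lie: "lie_group G A" and nil: "nilpotent_group G"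
    using assms(1) by (auto simp: nilmanifold_def)
  interpret group G using lie by (simp add: lie_group_def)
  interpret lie_chart G A U \<phi>
    using lie assms(3,4) U by unfold_locales auto
  have bracket: "lie_bracket G \<kappa> = br" unfolding U by (rule lie_bracket_eq)
  have "br v w = 0" for v w
    by (rule static_zero_imp_abelian[OF br_bilinear br_antisym br_jacobi br_nilpotent[OF nil]
          assms(5)[unfolded bracket] g(1) g(2)[unfolded bracket]])
  then have "is_torus G A \<Gamma>"
    using abelian_nilmanifold_is_torus[OF assms(1,3,4)] bracket by simp
  then show False using assms(2) by simp
qed

end
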